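(* \textsc{Shortest Self-Deleting $s$-$t$-path} can be solved (deterministically) in $2^{O(\mu k)}(n+m)\log n$ time.
   Context: All graphs are finite, simple and undirected; $n=|V(G)|$, $m=|E(G)|$. A self-deleting graph is a pair $(G,f)$ where $G=(V,E)$ is a graph and $f\colon V\to 2^{E}$ (the edges in $f(v)$ need not be incident to $v$). A path $(v_1,e_1,v_2,\dots,e_{k-1},v_k)$ in $G$ (with $e_i=\{v_i,v_{i+1}\}$) is $f$-conforming if $e_i\notin f(v_j)$ for all $j\le i$. Let $\mu=\max_{v\in V}|f(v)|$ (assumed $\ge 1$). In \textsc{Shortest Self-Deleting $s$-$t$-path}, the input is $(G,f)$, vertices $s,t\in V(G)$ and a positive integer $k$, and the question is whether $G$ contains an $f$-conforming $s$-$t$ path on at most $k$ vertices. *)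

theory Defs
  imports Complex_Main
begin

section \<open>Self-deleting graphs\<close>

definition self_deleting_graph :: "'a set \<Rightarrow> 'a set set \<Rightarrow> ('a \<Rightarrow> 'a set set) \<Rightarrow> bool" where
  "self_deleting_graph V E f \<longleftrightarrow>
     finite V \<and> (\<forall>e\<in>E. e \<subseteq> V \<and> card e = 2) \<and> (\<forall>v\<in>V. f v \<subseteq> E)"

text \<open>The graph is simple, so a path is determined by its sequence of vertices.\<close>

definition is_path :: "'a set \<Rightarrow> 'a set set \<Rightarrow> 'a list \<Rightarrow> bool" where
  "is_path V E vs \<longleftrightarrow> vs \<noteq> [] \<and> distinct vs \<and> set vs \<subseteq> V \<and>
     (\<forall>i. Suc i < length vs \<longrightarrow> {vs ! i, vs ! Suc i} \<in> E)"

definition conforming :: "('a \<Rightarrow> 'a set set) \<Rightarrow> 'a list \<Rightarrow> bool" where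
  "conforming f vs \<longleftrightarrow>
     (\<forall>i j. Suc i < length vs \<longrightarrow> j \<le> i \<longrightarrow> {vs ! i, vs ! Suc i} \<notin> f (vs ! j))"

definition has_short_conforming_path ::
  "'a set \<Rightarrow> 'a set set \<Rightarrow> ('a \<Rightarrow> 'a set set) \<Rightarrow> 'a \<Rightarrow> 'a \<Rightarrow> nat \<Rightarrow> bool" where
  "has_short_conforming_path V E f s t k \<longleftrightarrow>
     (\<exists>vs. is_path V E vs \<and> conforming f vs \<and> hd vs = s \<and> last vs = t \<and> length vs \<le> k)"

definition max_deletions :: "'a set \<Rightarrow> ('a \<Rightarrow> 'a set set) \<Rightarrow> nat" where
  "max_deletions V f = Max ((\<lambda>v. card (f v)) ` V)"

section \<open>Deterministic word RAM\<close>

text \<open>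
  A program works on finitely many registers (those it mentions) and a random access memory.
  Registers, memory cells and addresses hold words of \<open>w\<close> bits: arithmetic is modulo \<open>2 ^ w\<close>, except
  that subtraction is truncated at 0. The word length is a parameter of the execution, not of the
  program. Every constant, register access, memory access, arithmetic operation, comparison,
  Boolean connective and control step costs one unit of time.
\<close>

type_synonym reg = nat
type_synonym state = "(reg \<Rightarrow> nat) \<times> (nat \<Rightarrow> nat)"

datatype binop = Plus | Minus | Times | Quot | Rem

datatype aexp = N nat | R reg | M aexp | Bin binop aexp aexp

datatype bexp = Less aexp aexp | Equal aexp aexp | Neg bexp | Conj bexp bexp

datatype com = Skip | Assign reg aexp | Store aexp aexp | Seq com com
  | Cond bexp com com | While bexp com

fun binop_val :: "binop \<Rightarrow> nat \<Rightarrow> nat \<Rightarrow> nat" where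
  "binop_val Plus a b = a + b"
| "binop_val Minus a b = a - b"
| "binop_val Times a b = a * b"
| "binop_val Quot a b = a div b"
| "binop_val Rem a b = a mod b"

fun aval :: "nat \<Rightarrow> aexp \<Rightarrow> state \<Rightarrow> nat" where
  "aval w (N n) \<sigma> = n mod 2 ^ w"
| "aval w (R x) \<sigma> = fst \<sigma> x"
| "aval w (M a) \<sigma> = snd \<sigma> (aval w a \<sigma>)"
| "aval w (Bin p a b) \<sigma> = binop_val p (aval w a \<sigma>) (aval w b \<sigma>) mod 2 ^ w"

fun bval :: "nat \<Rightarrow> bexp \<Rightarrow> state \<Rightarrow> bool" where
  "bval w (Less a b) \<sigma> \<longleftrightarrow> aval w a \<sigma> < aval w b \<sigma>"
| "bval w (Equal a b) \<sigma> \<longleftrightarrow> aval w a \<sigma> = aval w b \<sigma>"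
| "bval w (Neg b) \<sigma> \<longleftrightarrow> \<not> bval w b \<sigma>"
| "bval w (Conj b c) \<sigma> \<longleftrightarrow> bval w b \<sigma> \<and> bval w c \<sigma>"

fun acost :: "aexp \<Rightarrow> nat" where
  "acost (N n) = 1"
| "acost (R x) = 1"
| "acost (M a) = 1 + acost a"
| "acost (Bin p a b) = 1 + acost a + acost b"

fun bcost :: "bexp \<Rightarrow> nat" where
  "bcost (Less a b) = 1 + acost a + acost b"
| "bcost (Equal a b) = 1 + acost a + acost b"
| "bcost (Neg b) = 1 + bcost b"
| "bcost (Conj b c) = 1 + bcost b + bcost c"

text \<open>\<open>exec w P \<sigma> T \<sigma>'\<close>: started in \<open>\<sigma>\<close>, the program \<open>P\<close> halts in \<open>\<sigma>'\<close> after exactly \<open>T\<close> time units.\<close>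

inductive exec :: "nat \<Rightarrow> com \<Rightarrow> state \<Rightarrow> nat \<Rightarrow> state \<Rightarrow> bool" for w :: nat where
  Skip: "exec w Skip \<sigma> 1 \<sigma>"
| Assign: "exec w (Assign x a) \<sigma> (1 + acost a) ((fst \<sigma>)(x := aval w a \<sigma>), snd \<sigma>)"
| Store: "exec w (Store a b) \<sigma> (1 + acost a + acost b)
            (fst \<sigma>, (snd \<sigma>)(aval w a \<sigma> := aval w b \<sigma>))"
| Seq: "exec w P \<sigma> T \<sigma>' \<Longrightarrow> exec w Q \<sigma>' U \<sigma>'' \<Longrightarrow> exec w (Seq P Q) \<sigma> (1 + T + U) \<sigma>''"
| CondTrue: "bval w b \<sigma> \<Longrightarrow> exec w P \<sigma> T \<sigma>' \<Longrightarrow> exec w (Cond b P Q) \<sigma> (1 + bcost b + T) \<sigma>'"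
| CondFalse: "\<not> bval w b \<sigma> \<Longrightarrow> exec w Q \<sigma> T \<sigma>' \<Longrightarrow> exec w (Cond b P Q) \<sigma> (1 + bcost b + T) \<sigma>'"
| WhileFalse: "\<not> bval w b \<sigma> \<Longrightarrow> exec w (While b P) \<sigma> (1 + bcost b) \<sigma>"
| WhileTrue: "bval w b \<sigma> \<Longrightarrow> exec w P \<sigma> T \<sigma>' \<Longrightarrow> exec w (While b P) \<sigma>' U \<sigma>'' \<Longrightarrow>
    exec w (While b P) \<sigma> (1 + bcost b + T + U) \<sigma>''"

inductive_cases exec_SkipE: "exec w Skip \<sigma> T \<sigma>'"
inductive_cases exec_AssignE: "exec w (Assign x a) \<sigma> T \<sigma>'"
inductive_cases exec_StoreE: "exec w (Store a b) \<sigma> T \<sigma>'"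
inductive_cases exec_SeqE: "exec w (Seq P Q) \<sigma> T \<sigma>'"
inductive_cases exec_CondE: "exec w (Cond b P Q) \<sigma> T \<sigma>'"
inductive_cases exec_WhileE: "exec w (While b P) \<sigma> T \<sigma>'"

lemma exec_deterministic:
  "exec w P \<sigma> T \<sigma>' \<Longrightarrow> exec w P \<sigma> U \<sigma>'' \<Longrightarrow> T = U \<and> \<sigma>' = \<sigma>''"
proof (induction arbitrary: U \<sigma>'' rule: exec.induct)
  case (Skip \<sigma>)
  then show ?case by (auto elim: exec_SkipE)
next
  case (Assign x a \<sigma>)
  then show ?case by (auto elim: exec_AssignE)
next
  case (Store a b \<sigma>)
  then show ?case by (auto elim: exec_StoreE)
next
  case (Seq P \<sigma> T \<sigma>' Q U' \<sigma>3)
  from Seq.prems obtain T2 \<tau> U2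
    where *: "U = Suc (T2 + U2)" "exec w P \<sigma> T2 \<tau>" "exec w Q \<tau> U2 \<sigma>''"
    by (rule exec_SeqE)
  have "T = T2" "\<sigma>' = \<tau>" using Seq.IH(1)[OF *(2)] by auto
  moreover from this have "U' = U2 \<and> \<sigma>3 = \<sigma>''" using Seq.IH(2) *(3) by blast
  ultimately show ?case using *(1) by simp
next
  case (CondTrue b \<sigma> P T \<sigma>' Q)
  then obtain T2 where *: "U = Suc (bcost b + T2)" "exec w P \<sigma> T2 \<sigma>''"
    by (auto elim: exec_CondE)
  show ?case using CondTrue.IH[OF *(2)] *(1) by simp
next
  case (CondFalse b \<sigma> Q T \<sigma>' P)
  then obtain T2 where *: "U = Suc (bcost b + T2)" "exec w Q \<sigma> T2 \<sigma>''"
    by (auto elim: exec_CondE)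
  show ?case using CondFalse.IH[OF *(2)] *(1) by simp
next
  case (WhileFalse b \<sigma> P)
  from WhileFalse.prems WhileFalse.hyps show ?case by (auto elim: exec_WhileE)
next
  case (WhileTrue b \<sigma> P T \<sigma>' U' \<sigma>3)
  from WhileTrue.prems WhileTrue.hyps(1) obtain T2 \<tau> U2
    where *: "U = Suc (bcost b + T2 + U2)" "exec w P \<sigma> T2 \<tau>" "exec w (While b P) \<tau> U2 \<sigma>''"
    by (auto elim: exec_WhileE)
  have "T = T2" "\<sigma>' = \<tau>" using WhileTrue.IH(1)[OF *(2)] by auto
  moreover from this have "U' = U2 \<and> \<sigma>3 = \<sigma>''" using WhileTrue.IH(2) *(3) by blast
  ultimately show ?case using *(1) by simp
qed

definition words_fit :: "nat \<Rightarrow> state \<Rightarrow> bool" where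
  "words_fit w \<sigma> \<longleftrightarrow> (\<forall>x. fst \<sigma> x < 2 ^ w) \<and> (\<forall>i. snd \<sigma> i < 2 ^ w)"

lemma aval_fits: "words_fit w \<sigma> \<Longrightarrow> aval w a \<sigma> < 2 ^ w"
  by (induction a) (auto simp: words_fit_def)

lemma exec_fits: "exec w P \<sigma> T \<sigma>' \<Longrightarrow> words_fit w \<sigma> \<Longrightarrow> words_fit w \<sigma>'"
  by (induction rule: exec.induct) (auto simp: words_fit_def aval_fits[unfolded words_fit_def])

text \<open>The input occupies an initial segment of the memory; everything else is 0.\<close>

definition initial_state :: "nat \<Rightarrow> nat list \<Rightarrow> state" where
  "initial_state w ws = (\<lambda>x. 0, \<lambda>i. if i < length ws then ws ! i mod 2 ^ w else 0)"

lemma initial_state_fits: "words_fit w (initial_state w ws)"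
  by (simp add: words_fit_def initial_state_def)

text \<open>The answer is returned in register 0: 1 for yes, 0 for no.\<close>

definition halts_with :: "nat \<Rightarrow> com \<Rightarrow> nat list \<Rightarrow> nat \<Rightarrow> bool \<Rightarrow> bool" where
  "halts_with w P ws T ans \<longleftrightarrow>
     (\<exists>\<sigma>. exec w P (initial_state w ws) T \<sigma> \<and> fst \<sigma> 0 = (if ans then 1 else 0))"

section \<open>Encoding of instances\<close>

text \<open>
  An instance on the vertices \<open>0, \<dots>, n - 1\<close> is given by a list \<open>es\<close> of the edges, without repetition
  but in arbitrary order and orientation, and for each vertex \<open>v\<close> a list \<open>fs ! v\<close> of the positions in
  \<open>es\<close> of the edges in \<open>f v\<close>, again without repetition and in arbitrary order. The words of the input
  are \<open>n\<close>, \<open>m\<close>, \<open>k\<close>, \<open>s\<close>, \<open>t\<close>, the end points of the edges, the lengths of the lists \<open>fs ! v\<close>, and then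
  these lists one after the other.
\<close>

definition edge_of :: "nat \<times> nat \<Rightarrow> nat set" where
  "edge_of p = {fst p, snd p}"

definition encodes ::
  "nat list \<Rightarrow> nat \<Rightarrow> nat set set \<Rightarrow> (nat \<Rightarrow> nat set set) \<Rightarrow> nat \<Rightarrow> nat \<Rightarrow> nat \<Rightarrow> bool" where
  "encodes ws n E f s t k \<longleftrightarrow>
     (\<exists>es fs.
        distinct (map edge_of es) \<and> set (map edge_of es) = E \<and>
        length fs = n \<and>
        (\<forall>v<n. distinct (fs ! v) \<and> set (fs ! v) \<subseteq> {..<length es} \<and>
                (\<lambda>i. edge_of (es ! i)) ` set (fs ! v) = f v) \<and>
        ws = [n, length es, k, s, t] @ concat (map (\<lambda>(u, v). [u, v]) es)
               @ map length fs @ concat fs)"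

end

theory Submission
  imports Defs "HOL-Number_Theory.Number_Theory"
begin

text \<open>
  A shortest conforming walk is a path, so it suffices to look for walks. Working backwards from \<open>t\<close>,
  a walk with edge positions \<open>e\<^sub>1, e\<^sub>2, \<dots>\<close> is represented by the polynomial \<open>c(x) = \<Prod>\<^sub>i (x - e\<^sub>i)\<close> modulo
  a small prime \<open>P\<close>; prepending a vertex \<open>u\<close> is allowed if \<open>c\<close> does not vanish on \<open>f(u)\<close>. Whether the walk
  can be extended by a given prefix depends only on \<open>\<Prod>\<^sub>x c(x)\<close>, taken over the at most \<open>\<mu> k\<close> edges \<open>x\<close>
  deleted by the prefix, and this is a linear function of the vector of monomials of degree at most
  \<open>\<mu> k\<close> in the coefficients of \<open>c\<close>. Hence for every vertex and every length it suffices to keep walks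
  whose monomial vectors form a basis of the span; with \<open>L = 2 \<mu> k\<close> these are at most \<open>2 ^ L\<close> many, found
  by incremental Gaussian elimination over the field with \<open>P\<close> elements.

  This is sound for every prime, and complete if the positions of the at most \<open>L\<close> edges that matter
  for a fixed path are distinct modulo \<open>P\<close>. A bad prime divides the product of the differences of these
  positions, which has fewer than \<open>K = O(L\<^sup>2 log m)\<close> prime factors, so trying the first \<open>K\<close> primes is
  enough. They are all at most \<open>2 K\<^sup>2\<close>, by a weak form of Chebyshev's bound, and can be found by trial
  division.
\<close>

section \<open>Total correctness with time bounds\<close>

text \<open>A vertex deletes only edges that come after it, so for prepending vertices a suffix of a
  walk matters only through its set of edges; hence the search starts at \<open>t\<close>. The
  modulus is forced by the word length: integer coefficients would need about \<open>k log m\<close>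
  bits. It costs nothing in soundness, because a deleted edge on the walk makes the polynomial
  exactly 0 at its position. \<open>L = 2 * \<mu> * k\<close> is used twice: it bounds the at most
  \<open>\<mu> * k\<close> factors of a product plus a degree of at most \<open>k\<close>, and also
  the number of relevant positions. A monomial is a lattice path of \<open>L\<close> bits, one per
  factor or change of index, so \<open>D = 2 ^ L\<close> is both the vector length and the capacity
  of a cell. Spans appear only in dual form: a vector belongs to a span if every functional that is
  0 modulo \<open>P\<close> on the generators is 0 on it. This is exactly what completeness
  consumes, and it avoids explicit linear combinations. In the running time each prime costs
  \<open>D ^ 5 (n + m)\<close> up to a constant, and the number \<open>K\<close> of primes supplies
  the logarithm; testing candidates costs about \<open>K ^ 4\<close>, whose \<open>lg ^ 4\<close> is
  absorbed by \<open>m\<close>.\<close>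

definition runs :: "nat \<Rightarrow> com \<Rightarrow> (reg \<Rightarrow> nat) \<Rightarrow> (nat \<Rightarrow> nat) \<Rightarrow> nat \<Rightarrow>
    ((reg \<Rightarrow> nat) \<Rightarrow> (nat \<Rightarrow> nat) \<Rightarrow> bool) \<Rightarrow> bool" where
  "runs w P r m B Q \<longleftrightarrow> (\<exists>T r' m'. exec w P (r, m) T (r', m') \<and> T \<le> B \<and> Q r' m')"

lemma runs_mono:
  "runs w P r m B Q \<Longrightarrow> B \<le> B' \<Longrightarrow> (\<And>r' m'. Q r' m' \<Longrightarrow> Q' r' m') \<Longrightarrow> runs w P r m B' Q'"
  unfolding runs_def by (meson le_trans)

lemma runs_Seq:
  assumes "runs w P r m B Q0" and "\<And>r' m'. Q0 r' m' \<Longrightarrow> runs w P' r' m' B' Q"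
    and "1 + B + B' \<le> C"
  shows "runs w (Seq P P') r m C Q"
proof -
  obtain T r1 m1 where 1: "exec w P (r, m) T (r1, m1)" "T \<le> B" "Q0 r1 m1"
    using assms(1) by (auto simp: runs_def)
  obtain U r2 m2 where 2: "exec w P' (r1, m1) U (r2, m2)" "U \<le> B'" "Q r2 m2"
    using assms(2)[OF 1(3)] by (auto simp: runs_def)
  show ?thesis
    unfolding runs_def using exec.Seq[OF 1(1) 2(1)] 1(2) 2(2,3) assms(3)
    by (intro exI[of _ "1 + T + U"] exI[of _ r2] exI[of _ m2]) simp
qed

lemma runs_Cond:
  assumes "bval w b (r, m) \<Longrightarrow> runs w P r m B Q" and "\<not> bval w b (r, m) \<Longrightarrow> runs w P' r m B Q"
    and "1 + bcost b + B \<le> C"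
  shows "runs w (Cond b P P') r m C Q"
proof (cases "bval w b (r, m)")
  case True
  then obtain T r1 m1 where "exec w P (r, m) T (r1, m1)" "T \<le> B" "Q r1 m1"
    using assms(1) by (auto simp: runs_def)
  then show ?thesis
    unfolding runs_def using exec.CondTrue[OF True] assms(3)
    by (intro exI[of _ "1 + bcost b + T"] exI[of _ r1] exI[of _ m1]) simp
next
  case False
  then obtain T r1 m1 where "exec w P' (r, m) T (r1, m1)" "T \<le> B" "Q r1 m1"
    using assms(2) by (auto simp: runs_def)
  then show ?thesis
    unfolding runs_def using exec.CondFalse[OF False] assms(3)
    by (intro exI[of _ "1 + bcost b + T"] exI[of _ r1] exI[of _ m1]) simp
qed

text \<open>The potential \<open>\<Phi>\<close> pays for all remaining iterations.\<close>

lemma runs_While_potential: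
  fixes I :: "(reg \<Rightarrow> nat) \<Rightarrow> (nat \<Rightarrow> nat) \<Rightarrow> bool" and \<Phi> :: "(reg \<Rightarrow> nat) \<Rightarrow> nat"
  assumes "I r m"
    and step: "\<And>r m. I r m \<Longrightarrow> bval w b (r, m) \<Longrightarrow>
      \<exists>B. runs w P r m B (\<lambda>r' m'. I r' m' \<and> 1 + bcost b + B + \<Phi> r' \<le> \<Phi> r)"
  shows "runs w (While b P) r m (1 + bcost b + \<Phi> r) (\<lambda>r' m'. I r' m' \<and> \<not> bval w b (r', m'))"
  using assms(1)
proof (induction "\<Phi> r" arbitrary: r m rule: less_induct)
  case less
  show ?case
  proof (cases "bval w b (r, m)")
    case False
    then show ?thesis
      unfolding runs_def using less.prems exec.WhileFalse[OF False, of P]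
      by (intro exI[of _ "1 + bcost b"] exI[of _ r] exI[of _ m]) simp
  next
    case True
    obtain B T r1 m1 where 1: "exec w P (r, m) T (r1, m1)" "T \<le> B" "I r1 m1"
      "1 + bcost b + B + \<Phi> r1 \<le> \<Phi> r"
      using step[OF less.prems True] by (auto simp: runs_def)
    have "\<Phi> r1 < \<Phi> r" using 1(4) by simp
    from less.hyps[OF this 1(3)] obtain U r2 m2 where 2: "exec w (While b P) (r1, m1) U (r2, m2)"
      "U \<le> 1 + bcost b + \<Phi> r1" "I r2 m2" "\<not> bval w b (r2, m2)"
      by (auto simp: runs_def)
    show ?thesis
      unfolding runs_def using exec.WhileTrue[OF True 1(1) 2(1)] 1(2,4) 2(2,3,4)
      by (intro exI[of _ "1 + bcost b + T + U"] exI[of _ r2] exI[of _ m2]) simp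
  qed
qed

text \<open>For counting loops: the number \<open>l\<close> of iterations is known beforehand and
  serves as the termination measure.\<close>

lemma runs_While:
  fixes I :: "nat \<Rightarrow> (reg \<Rightarrow> nat) \<Rightarrow> (nat \<Rightarrow> nat) \<Rightarrow> bool"
  assumes "I 0 r m"
    and step: "\<And>j r m. j < l \<Longrightarrow> I j r m \<Longrightarrow> bval w b (r, m) \<and> runs w P r m B (I (Suc j))"
    and final: "\<And>r m. I l r m \<Longrightarrow> \<not> bval w b (r, m)"
    and C: "l * (1 + bcost b + B) + 1 + bcost b \<le> C"
  shows "runs w (While b P) r m C (I l)"
proof -
  have "runs w (While b P) r m ((l - j) * (1 + bcost b + B) + 1 + bcost b) (I l)"
    if "j \<le> l" "I j r m" for j r m
    using that
  proof (induction "l - j" arbitrary: j r m)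
    case 0
    then have "\<not> bval w b (r, m)" "I l r m" using final[of r m] by auto
    then show ?case
      unfolding runs_def using exec.WhileFalse[of w b "(r, m)" P] 0
      by (intro exI[of _ "1 + bcost b"] exI[of _ r] exI[of _ m]) simp
  next
    case (Suc x)
    then have j: "j < l" by simp
    from step[OF j Suc.prems(2)] obtain T r1 m1 where 1: "bval w b (r, m)"
      "exec w P (r, m) T (r1, m1)" "T \<le> B" "I (Suc j) r1 m1"
      by (auto simp: runs_def)
    have "x = l - Suc j" using Suc by simp
    from Suc.hyps(1)[OF this _ 1(4)] j obtain U r2 m2 where 2: "exec w (While b P) (r1, m1) U (r2, m2)"
      "U \<le> (l - Suc j) * (1 + bcost b + B) + 1 + bcost b" "I l r2 m2"
      by (auto simp: runs_def)
    have "l - j = Suc (l - Suc j)" using j by simp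
    then have "1 + bcost b + T + U \<le> (l - j) * (1 + bcost b + B) + 1 + bcost b"
      using 1(3) 2(2) by simp
    then show ?case
      unfolding runs_def using exec.WhileTrue[OF 1(1,2) 2(1)] 2(3)
      by (intro exI[of _ "1 + bcost b + T + U"] exI[of _ r2] exI[of _ m2]) simp
  qed
  from this[OF _ assms(1)] C show ?thesis by (auto intro: runs_mono)
qed

text \<open>Evaluation in \<open>\<nat>\<close>; it agrees with \<^const>\<open>aval\<close> as long as no intermediate result overflows.\<close>

fun av :: "aexp \<Rightarrow> (reg \<Rightarrow> nat) \<Rightarrow> (nat \<Rightarrow> nat) \<Rightarrow> nat" where
  "av (N n) r m = n"
| "av (R x) r m = r x"
| "av (M a) r m = m (av a r m)"
| "av (Bin p a b) r m = binop_val p (av a r m) (av b r m)"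

fun safe :: "nat \<Rightarrow> aexp \<Rightarrow> (reg \<Rightarrow> nat) \<Rightarrow> (nat \<Rightarrow> nat) \<Rightarrow> bool" where
  "safe w (N n) r m \<longleftrightarrow> n < 2 ^ w"
| "safe w (R x) r m \<longleftrightarrow> True"
| "safe w (M a) r m \<longleftrightarrow> safe w a r m"
| "safe w (Bin p a b) r m \<longleftrightarrow> safe w a r m \<and> safe w b r m \<and>
     binop_val p (av a r m) (av b r m) < 2 ^ w"

lemma aval_safe: "safe w a r m \<Longrightarrow> aval w a (r, m) = av a r m"
  by (induction a) auto

fun bv :: "bexp \<Rightarrow> (reg \<Rightarrow> nat) \<Rightarrow> (nat \<Rightarrow> nat) \<Rightarrow> bool" where
  "bv (Less a b) r m \<longleftrightarrow> av a r m < av b r m"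
| "bv (Equal a b) r m \<longleftrightarrow> av a r m = av b r m"
| "bv (Neg b) r m \<longleftrightarrow> \<not> bv b r m"
| "bv (Conj b c) r m \<longleftrightarrow> bv b r m \<and> bv c r m"

fun bsafe :: "nat \<Rightarrow> bexp \<Rightarrow> (reg \<Rightarrow> nat) \<Rightarrow> (nat \<Rightarrow> nat) \<Rightarrow> bool" where
  "bsafe w (Less a b) r m \<longleftrightarrow> safe w a r m \<and> safe w b r m"
| "bsafe w (Equal a b) r m \<longleftrightarrow> safe w a r m \<and> safe w b r m"
| "bsafe w (Neg b) r m \<longleftrightarrow> bsafe w b r m"
| "bsafe w (Conj b c) r m \<longleftrightarrow> bsafe w b r m \<and> bsafe w c r m"

lemma bval_bsafe: "bsafe w b r m \<Longrightarrow> bval w b (r, m) = bv b r m"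
  by (induction b) (auto simp: aval_safe)

text \<open>Weakest preconditions for loop-free code, with absence of overflow as an obligation at
  every expression. A loop that is reached makes \<open>wpb\<close> false, so loops are left to the
  \<open>While\<close> rules and the value 0 of \<open>cost_bound\<close> on them is
  harmless.\<close>

fun wpb :: "nat \<Rightarrow> com \<Rightarrow> ((reg \<Rightarrow> nat) \<Rightarrow> (nat \<Rightarrow> nat) \<Rightarrow> bool) \<Rightarrow> (reg \<Rightarrow> nat) \<Rightarrow> (nat \<Rightarrow> nat) \<Rightarrow> bool"
  where
  "wpb w Skip Q r m \<longleftrightarrow> Q r m"
| "wpb w (Assign x a) Q r m \<longleftrightarrow> safe w a r m \<and> Q (r(x := av a r m)) m"
| "wpb w (Store a b) Q r m \<longleftrightarrow> safe w a r m \<and> safe w b r m \<and> Q r (m(av a r m := av b r m))"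
| "wpb w (Seq P P') Q r m \<longleftrightarrow> wpb w P (wpb w P' Q) r m"
| "wpb w (Cond b P P') Q r m \<longleftrightarrow> bsafe w b r m \<and>
     (bv b r m \<longrightarrow> wpb w P Q r m) \<and> (\<not> bv b r m \<longrightarrow> wpb w P' Q r m)"
| "wpb w (While b P) Q r m \<longleftrightarrow> False"

fun cost_bound :: "com \<Rightarrow> nat" where
  "cost_bound Skip = 1"
| "cost_bound (Assign x a) = 1 + acost a"
| "cost_bound (Store a b) = 1 + acost a + acost b"
| "cost_bound (Seq P P') = 1 + cost_bound P + cost_bound P'"
| "cost_bound (Cond b P P') = 1 + bcost b + max (cost_bound P) (cost_bound P')"
| "cost_bound (While b P) = 0"

lemma runs_wpb: "wpb w P Q r m \<Longrightarrow> cost_bound P \<le> B \<Longrightarrow> runs w P r m B Q"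
proof (induction P arbitrary: Q r m B)
  case Skip
  then show ?case using exec.Skip[of w "(r, m)"] by (auto simp: runs_def)
next
  case (Assign x a)
  then show ?case using exec.Assign[of w x a "(r, m)"] by (auto simp: runs_def aval_safe)
next
  case (Store a b)
  then show ?case using exec.Store[of w a b "(r, m)"] by (auto simp: runs_def aval_safe)
next
  case (Seq P P')
  show ?case
  proof (rule runs_Seq)
    show "runs w P r m (cost_bound P) (wpb w P' Q)" using Seq by simp
    show "runs w P' r' m' (cost_bound P') Q" if "wpb w P' Q r' m'" for r' m'
      using that Seq by simp
    show "1 + cost_bound P + cost_bound P' \<le> B" using Seq by simp
  qed
next
  case (Cond b P P')
  show ?case
    using Cond by (intro runs_Cond[where B = "max (cost_bound P) (cost_bound P')"])
      (auto simp: bval_bsafe)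
next
  case (While b P)
  then show ?case by simp
qed

lemma runs_Seq_wpb:
  assumes "wpb w P (\<lambda>r' m'. runs w P' r' m' B' Q) r m" and "1 + cost_bound P + B' \<le> C"
  shows "runs w (Seq P P') r m C Q"
  using assms by (intro runs_Seq[OF runs_wpb[OF assms(1) order.refl]]) auto

section \<open>Many small primes\<close>

text \<open>The Leibniz harmonic triangle: \<open>1 / (m * (n choose m))\<close> is a difference of two entries of
  column \<open>m - 1\<close>, so a common multiple \<open>d\<close> of \<open>1, \<dots>, l\<close> clears all denominators up to row \<open>l\<close>.\<close>

lemma leibniz_step:
  assumes "0 < i" "i < n"
  shows "1 / (real (Suc i) * real (n choose Suc i)) =
    1 / (real i * real ((n - 1) choose i)) - 1 / (real i * real (n choose i))"
proof -
  obtain n' where n: "n = Suc n'" using assms by (cases n) auto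
  have pos: "real (n' choose i) > 0" "real (n choose i) > 0" "real (n choose Suc i) > 0"
    using assms n by (auto simp: zero_less_binomial_iff simp del: binomial_Suc_Suc)
  have a: "real (Suc i) * real (n choose Suc i) = real n * real (n' choose i)"
    using Suc_times_binomial[of i n'] n by (metis of_nat_mult)
  have "(n - i) * (n choose i) = n * ((n - 1) choose i)" by (rule binomial_absorb_comp)
  then have b: "(real n - real i) * real (n choose i) = real n * real (n' choose i)"
    using assms n by (metis diff_Suc_1 less_imp_le of_nat_diff of_nat_mult)
  have ni: "real n - real i > 0" "real n > 0" "real i > 0" using assms by auto
  have c: "real (n choose i) = real n * real (n' choose i) / (real n - real i)"
    using b ni by (simp add: field_simps)
  have "1 / (y * x) = 1 / (z * x) - 1 / (z * (y * x / (y - z)))"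
    if "x > 0" "y - z > 0" "z > 0" "y > 0" for x y z :: real
    using that by (simp add: field_simps)
  from this[OF pos(1) ni(1,3,2)] show ?thesis
    unfolding a c using n by simp
qed

lemma mult_binomial_dvd:
  fixes d :: nat
  assumes d: "\<And>j. 0 < j \<Longrightarrow> j \<le> l \<Longrightarrow> j dvd d"
    and "0 < i" "i \<le> n" "n \<le> l"
  shows "i * (n choose i) dvd d"
proof -
  \<comment> \<open>As integrality of a quotient, the claim passes from column \<open>i\<close> to
    column \<open>i + 1\<close> by a subtraction; divisibility is recovered at the end.\<close>
  have "real d / (real i * real (n choose i)) \<in> \<int>"
    using assms(2-)
  proof (induction i arbitrary: n rule: nat_induct_non_zero)
    case 1
    then have "n dvd d" using d by simp
    then obtain x where "d = n * x" ..
    then show ?case using 1 by simp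
  next
    case (Suc i)
    have "real d / (real (Suc i) * real (n choose Suc i)) =
      real d / (real i * real ((n - 1) choose i)) - real d / (real i * real (n choose i))"
      using leibniz_step[of i n] Suc.hyps Suc.prems
      by (metis (no_types, lifting) Suc_le_eq mult.right_neutral right_diff_distrib times_divide_eq_right)
    moreover have "real d / (real i * real ((n - 1) choose i)) \<in> \<int>"
      using Suc.prems by (intro Suc.IH) auto
    moreover have "real d / (real i * real (n choose i)) \<in> \<int>"
      using Suc.prems by (intro Suc.IH) auto
    ultimately show ?case by simp
  qed
  then obtain z where z: "real d / (real i * real (n choose i)) = of_int z" by (elim Ints_cases)
  have "real i * real (n choose i) \<noteq> 0" using assms by simp
  then have "real d = of_int z * (real i * real (n choose i))" using z by (simp add: field_simps)
  then have "real_of_int (int d) = real_of_int (z * int (i * (n choose i)))" by simp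
  then have "int d = z * int (i * (n choose i))" by (simp only: of_int_eq_iff)
  then have "int (i * (n choose i)) dvd int d" by simp
  then show ?thesis by (simp only: int_dvd_int_iff)
qed

text \<open>For \<open>l = 2 n\<close> the least common multiple of \<open>1, ..., l\<close> is at
  most \<open>l\<close> to the power of the number of primes up to \<open>l\<close>, but it is a
  multiple of \<open>n * (2 n choose n)\<close> and hence at least \<open>4 ^ n / 2\<close>. With
  \<open>n = K ^ 2\<close> and fewer than \<open>K\<close> primes the upper bound falls below the
  lower one.\<close>

lemma many_primes:
  fixes K :: nat
  assumes "K \<ge> 2"
  shows "K \<le> card {p. prime p \<and> p \<le> 2 * K\<^sup>2}"
proof (rule ccontr)
  define l where "l = 2 * K\<^sup>2"
  define A where "A = {p. prime p \<and> p \<le> l}"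
  \<comment> \<open>The least common multiple of \<open>1, ..., l\<close>: for each prime its
    largest power not exceeding \<open>l\<close>.\<close>
  define d where "d = (\<Prod>p\<in>A. p ^ (GREATEST a. p ^ a \<le> l))"
  assume "\<not> ?thesis"
  then have card: "card A < K" by (simp add: A_def l_def)
  have fin: "finite A" unfolding A_def by (rule finite_subset[of _ "{..l}"]) auto
  have l: "l > 1" using assms power_mono[of 2 K 2] by (simp add: l_def)
  have bnd: "a \<le> l" if "p ^ a \<le> l" "p \<in> A" for p a
  proof -
    have "p \<ge> 2" using that by (simp add: A_def prime_ge_2_nat)
    then have "a < p ^ a" by (intro less_le_trans[OF less_exp power_mono]) auto
    then show ?thesis using that by simp
  qed
  have G: "p ^ (GREATEST a. p ^ a \<le> l) \<le> l" if "p \<in> A" for p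
    by (rule GreatestI_nat[of "\<lambda>a. p ^ a \<le> l" 0 l]) (use bnd[OF _ that] l in simp_all)
  have Gle: "a \<le> (GREATEST a. p ^ a \<le> l)" if "p \<in> A" "p ^ a \<le> l" for p a
    by (rule Greatest_le_nat[of "\<lambda>a. p ^ a \<le> l" a l]) (use bnd[OF _ that(1)] that(2) in simp_all)
  have dvd: "j dvd d" if "0 < j" "j \<le> l" for j
  proof (rule multiplicity_le_imp_dvd)
    show "j \<noteq> 0" using that by simp
    fix p :: nat assume p: "prime p"
    have d0: "d \<noteq> 0" unfolding d_def using fin by (auto simp: A_def)
    show "multiplicity p j \<le> multiplicity p d"
    proof (cases "p \<in> A")
      case True
      have "p ^ multiplicity p j dvd j" by (rule multiplicity_dvd)
      then have "p ^ multiplicity p j \<le> l" using that by (meson dvd_imp_le le_trans)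
      then have "multiplicity p j \<le> (GREATEST a. p ^ a \<le> l)" by (rule Gle[OF True])
      moreover have "p ^ (GREATEST a. p ^ a \<le> l) dvd d"
        unfolding d_def by (rule dvd_prodI[OF fin True])
      ultimately have "p ^ multiplicity p j dvd d" by (meson dvd_trans le_imp_power_dvd)
      then show ?thesis using d0 p by (intro multiplicity_geI) auto
    next
      case False
      then have "\<not> p dvd j" using that p by (auto simp: A_def dest: dvd_imp_le)
      then show ?thesis by (simp add: not_dvd_imp_multiplicity_0)
    qed
  qed
  have "d \<le> (\<Prod>p\<in>A. l)" unfolding d_def by (intro prod_mono) (auto simp: G)
  also have "\<dots> = l ^ card A" by simp
  also have "\<dots> \<le> l ^ (K - 1)" using card l by (intro power_increasing) auto
  finally have up: "d \<le> l ^ (K - 1)" .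
  define n where "n = K\<^sup>2"
  have n: "n > 0" "l = 2 * n" using assms by (auto simp: n_def l_def)
  have "n * ((2 * n) choose n) dvd d" using n dvd by (intro mult_binomial_dvd[of l]) auto
  moreover have "d > 0" unfolding d_def by (intro prod_pos) (auto simp: A_def prime_gt_0_nat)
  ultimately have low: "n * ((2 * n) choose n) \<le> d" by (rule dvd_imp_le)
  have "4 ^ n / (2 * real n) \<le> real ((2 * n) choose n)" by (rule central_binomial_lower_bound[OF n(1)])
  then have "real (4 ^ n) \<le> real (2 * (n * ((2 * n) choose n)))" using n by (simp add: field_simps)
  then have "4 ^ n \<le> 2 * (n * ((2 * n) choose n))" by (simp only: of_nat_le_iff)
  also have "\<dots> \<le> 2 * l ^ (K - 1)" using low up by simp
  finally have le: "4 ^ n \<le> 2 * l ^ (K - 1)" .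
  \<comment> \<open>This crude bound gives \<open>l \<le> 2 ^ (2 * K - 1)\<close>, so the exponent
    of the upper bound on \<open>4 ^ n\<close> is quadratic in \<open>K\<close> with leading term
    \<open>2 * K ^ 2\<close> and a negative linear term.\<close>
  have "K \<le> 2 ^ (K - 1)"
    using less_exp[of "K - 1"] assms by linarith
  then have "K\<^sup>2 \<le> (2 ^ (K - 1))\<^sup>2" by (rule power_mono) simp
  then have "l \<le> 2 * 2 ^ (2 * (K - 1))" by (simp add: l_def power_mult[symmetric] mult.commute)
  then have "l \<le> 2 ^ (2 * K - 1)" using assms by (cases K) auto
  then have "2 * l ^ (K - 1) \<le> 2 * (2 ^ (2 * K - 1)) ^ (K - 1)"
    by (intro mult_left_mono power_mono) auto
  also have "\<dots> = 2 ^ (1 + (2 * K - 1) * (K - 1))" by (simp add: power_mult[symmetric])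
  also have "\<dots> < 2 ^ (2 * n)"
  proof (rule power_strict_increasing)
    obtain K' where K': "K = Suc (Suc K')" using assms by (metis Suc_le_D numeral_2_eq_2 Suc_le_mono)
    show "1 + (2 * K - 1) * (K - 1) < 2 * n" by (simp add: K' n_def power2_eq_square algebra_simps)
  qed simp
  also have "2 ^ (2 * n) = (4::nat) ^ n" by (simp add: power_mult)
  finally show False using le by simp
qed

lemma card_prime_divisors_less:
  fixes d :: nat
  assumes "d \<noteq> 0" "d < 2 ^ K" "finite A" "\<And>p. p \<in> A \<Longrightarrow> prime p \<and> p dvd d"
  shows "card A < K"
proof -
  have "\<Prod>A dvd d"
    using assms(3,4)
  proof (induction A)
    case (insert p A)
    then have "coprime p (\<Prod>A)"
      by (intro prod_coprime_right) (metis insertCI primes_coprime)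
    then show ?case using insert by (auto intro: divides_mult)
  qed simp
  then have "\<Prod>A \<le> d" using assms(1) by (auto intro: dvd_imp_le)
  moreover have "2 ^ card A \<le> \<Prod>A"
    using prod_mono[of A "\<lambda>_. 2" "\<lambda>p. p"] assms(4) by (auto simp: prime_ge_2_nat)
  ultimately have "(2::nat) ^ card A < 2 ^ K" using assms(2) by linarith
  then show ?thesis by simp
qed

text \<open>A prime fails to be injective only if it divides the product of all differences.\<close>

lemma exists_injective_prime:
  fixes U :: "nat set" and A :: "nat set"
  assumes "finite U" "card U \<le> l" "\<And>x. x \<in> U \<Longrightarrow> x < 2 ^ b"
    and "finite A" "\<And>p. p \<in> A \<Longrightarrow> prime p" "l * l * b \<le> card A" "0 < l * l * b"
  shows "\<exists>p\<in>A. inj_on (\<lambda>x. x mod p) U"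
proof (rule ccontr)
  assume neg: "\<not> ?thesis"
  define S where "S = {z \<in> U \<times> U. snd z < fst z}"
  define d where "d = (\<Prod>z\<in>S. fst z - snd z)"
  have finS: "finite S" unfolding S_def using assms(1) by simp
  have "card S \<le> card (U \<times> U)" unfolding S_def using assms(1) by (intro card_mono) auto
  also have "\<dots> \<le> l * l" using assms(2) by (simp add: card_cartesian_product mult_le_mono)
  finally have cS: "card S \<le> l * l" .
  have d0: "d \<noteq> 0" unfolding d_def using finS by (auto simp: S_def)
  have dvd: "p dvd d" if "p \<in> A" for p
  proof -
    obtain x y where xy: "x \<in> U" "y \<in> U" "x \<noteq> y" "x mod p = y mod p"
      using neg \<open>p \<in> A\<close> by (auto simp: inj_on_def)
    have "\<exists>x y. x \<in> U \<and> y \<in> U \<and> y < x \<and> x mod p = y mod p"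
      using xy by (metis nat_neq_iff)
    then obtain x y where xy: "x \<in> U" "y \<in> U" "y < x" "x mod p = y mod p" by blast
    then have "p dvd x - y" by (simp add: mod_eq_dvd_iff_nat)
    moreover have "x - y dvd d" unfolding d_def
      using dvd_prodI[OF finS, of "(x, y)" "\<lambda>z. fst z - snd z"] xy by (simp add: S_def)
    ultimately show ?thesis by (rule dvd_trans)
  qed
  have "card A < l * l * b"
  \<comment> \<open>The strict bound on \<open>d\<close> needs at least one factor. Without pairs
    \<open>d = 1\<close>, no prime divides it, and \<open>A\<close> is empty.\<close>
  proof (cases "b = 0 \<or> S = {}")
    case True
    with assms(7) have "S = {}" by auto
    then have "d = 1" by (simp add: d_def)
    then have "A = {}" using dvd assms(5) by (metis all_not_in_conv nat_dvd_1_iff_1 not_prime_1)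
    then show ?thesis using assms(7) by simp
  next
    case False
    have lt: "fst z - snd z < 2 ^ b" if "z \<in> S" for z
      using that assms(3) by (auto simp: S_def intro: le_less_trans[OF diff_le_self])
    obtain z where "z \<in> S" using False by auto
    then have "d < (\<Prod>z\<in>S. 2 ^ b)"
      unfolding d_def using lt by (intro prod_mono_strict[OF _ _ finS, of z]) (auto intro: less_imp_le)
    also have "\<dots> = 2 ^ (b * card S)" by (simp add: power_mult)
    also have "\<dots> \<le> 2 ^ (l * l * b)" using cS by (intro power_increasing) (auto simp: mult.commute)
    finally show ?thesis using d0 dvd assms(4,5) by (intro card_prime_divisors_less) auto
  qed
  then show False using assms(6) by simp
qed

section \<open>Walks\<close>

text \<open>The walk is recorded together with the positions of its edges in \<open>es\<close>.\<close>

fun conforming_walk :: "(nat \<times> nat) list \<Rightarrow> nat list list \<Rightarrow> nat list \<Rightarrow> nat list \<Rightarrow> bool" where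
  "conforming_walk es fs [v] [] \<longleftrightarrow> True"
| "conforming_walk es fs (u # v # vs) (e # l) \<longleftrightarrow>
     e < length es \<and> edge_of (es ! e) = {u, v} \<and> set (fs ! u) \<inter> set (e # l) = {} \<and>
     conforming_walk es fs (v # vs) l"
| "conforming_walk es fs _ _ \<longleftrightarrow> False"

fun steps :: "'a list \<Rightarrow> 'a set set" where
  "steps (u # v # vs) = insert {u, v} (steps (v # vs))"
| "steps _ = {}"

lemma steps_conv_nth: "steps vs = {{vs ! i, vs ! Suc i} | i. Suc i < length vs}"
proof (induction vs rule: steps.induct)
  case (1 u v vs)
  have "{{(u # v # vs) ! i, (u # v # vs) ! Suc i} | i. Suc i < length (u # v # vs)} =
    insert {u, v} {{(v # vs) ! i, (v # vs) ! Suc i} | i. Suc i < length (v # vs)}"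
    (is "?A = insert _ ?B")
  proof (intro equalityI subsetI)
    fix x assume "x \<in> ?A"
    then obtain i where i: "x = {(u # v # vs) ! i, (u # v # vs) ! Suc i}" "Suc i < length (u # v # vs)"
      by blast
    show "x \<in> insert {u, v} ?B"
    proof (cases i)
      case 0
      then show ?thesis using i by simp
    next
      case (Suc j)
      have "x = {(v # vs) ! j, (v # vs) ! Suc j}" "Suc j < length (v # vs)" using i Suc by auto
      then show ?thesis by blast
    qed
  next
    fix x assume "x \<in> insert {u, v} ?B"
    then consider "x = {u, v}" | i where "x = {(v # vs) ! i, (v # vs) ! Suc i}" "Suc i < length (v # vs)"
      by blast
    then show "x \<in> ?A"
    proof cases
      case 1
      then show ?thesis by (intro CollectI exI[of _ 0]) simp
    next
      case (2 i)
      then show ?thesis by (intro CollectI exI[of _ "Suc i"]) simp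
    qed
  qed
  then show ?case using 1 by simp
qed auto

lemma is_path_conv_steps:
  "is_path V E vs \<longleftrightarrow> vs \<noteq> [] \<and> distinct vs \<and> set vs \<subseteq> V \<and> steps vs \<subseteq> E"
  unfolding is_path_def steps_conv_nth by blast

lemma conforming_Cons:
  "conforming f (u # vs) \<longleftrightarrow> f u \<inter> steps (u # vs) = {} \<and> conforming f vs"
proof
  assume c: "conforming f (u # vs)"
  have "f u \<inter> steps (u # vs) = {}"
    using c unfolding conforming_def steps_conv_nth by fastforce
  moreover have "conforming f vs"
    unfolding conforming_def
  proof (intro allI impI)
    fix i j assume "Suc i < length vs" "j \<le> i"
    then show "{vs ! i, vs ! Suc i} \<notin> f (vs ! j)"
      using c[unfolded conforming_def, rule_format, of "Suc i" "Suc j"] by simp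
  qed
  ultimately show "f u \<inter> steps (u # vs) = {} \<and> conforming f vs" ..
next
  assume a: "f u \<inter> steps (u # vs) = {} \<and> conforming f vs"
  show "conforming f (u # vs)"
    unfolding conforming_def
  proof (intro allI impI)
    fix i j assume ij: "Suc i < length (u # vs)" "j \<le> i"
    show "{(u # vs) ! i, (u # vs) ! Suc i} \<notin> f ((u # vs) ! j)"
    proof (cases j)
      case 0
      have "{(u # vs) ! i, (u # vs) ! Suc i} \<in> steps (u # vs)"
        unfolding steps_conv_nth using ij by blast
      then show ?thesis using a 0 by auto
    next
      case (Suc j')
      then obtain i' where "i = Suc i'" using ij by (cases i) auto
      then show ?thesis using a ij Suc by (auto simp: conforming_def)
    qed
  qed
qed

lemma steps_append2: "steps (b # c) \<subseteq> steps (a @ b # c)"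
proof (induction a)
  case (Cons x a)
  then show ?case by (cases a) auto
qed simp

lemma conforming_append2: "conforming f (a @ b) \<Longrightarrow> conforming f b"
  by (induction a) (auto simp: conforming_Cons)

locale encoded_instance =
  fixes n :: nat and es :: "(nat \<times> nat) list" and fs :: "nat list list"
    and f :: "nat \<Rightarrow> nat set set" and \<mu> k :: nat
  assumes dist_es: "distinct (map edge_of es)"
    and edges: "\<And>e. e < length es \<Longrightarrow> fst (es ! e) < n \<and> snd (es ! e) < n"
    and len_fs: "length fs = n"
    and fs: "\<And>v. v < n \<Longrightarrow> distinct (fs ! v) \<and> set (fs ! v) \<subseteq> {..<length es} \<and>
      (\<lambda>i. edge_of (es ! i)) ` set (fs ! v) = f v"
    and len_f: "\<And>v. v < n \<Longrightarrow> length (fs ! v) \<le> \<mu>"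
    and \<mu>: "\<mu> \<ge> 1" and k: "k \<ge> 1"
begin

lemma edge_of_eq_iff:
  assumes "i < length es" "j < length es"
  shows "edge_of (es ! i) = edge_of (es ! j) \<longleftrightarrow> i = j"
  using dist_es assms nth_eq_iff_index_eq[of "map edge_of es" i j] by auto

lemma mem_f_iff:
  assumes "v < n" "e < length es"
  shows "edge_of (es ! e) \<in> f v \<longleftrightarrow> e \<in> set (fs ! v)"
proof
  assume "edge_of (es ! e) \<in> f v"
  then obtain i where "i \<in> set (fs ! v)" "edge_of (es ! e) = edge_of (es ! i)"
    using fs[OF assms(1)] by blast
  moreover from this have "i < length es" using fs[OF assms(1)] by blast
  ultimately show "e \<in> set (fs ! v)" using edge_of_eq_iff assms(2) by simp
next
  assume "e \<in> set (fs ! v)"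
  then show "edge_of (es ! e) \<in> f v" using fs[OF assms(1)] by blast
qed

text \<open>Cutting out a cycle only removes deleting vertices and edges.\<close>

lemma conforming_walk_imp_path:
  assumes "conforming_walk es fs vs l" "hd vs < n"
  shows "\<exists>p. is_path {..<n} (edge_of ` set es) p \<and> conforming f p \<and> hd p = hd vs \<and>
    last p = last vs \<and> length p \<le> length vs \<and> steps p \<subseteq> (\<lambda>e. edge_of (es ! e)) ` set l \<and>
    set l \<subseteq> {..<length es}"
  using assms
proof (induction l arbitrary: vs)
  case Nil
  then obtain v where "vs = [v]" by (cases vs; cases "tl vs") auto
  then show ?case using Nil
    by (intro exI[of _ "[v]"]) (auto simp: is_path_conv_steps conforming_def)
next
  case (Cons e l)
  obtain u v vs' where vs: "vs = u # v # vs'"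
    using Cons.prems(1) by (cases vs; cases "tl vs") auto
  have e: "e < length es" "edge_of (es ! e) = {u, v}" "set (fs ! u) \<inter> set (e # l) = {}"
    "conforming_walk es fs (v # vs') l"
    using Cons.prems(1) by (auto simp: vs)
  have "u < n" using Cons.prems(2) by (simp add: vs)
  moreover have "v \<in> edge_of (es ! e)" using e by simp
  then have "v < n" using edges[OF e(1)] by (auto simp: edge_of_def)
  ultimately have uv: "u < n" "v < n" .
  from Cons.IH[OF e(4)] uv obtain p where p: "is_path {..<n} (edge_of ` set es) p"
    "conforming f p" "hd p = v" "last p = last (v # vs')" "length p \<le> length (v # vs')"
    "steps p \<subseteq> (\<lambda>e. edge_of (es ! e)) ` set l" "set l \<subseteq> {..<length es}" by auto
  show ?case
  proof (cases "u \<in> set p")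
    \<comment> \<open>The path from \<open>v\<close> already visits \<open>u\<close>: its part from
      \<open>u\<close> on replaces the walk, and as a suffix it is conforming and uses no new
      edge.\<close>
    case True
    then obtain a b where ab: "p = a @ u # b" by (meson split_list)
    have sub: "steps (u # b) \<subseteq> steps p" unfolding ab by (rule steps_append2)
    show ?thesis
    proof (intro exI conjI)
      show "is_path {..<n} (edge_of ` set es) (u # b)"
        using p(1) sub by (auto simp: is_path_conv_steps ab)
      show "conforming f (u # b)" using p(2) conforming_append2 unfolding ab by blast
      show "last (u # b) = last vs" using p(4) by (simp add: ab vs)
      show "length (u # b) \<le> length vs" using p(5) by (simp add: ab vs)
      show "steps (u # b) \<subseteq> (\<lambda>e. edge_of (es ! e)) ` set (e # l)" using p(6) sub by auto
    qed (use vs p(7) e(1) in auto)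
  next
    case False
    obtain p' where p': "p = v # p'" using p(1,3) by (cases p) (auto simp: is_path_def)
    have st: "steps (u # p) = insert (edge_of (es ! e)) (steps p)" using p' e(2) by simp
    have "edge_of (es ! e) \<in> edge_of ` set es" using e(1) by simp
    moreover have sub: "steps (u # p) \<subseteq> (\<lambda>e. edge_of (es ! e)) ` set (e # l)"
      using st p(6) by auto
    moreover have "f u \<inter> steps (u # p) = {}"
    proof -
      have "edge_of (es ! e') \<notin> f u" if "e' \<in> set (e # l)" for e'
        using that e(1,3) p(7) mem_f_iff[OF uv(1), of e'] by auto
      then show ?thesis using sub by auto
    qed
    ultimately show ?thesis
      using p False uv st e(1) by (intro exI[of _ "u # p"])
        (auto simp: is_path_conv_steps conforming_Cons vs)
  qed
qed

lemma path_imp_conforming_walk: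
  assumes "is_path {..<n} (edge_of ` set es) p" "conforming f p"
  shows "\<exists>l. conforming_walk es fs p l"
  using assms
proof (induction p rule: steps.induct)
  case (1 u v vs)
  then have "is_path {..<n} (edge_of ` set es) (v # vs)" "conforming f (v # vs)"
    by (auto simp: is_path_conv_steps conforming_Cons)
  from 1(1)[OF this] obtain l where l: "conforming_walk es fs (v # vs) l" ..
  have "{u, v} \<in> edge_of ` set es" using 1(2) by (simp add: is_path_conv_steps)
  then obtain e where e: "e < length es" "edge_of (es ! e) = {u, v}"
    by (metis image_iff in_set_conv_nth)
  have u: "u < n" using 1(2) by (simp add: is_path_def)
  have sub: "\<forall>e\<in>set l. e < length es \<and> edge_of (es ! e) \<in> steps (v # vs)"
    using l
  proof (induction l arbitrary: v vs)
    case (Cons e l)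
    then show ?case by (cases vs) auto
  qed simp
  have "set (fs ! u) \<inter> set (e # l) = {}"
  proof -
    have "e' \<notin> set (fs ! u)" if "e' \<in> set (e # l)" for e'
    proof -
      have "edge_of (es ! e') \<in> steps (u # v # vs)" "e' < length es" using that sub e by auto
      moreover have "f u \<inter> steps (u # v # vs) = {}" using 1(3) unfolding conforming_Cons by blast
      ultimately show ?thesis using mem_f_iff[OF u, of e'] by blast
    qed
    then show ?thesis by auto
  qed
  then show ?case using e l by (intro exI[of _ "e # l"]) auto
next
  case "2_1"
  then show ?case by (simp add: is_path_def)
next
  case ("2_2" v)
  show ?case by (rule exI[of _ "[]"]) simp
qed

lemma length_conforming_walk: "conforming_walk es fs vs l \<Longrightarrow> length vs = Suc (length l)"
  by (induction es fs vs l rule: conforming_walk.induct) auto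

lemma conforming_walk_edges: "conforming_walk es fs vs l \<Longrightarrow> set l \<subseteq> {..<length es}"
  by (induction es fs vs l rule: conforming_walk.induct) auto

end

section \<open>Polynomials as vectors of monomials\<close>

definition peval :: "nat \<Rightarrow> (nat \<Rightarrow> 'a::comm_semiring_1) \<Rightarrow> 'a \<Rightarrow> 'a" where
  "peval L c x = (\<Sum>j\<le>L. c j * x ^ j)"

text \<open>The bits of \<open>b\<close> describe a monomial in the coefficients: a 1 moves to the next coefficient, a 0
  multiplies by the current one. Trailing 1s pad a monomial of low degree to \<open>l\<close> bits.\<close>

fun mon :: "(nat \<Rightarrow> 'a::comm_semiring_1) \<Rightarrow> nat \<Rightarrow> nat \<Rightarrow> nat \<Rightarrow> 'a" where
  "mon c j b 0 = 1"
| "mon c j b (Suc l) = (if odd b then mon c (Suc j) (b div 2) l else c j * mon c j (b div 2) l)"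

lemma of_nat_mon: "of_nat (mon c j b l) = mon (\<lambda>i. of_nat (c i)) j b l"
  by (induction l arbitrary: j b) auto

text \<open>Read as a lattice path: every factor costs a 0 and every move to the next index a 1, so
  \<open>length ms + (p - j)\<close> bits suffice; sortedness makes a single pass enough.\<close>

lemma mon_exists:
  fixes c :: "nat \<Rightarrow> 'a::comm_semiring_1"
  assumes "sorted ms" "\<forall>x\<in>set ms. j \<le> x \<and> x \<le> p" "length ms + p \<le> l + j"
  shows "\<exists>b<2 ^ l. \<forall>c::nat \<Rightarrow> 'a. mon c j b l = prod_list (map c ms)"
  using assms
proof (induction l arbitrary: j ms)
  case 0
  then have "ms = []" by (cases ms) auto
  then show ?case by auto
next
  case (Suc l)
  show ?case
  proof (cases "ms \<noteq> [] \<and> hd ms = j")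
    case True
    then obtain ms' where ms: "ms = j # ms'" by (cases ms) auto
    with Suc.prems Suc.IH[of ms' j] obtain b where
      b: "b < 2 ^ l" "\<forall>c::nat \<Rightarrow> 'a. mon c j b l = prod_list (map c ms')" by auto
    then show ?thesis by (intro exI[of _ "2 * b"]) (auto simp: ms)
  next
    case False
    have "\<forall>x\<in>set ms. Suc j \<le> x \<and> x \<le> p"
    proof (cases ms)
      case (Cons y ys)
      then have "Suc j \<le> y" using False Suc.prems(2) by auto
      then show ?thesis using Suc.prems(1,2) Cons by auto
    qed simp
    with Suc.prems Suc.IH[of ms "Suc j"] obtain b where
      b: "b < 2 ^ l" "\<forall>c::nat \<Rightarrow> 'a. mon c (Suc j) b l = prod_list (map c ms)" by auto
    then show ?thesis by (intro exI[of _ "2 * b + 1"]) auto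
  qed
qed

lemma mon_exists_mset:
  fixes ms :: "nat list"
  assumes "\<forall>x\<in>set ms. x \<le> p" "length ms + p \<le> l"
  shows "\<exists>b<2 ^ l. \<forall>c::nat \<Rightarrow> 'a::comm_semiring_1. mon c 0 b l = prod_list (map c ms)"
proof -
  have "\<exists>b<2 ^ l. \<forall>c::nat \<Rightarrow> 'a. mon c 0 b l = prod_list (map c (sort ms))"
    using assms by (intro mon_exists[of _ _ p]) auto
  moreover have "prod_list (map c (sort ms)) = prod_list (map c ms)" for c :: "nat \<Rightarrow> 'a"
    by (metis mset_map mset_sort prod_mset_prod_list)
  ultimately show ?thesis by simp
qed

text \<open>Multiplying out gives monomials of degree \<open>length xs\<close> in the coefficients
  \<open>0, ..., p\<close>, and each of them is an entry of the monomial vector because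
  \<open>length xs + p \<le> L\<close>. The weights \<open>W\<close> are chosen before
  \<open>c\<close>, which is what makes the product one fixed linear functional.\<close>

lemma prod_peval_linear:
  fixes xs :: "'a::comm_ring_1 list"
  assumes "length xs + p \<le> L"
  shows "\<exists>W. \<forall>c. (\<forall>j>p. c j = 0) \<longrightarrow>
    prod_list (map (peval L c) xs) = (\<Sum>b<2 ^ L. W b * mon c 0 b L)"
proof -
  \<comment> \<open>\<open>ms\<close> collects the indices chosen from the factors already
    multiplied out; expanding one more factor trades an element of \<open>xs\<close> for an element
    of \<open>ms\<close>.\<close>
  have "\<exists>W. \<forall>c. (\<forall>j>p. c j = 0) \<longrightarrow>
      prod_list (map c ms) * prod_list (map (peval L c) xs) = (\<Sum>b<2 ^ L. W b * mon c 0 b L)"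
    if "\<forall>x\<in>set ms. x \<le> p" "length ms + length xs + p \<le> L" for ms
    using that
  proof (induction xs arbitrary: ms)
    case Nil
    then obtain b where b: "b < 2 ^ L" "\<And>c::nat \<Rightarrow> 'a. mon c 0 b L = prod_list (map c ms)"
      using mon_exists_mset[of ms p L] by auto
    then show ?case
      by (intro exI[of _ "\<lambda>b'. if b' = b then 1 else 0"]) (simp add: if_distrib[of "\<lambda>x. x * _"] cong: if_cong)
  next
    case (Cons x xs)
    have "\<exists>W. \<forall>c. (\<forall>j>p. c j = 0) \<longrightarrow>
        prod_list (map c (j # ms)) * prod_list (map (peval L c) xs) = (\<Sum>b<2 ^ L. W b * mon c 0 b L)"
      if "j \<le> p" for j
      using Cons.prems that by (intro Cons.IH) auto
    then obtain W where W: "\<And>j c. j \<le> p \<Longrightarrow> (\<forall>j>p. c j = 0) \<Longrightarrow>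
        prod_list (map c (j # ms)) * prod_list (map (peval L c) xs) = (\<Sum>b<2 ^ L. W j b * mon c 0 b L)"
      by metis
    show ?case
    proof (intro exI[of _ "\<lambda>b. \<Sum>j\<le>p. x ^ j * W j b"] allI impI)
      fix c :: "nat \<Rightarrow> 'a" assume c: "\<forall>j>p. c j = 0"
      have "peval L c x = (\<Sum>j\<le>p. c j * x ^ j)"
        unfolding peval_def using c assms Cons.prems by (intro sum.mono_neutral_right) auto
      then have "prod_list (map c ms) * prod_list (map (peval L c) (x # xs)) =
        (\<Sum>j\<le>p. x ^ j * (prod_list (map c (j # ms)) * prod_list (map (peval L c) xs)))"
        by (simp add: sum_distrib_left sum_distrib_right algebra_simps)
      also have "\<dots> = (\<Sum>j\<le>p. x ^ j * (\<Sum>b<2 ^ L. W j b * mon c 0 b L))"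
        using W[OF _ c] by (intro sum.cong) auto
      also have "\<dots> = (\<Sum>b<2 ^ L. (\<Sum>j\<le>p. x ^ j * W j b) * mon c 0 b L)"
        by (simp add: sum_distrib_left sum_distrib_right mult.assoc) (rule sum.swap)
      finally show "prod_list (map c ms) * prod_list (map (peval L c) (x # xs)) =
        (\<Sum>b<2 ^ L. (\<Sum>j\<le>p. x ^ j * W j b) * mon c 0 b L)" .
    qed
  qed
  from this[of "[]"] assms show ?thesis by simp
qed

section \<open>Incremental elimination modulo a prime\<close>

text \<open>Elimination without division: the vector is multiplied by the pivot entry before a
  multiple of the row is subtracted, and \<open>P - y\<close> stands for \<open>- y\<close>. For an
  echelon system modulo a prime these scalings are by units, so spans are not affected.\<close>

fun reduce :: "nat \<Rightarrow> (nat \<Rightarrow> nat \<Rightarrow> nat) \<Rightarrow> (nat \<Rightarrow> nat) \<Rightarrow> nat \<Rightarrow> (nat \<Rightarrow> nat) \<Rightarrow> nat \<Rightarrow> nat" where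
  "reduce P rw pv 0 v = v"
| "reduce P rw pv (Suc q) v = (\<lambda>x. (rw q (pv q) * reduce P rw pv q v x +
     (P - reduce P rw pv q v (pv q)) * rw q x) mod P)"

definition inner :: "nat \<Rightarrow> (nat \<Rightarrow> int) \<Rightarrow> (nat \<Rightarrow> nat) \<Rightarrow> int" where
  "inner D W u = (\<Sum>x<D. W x * int (u x))"

definition monv :: "nat \<Rightarrow> (nat \<Rightarrow> nat) \<Rightarrow> nat \<Rightarrow> nat" where
  "monv L c x = mon c 0 x L"

text \<open>In dual form: the monomial vector of \<open>c\<close> is in the span of those of the \<open>t\<close> entries.\<close>

definition represented :: "nat \<Rightarrow> nat \<Rightarrow> nat \<Rightarrow> (nat \<Rightarrow> nat \<Rightarrow> nat) \<Rightarrow> (nat \<Rightarrow> nat) \<Rightarrow> bool" where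
  "represented P L t cf c \<longleftrightarrow> (\<forall>W. (\<forall>q<t. int P dvd inner (2 ^ L) W (monv L (cf q))) \<longrightarrow>
     int P dvd inner (2 ^ L) W (monv L c))"

text \<open>A triangular form: a row has to vanish only at the pivots of the rows before it, so old
  rows are never touched again. The last conjunct says in dual form that the rows lie in the span of
  the monomial vectors of \<open>cf\<close>.\<close>

definition echelon :: "nat \<Rightarrow> nat \<Rightarrow> nat \<Rightarrow> (nat \<Rightarrow> nat) \<Rightarrow> (nat \<Rightarrow> nat \<Rightarrow> nat) \<Rightarrow>
    (nat \<Rightarrow> nat \<Rightarrow> nat) \<Rightarrow> bool" where
  "echelon P L t pv rw cf \<longleftrightarrow>
     (\<forall>q<t. pv q < 2 ^ L \<and> rw q (pv q) \<noteq> 0 \<and> (\<forall>x<2 ^ L. rw q x < P) \<and> (\<forall>i<q. rw q (pv i) = 0)) \<and>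
     (\<forall>W. (\<forall>q<t. int P dvd inner (2 ^ L) W (monv L (cf q))) \<longrightarrow>
        (\<forall>q<t. int P dvd inner (2 ^ L) W (rw q)))"

lemma echelon_0 [simp]: "echelon P L 0 pv rw cf"
  by (simp add: echelon_def)

lemma echelon_cong:
  assumes e: "echelon P L t pv rw cf"
    and eq: "\<And>q. q < t \<Longrightarrow> pv' q = pv q" "\<And>q x. q < t \<Longrightarrow> x < 2 ^ L \<Longrightarrow> rw' q x = rw q x"
      "\<And>q. q < t \<Longrightarrow> cf' q = cf q"
  shows "echelon P L t pv' rw' cf'"
proof -
  have inn: "inner (2 ^ L) W (rw' q) = inner (2 ^ L) W (rw q)" if "q < t" for q W
    unfolding inner_def using that eq(2) by (intro sum.cong) auto
  have "pv' q < 2 ^ L \<and> rw' q (pv' q) \<noteq> 0 \<and> (\<forall>x<2 ^ L. rw' q x < P) \<and> (\<forall>i<q. rw' q (pv' i) = 0)"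
    if "q < t" for q
  proof -
    have *: "pv q < 2 ^ L \<and> rw q (pv q) \<noteq> 0 \<and> (\<forall>x<2 ^ L. rw q x < P) \<and> (\<forall>i<q. rw q (pv i) = 0)"
      using e that unfolding echelon_def by blast
    have "rw' q (pv' i) = 0" if "i < q" for i
    proof -
      have "i < t" "pv i < 2 ^ L" using e \<open>i < q\<close> \<open>q < t\<close> unfolding echelon_def by auto
      then show ?thesis using eq \<open>q < t\<close> * that by simp
    qed
    then show ?thesis using * eq that by simp
  qed
  moreover have "\<forall>q<t. int P dvd inner (2 ^ L) W (rw' q)"
    if "\<forall>q<t. int P dvd inner (2 ^ L) W (monv L (cf' q))" for W
  proof -
    have "\<forall>q<t. int P dvd inner (2 ^ L) W (monv L (cf q))" using that eq(3) by simp
    then show ?thesis using e inn unfolding echelon_def by simp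
  qed
  ultimately show ?thesis unfolding echelon_def by blast
qed

text \<open>Row \<open>q\<close> is nonzero at its own pivot and zero at the earlier ones, so the
  pivots are distinct positions of a vector of length \<open>2 ^ L\<close>. This bounds the number
  of walks kept per vertex and length.\<close>

lemma echelon_le:
  assumes "echelon P L t pv rw cf"
  shows "t \<le> 2 ^ L"
proof -
  have "inj_on pv {..<t}"
  proof (rule linorder_inj_onI)
    fix i q assume "i < q" "i \<in> {..<t}" "q \<in> {..<t}"
    then have "rw q (pv q) \<noteq> 0" "rw q (pv i) = 0" using assms unfolding echelon_def by blast+
    then show "pv i \<noteq> pv q" by metis
  qed auto
  moreover have "pv ` {..<t} \<subseteq> {..<2 ^ L}" using assms by (auto simp: echelon_def)
  ultimately have "card {..<t} \<le> card {..<2 ^ L :: nat}" by (rule card_inj_on_le) simp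
  then show ?thesis by simp
qed

lemma reduce_less: "\<lbrakk>\<forall>x<D. v x < P; x < D\<rbrakk> \<Longrightarrow> reduce P rw pv q v x < P"
  by (cases q) (auto intro: mod_less_divisor)

text \<open>Step \<open>q\<close> clears position \<open>pv q\<close>, where its two terms add up to
  a multiple of \<open>P\<close>; later rows vanish there and only rescale the zero.\<close>

lemma reduce_pivot:
  assumes "echelon P L t pv rw cf" "\<forall>x<2 ^ L. v x < P" "q \<le> t" "i < q"
  shows "reduce P rw pv q v (pv i) = 0"
  using assms(3,4)
proof (induction q)
  case (Suc q)
  have *: "rw q (pv i) = 0" if "i < q" using assms(1) that Suc.prems by (auto simp: echelon_def)
  have "pv q < 2 ^ L" using assms(1) Suc.prems by (auto simp: echelon_def)
  then have "reduce P rw pv q v (pv q) < P" by (rule reduce_less[OF assms(2)])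
  then have "rw q (pv q) * reduce P rw pv q v (pv q) + (P - reduce P rw pv q v (pv q)) * rw q (pv q) =
    rw q (pv q) * P" by (simp add: algebra_simps flip: distrib_left)
  then show ?case using Suc * by (cases "i = q") auto
qed simp

text \<open>A functional that kills the rows sees each step as multiplication by a pivot entry,
  which is nonzero and below the prime \<open>P\<close>, hence a unit.\<close>

lemma inner_reduce:
  assumes "prime P" "echelon P L t pv rw cf" "\<forall>x<2 ^ L. v x < P" "q \<le> t"
    and "\<forall>q<t. int P dvd inner (2 ^ L) W (rw q)"
  shows "int P dvd inner (2 ^ L) W (reduce P rw pv q v) \<longleftrightarrow> int P dvd inner (2 ^ L) W v"
  using assms(4)
proof (induction q)
  case (Suc q)
  define a b u where "a = rw q (pv q)" and "b = P - reduce P rw pv q v (pv q)" and "u = reduce P rw pv q v"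
  have ind: "a \<noteq> 0" "a < P" using assms(2) Suc.prems by (auto simp: echelon_def a_def)
  have "[inner (2 ^ L) W (reduce P rw pv (Suc q) v) =
      (\<Sum>x<2 ^ L. W x * (int a * int (u x) + int b * int (rw q x)))] (mod int P)"
    unfolding inner_def
    by (intro cong_sum cong_mult cong_refl) (simp add: a_def b_def u_def zmod_int cong_def mod_simps)
  also have "(\<Sum>x<2 ^ L. W x * (int a * int (u x) + int b * int (rw q x))) =
      int a * inner (2 ^ L) W u + int b * inner (2 ^ L) W (rw q)"
    by (simp add: inner_def sum_distrib_left sum.distrib algebra_simps)
  finally have "int P dvd inner (2 ^ L) W (reduce P rw pv (Suc q) v) \<longleftrightarrow>
      int P dvd int a * inner (2 ^ L) W u + int b * inner (2 ^ L) W (rw q)"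
    by (simp add: cong_dvd_iff cong_sym_eq)
  also have "\<dots> \<longleftrightarrow> int P dvd int a * inner (2 ^ L) W u"
    using assms(5) Suc.prems by (intro dvd_add_left_iff) auto
  also have "\<dots> \<longleftrightarrow> int P dvd inner (2 ^ L) W u"
    using ind assms(1) by (simp add: prime_dvd_mult_iff nat_dvd_not_less)
  finally show ?case using Suc by (simp add: u_def)
qed simp

lemma represented_refl: "q < t \<Longrightarrow> cf q = c \<Longrightarrow> represented P L t cf c"
  by (auto simp: represented_def)

lemma represented_mono:
  assumes "represented P L t cf c" "t \<le> t'" "\<And>q. q < t \<Longrightarrow> cf' q = cf q"
  shows "represented P L t' cf' c"
  using assms unfolding represented_def by (metis order.strict_trans2)

lemma inner_scaled_mod:
  assumes "prime P"
  shows "int P dvd inner D W (\<lambda>x. h * u x mod P) \<longleftrightarrow> P dvd h \<or> int P dvd inner D W u"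
proof -
  have "[inner D W (\<lambda>x. h * u x mod P) = (\<Sum>x<D. W x * (int h * int (u x)))] (mod int P)"
    unfolding inner_def
    by (intro cong_sum cong_mult cong_refl) (simp add: zmod_int cong_def)
  also have "(\<Sum>x<D. W x * (int h * int (u x))) = int h * inner D W u"
    by (simp add: inner_def sum_distrib_left algebra_simps)
  finally have "int P dvd inner D W (\<lambda>x. h * u x mod P) \<longleftrightarrow> int P dvd int h * inner D W u"
    by (simp add: cong_dvd_iff cong_sym_eq)
  then show ?thesis using assms by (simp add: prime_dvd_mult_iff)
qed

text \<open>A functional that vanishes on the entries vanishes on the rows, hence cannot tell the
  vector from its reduction; the factor \<open>h\<close> cancels modulo \<open>P\<close>.\<close>

lemma represented_of_reduce_0:
  assumes "prime P" "echelon P L t pv rw cf" "\<not> P dvd h"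
    and "\<And>x. x < 2 ^ L \<Longrightarrow> reduce P rw pv t (\<lambda>x. h * monv L c x mod P) x = 0"
  shows "represented P L t cf c"
  unfolding represented_def
proof (intro allI impI)
  fix W assume W: "\<forall>q<t. int P dvd inner (2 ^ L) W (monv L (cf q))"
  have P: "P > 0" using assms(1) by (rule prime_gt_0_nat)
  have "inner (2 ^ L) W (reduce P rw pv t (\<lambda>x. h * monv L c x mod P)) = 0"
    unfolding inner_def using assms(4) by simp
  moreover have "\<forall>q<t. int P dvd inner (2 ^ L) W (rw q)" using assms(2) W by (auto simp: echelon_def)
  ultimately have "int P dvd inner (2 ^ L) W (\<lambda>x. h * monv L c x mod P)"
    using inner_reduce[OF assms(1,2) _ order.refl, of "\<lambda>x. h * monv L c x mod P" W] P by simp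
  then show "int P dvd inner (2 ^ L) W (monv L c)" using inner_scaled_mod[OF assms(1)] assms(3) by blast
qed

text \<open>In the application \<open>h\<close> is the product of the values of the new polynomial
  on \<open>f(u)\<close>. If it is 0 modulo \<open>P\<close>, the start vector is 0 and stays 0, so
  finding a pivot certifies that the extension is allowed.\<close>

lemma not_dvd_of_reduce:
  assumes "reduce P rw pv t (\<lambda>x. h * monv L c x mod P) p \<noteq> 0"
    and "echelon P L t pv rw cf" "p < 2 ^ L"
  shows "\<not> P dvd h"
proof
  assume h: "P dvd h"
  have "reduce P rw pv q (\<lambda>x. h * monv L c x mod P) x = 0" if "q \<le> t" "x < 2 ^ L" for q x
    using that
  proof (induction q arbitrary: x)
    case 0
    then show ?case using h by (simp add: mod_eq_0_iff_dvd)
  next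
    case (Suc q)
    have "pv q < 2 ^ L" using Suc.prems assms(2) by (auto simp: echelon_def)
    then show ?case using Suc by simp
  qed
  then show False using assms(1,3) by simp
qed

text \<open>The reduced vector vanishes at all earlier pivots and lies in the span of the entries
  together with \<open>c\<close>, so it can be appended as it is.\<close>

lemma echelon_extend:
  assumes "prime P" "echelon P L t pv rw cf"
    and v: "v = reduce P rw pv t (\<lambda>x. h * monv L c x mod P)" and p: "p < 2 ^ L" "v p \<noteq> 0"
  shows "echelon P L (Suc t) (pv(t := p)) (rw(t := v)) (cf(t := c))"
proof -
  have P: "P > 0" using assms(1) by (rule prime_gt_0_nat)
  have u: "\<forall>x<2 ^ L. h * monv L c x mod P < P" using P by simp
  have 1: "v x < P" if "x < 2 ^ L" for x unfolding v by (rule reduce_less[OF u that])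
  have 2: "v (pv i) = 0" if "i < t" for i unfolding v by (rule reduce_pivot[OF assms(2) u order.refl that])
  have 3: "int P dvd inner (2 ^ L) W v"
    if "\<forall>q<t. int P dvd inner (2 ^ L) W (monv L (cf q))" "int P dvd inner (2 ^ L) W (monv L c)" for W
  proof -
    have "\<forall>q<t. int P dvd inner (2 ^ L) W (rw q)" using assms(2) that by (auto simp: echelon_def)
    from inner_reduce[OF assms(1,2) u order.refl this] inner_scaled_mod[OF assms(1)] that(2)
    show ?thesis unfolding v by blast
  qed
  have "\<forall>q<Suc t. int P dvd inner (2 ^ L) W ((rw(t := v)) q)"
    if "\<forall>q<Suc t. int P dvd inner (2 ^ L) W (monv L ((cf(t := c)) q))" for W
  proof -
    have "int P dvd inner (2 ^ L) W (monv L (cf q))" if "q < t" for q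
      using \<open>\<forall>q<Suc t. _ q\<close>[rule_format, of q] that by simp
    moreover have "int P dvd inner (2 ^ L) W (monv L c)"
      using that[rule_format, of t] by simp
    ultimately show ?thesis using 3 assms(2) by (auto simp: echelon_def less_Suc_eq)
  qed
  moreover have "\<forall>q<Suc t. (pv(t := p)) q < 2 ^ L \<and> (rw(t := v)) q ((pv(t := p)) q) \<noteq> 0 \<and>
      (\<forall>x<2 ^ L. (rw(t := v)) q x < P) \<and> (\<forall>i<q. (rw(t := v)) q ((pv(t := p)) i) = 0)"
    using assms(2) p 1 2 by (auto simp: echelon_def less_Suc_eq)
  ultimately show ?thesis unfolding echelon_def by blast
qed

lemma of_nat_peval: "of_nat (peval L c x) = peval L (\<lambda>i. of_nat (c i)) (of_nat x)"
  by (simp add: peval_def)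

text \<open>The product over \<open>xs\<close> is a linear functional of the monomial vector by
  \<open>prod_peval_linear\<close>. If it vanished on all kept entries, it would vanish on
  \<open>c\<close>, which lies in their span.\<close>

lemma represented_prod:
  assumes "represented P L t cf c"
    and "\<And>j. j > p \<Longrightarrow> c j = 0" "\<And>q j. q < t \<Longrightarrow> j > p \<Longrightarrow> cf q j = 0"
    and "length xs + p \<le> L"
    and nd: "\<not> int P dvd prod_list (map (peval L (\<lambda>i. int (c i))) xs)"
  shows "\<exists>q<t. \<not> int P dvd prod_list (map (peval L (\<lambda>i. int (cf q i))) xs)"
proof (rule ccontr)
  assume neg: "\<not> ?thesis"
  obtain W where W: "\<And>c. (\<forall>j>p. c j = 0) \<Longrightarrow>
      prod_list (map (peval L c) xs) = (\<Sum>b<2 ^ L. W b * mon c 0 b L)"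
    using prod_peval_linear[OF assms(4)] by blast
  have inn: "inner (2 ^ L) W (monv L c') = prod_list (map (peval L (\<lambda>i. int (c' i))) xs)"
    if "\<And>j. j > p \<Longrightarrow> c' j = 0" for c'
    using W[of "\<lambda>i. int (c' i)"] that by (simp add: inner_def monv_def of_nat_mon)
  have "\<forall>q<t. int P dvd inner (2 ^ L) W (monv L (cf q))"
    using neg inn assms(3) by auto
  then have "int P dvd inner (2 ^ L) W (monv L c)" using assms(1) by (auto simp: represented_def)
  then show False using nd inn assms(2) by auto
qed

text \<open>The coefficients of \<open>c * (x - e)\<close> modulo \<open>P\<close>, where \<open>d \<equiv> - e\<close>.\<close>

definition shift_coef :: "nat \<Rightarrow> nat \<Rightarrow> nat \<Rightarrow> (nat \<Rightarrow> nat) \<Rightarrow> nat \<Rightarrow> nat" where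
  "shift_coef P L d c i = (if i \<le> L then ((if i = 0 then 0 else c (i - 1)) + d * c i) mod P else 0)"

text \<open>\<open>c L = 0\<close> guarantees that the shift by one pushes no coefficient beyond the
  cut-off \<open>L\<close>.\<close>

lemma peval_shift_coef:
  assumes "c L = 0" "P > 0"
  shows "[peval L (\<lambda>i. int (shift_coef P L (P - e mod P) c i)) x =
    peval L (\<lambda>i. int (c i)) x * (x - int e)] (mod int P)"
proof -
  have d: "[int (P - e mod P) = - int e] (mod int P)"
  proof -
    have "int (P - e mod P) = int P - int e mod int P"
      using assms(2) by (simp add: of_nat_diff zmod_int)
    then show ?thesis by (simp add: cong_def mod_simps)
  qed
  obtain s :: "nat \<Rightarrow> int" where s: "s = (\<lambda>i. if i = 0 then 0 else int (c (i - 1)))" by simp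
  have "[peval L (\<lambda>i. int (shift_coef P L (P - e mod P) c i)) x =
    (\<Sum>i\<le>L. (s i + (- int e) * int (c i)) * x ^ i)] (mod int P)"
    unfolding peval_def
  proof (intro cong_sum cong_mult cong_refl)
    fix i assume i: "i \<in> {..L}"
    have "[int (shift_coef P L (P - e mod P) c i) = s i + int (P - e mod P) * int (c i)] (mod int P)"
      using i by (simp add: shift_coef_def s cong_def zmod_int)
    also have "[s i + int (P - e mod P) * int (c i) = s i + (- int e) * int (c i)] (mod int P)"
      by (intro cong_add cong_mult cong_refl d)
    finally show "[int (shift_coef P L (P - e mod P) c i) = s i + - int e * int (c i)] (mod int P)" .
  qed
  also have "(\<Sum>i\<le>L. (s i + (- int e) * int (c i)) * x ^ i) =
      (\<Sum>i\<le>L. s i * x ^ i) - int e * peval L (\<lambda>i. int (c i)) x"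
    by (simp add: peval_def sum_distrib_left sum_subtractf algebra_simps)
  also have "(\<Sum>i\<le>L. s i * x ^ i) = x * peval L (\<lambda>i. int (c i)) x"
  proof (cases L)
    case 0
    then show ?thesis using assms by (simp add: s peval_def)
  next
    case (Suc L')
    have "(\<Sum>i\<le>L. s i * x ^ i) = (\<Sum>i\<le>L'. int (c i) * x ^ Suc i)"
      unfolding Suc by (subst sum.atMost_Suc_shift) (simp add: s)
    also have "\<dots> = x * (\<Sum>i\<le>L. int (c i) * x ^ i)"
      using assms Suc by (simp add: sum_distrib_left algebra_simps)
    finally show ?thesis by (simp add: peval_def)
  qed
  finally show ?thesis by (simp add: algebra_simps)
qed

lemma prod_list_map_mult:
  "prod_list (map (\<lambda>x. f x * g x) xs) =
    prod_list (map f xs) * (prod_list (map g xs) :: 'a::comm_monoid_mult)"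
  by (induction xs) (simp_all add: ac_simps)

lemma cong_prod_list:
  "(\<And>x. x \<in> set xs \<Longrightarrow> [f x = g x] (mod b)) \<Longrightarrow>
    [prod_list (map f xs) = prod_list (map g xs)] (mod (b::int))"
  by (induction xs) (auto intro: cong_mult)

section \<open>Entries of the tables: soundness and completeness\<close>

context encoded_instance
begin

text \<open>The zeros beyond \<open>r\<close> bound the degree by the number of edges, on which the
  bit count of the monomials relies.\<close>

definition sound_entry :: "nat \<Rightarrow> nat \<Rightarrow> nat \<Rightarrow> nat \<Rightarrow> nat \<Rightarrow> (nat \<Rightarrow> nat) \<Rightarrow> bool" where
  "sound_entry P L t r v c \<longleftrightarrow> (\<forall>j>r. c j = 0) \<and>
     (\<exists>vs l. conforming_walk es fs vs l \<and> hd vs = v \<and> last vs = t \<and> length l = r \<and>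
       (\<forall>x. [peval L (\<lambda>i. int (c i)) x = (\<Prod>e\<leftarrow>l. x - int e)] (mod int P)))"

lemma sound_entry_0:
  assumes "c = (\<lambda>i. if i = 0 then 1 else 0)"
  shows "sound_entry P L t 0 t c"
proof -
  have "peval L (\<lambda>i. int (c i)) x = 1" for x
    by (simp add: peval_def assms if_distrib[of int] if_distrib[of "\<lambda>y. y * _"] cong: if_cong)
  then show ?thesis unfolding sound_entry_def using assms
    by (intro conjI exI[of _ "[t]"] exI[of _ "[]"]) auto
qed

text \<open>If \<open>u\<close> deleted an edge of the new walk, the polynomial would have an exact
  zero there, and the product on \<open>f(u)\<close> would be 0 whatever the modulus.
  \<open>c'\<close> already contains the factor for \<open>e\<close>, so the test covers the edge
  leaving \<open>u\<close> as well.\<close>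

lemma sound_entry_Suc:
  assumes "sound_entry P L t r v c" "P > 0" "r < L"
    and e: "e < length es" "edge_of (es ! e) = {u, v}"
    and c': "c' = shift_coef P L (P - e mod P) c"
    and nd: "\<not> int P dvd (\<Prod>x\<leftarrow>fs ! u. peval L (\<lambda>i. int (c' i)) (int x))"
  shows "sound_entry P L t (Suc r) u c'"
proof -
  obtain vs l where w: "conforming_walk es fs vs l" "hd vs = v" "last vs = t" "length l = r"
    "\<And>x. [peval L (\<lambda>i. int (c i)) x = (\<Prod>e\<leftarrow>l. x - int e)] (mod int P)"
    and c0: "\<forall>j>r. c j = 0"
    using assms(1) unfolding sound_entry_def by blast
  have vs: "vs \<noteq> []" using length_conforming_walk[OF w(1)] by auto
  then obtain vs' where vs': "vs = v # vs'" using w(2) by (cases vs) auto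
  have ev: "[peval L (\<lambda>i. int (c' i)) x = (\<Prod>e\<leftarrow>e # l. x - int e)] (mod int P)" for x
  proof -
    have "[peval L (\<lambda>i. int (c' i)) x = peval L (\<lambda>i. int (c i)) x * (x - int e)] (mod int P)"
      unfolding c' using c0 assms(2,3) by (intro peval_shift_coef) auto
    also have "[peval L (\<lambda>i. int (c i)) x * (x - int e) = (\<Prod>e\<leftarrow>l. x - int e) * (x - int e)] (mod int P)"
      by (intro cong_mult w(5) cong_refl)
    finally show ?thesis by (simp add: mult.commute)
  qed
  have "set (fs ! u) \<inter> set (e # l) = {}"
  proof (rule ccontr)
    assume "\<not> ?thesis"
    then obtain x where x: "x \<in> set (fs ! u)" "x \<in> set (e # l)" by blast
    then have "(\<Prod>e\<leftarrow>e # l. int x - int e) = 0"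
      by (intro prod_list_zero_iff[THEN iffD2]) (auto simp: image_iff)
    with ev[of "int x"] have "int P dvd peval L (\<lambda>i. int (c' i)) (int x)"
      by (simp only: cong_0_iff)
    moreover have "peval L (\<lambda>i. int (c' i)) (int x) dvd (\<Prod>x\<leftarrow>fs ! u. peval L (\<lambda>i. int (c' i)) (int x))"
      using x(1) by (intro prod_list_dvd) auto
    ultimately show False using nd dvd_trans by blast
  qed
  then have "conforming_walk es fs (u # vs) (e # l)" using w(1) e vs' by simp
  moreover have "\<forall>j>Suc r. c' j = 0" unfolding c' shift_coef_def using c0 by auto
  ultimately show ?thesis
    unfolding sound_entry_def using w vs ev by (intro conjI exI[of _ "u # vs"] exI[of _ "e # l"]) auto
qed

lemma sound_entry_imp_path:
  assumes "sound_entry P L t r s c" "r < k" "s < n"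
  shows "has_short_conforming_path {..<n} (edge_of ` set es) f s t k"
proof -
  obtain vs l where w: "conforming_walk es fs vs l" "hd vs = s" "last vs = t" "length l = r"
    using assms(1) unfolding sound_entry_def by blast
  from conforming_walk_imp_path[OF w(1)] length_conforming_walk[OF w(1)] assms w show ?thesis
    unfolding has_short_conforming_path_def by fastforce
qed

text \<open>\<open>ent\<close> is any family of kept entries closed under \<open>step\<close>. The
  list \<open>xs\<close> holds the positions deleted by a prefix still to come, so some kept entry,
  not necessarily that of the given walk, fits the same prefix. A vertex that passes from the walk
  to the prefix adds at most \<open>\<mu>\<close> positions, which explains the budget
  \<open>\<mu> * k\<close>.\<close>

lemma complete_entries:
  fixes ent :: "nat \<Rightarrow> nat \<Rightarrow> (nat \<Rightarrow> nat) set"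
  assumes P: "prime P" and inj: "inj_on (\<lambda>x. x mod P) U"
    and init: "\<exists>c\<in>ent 0 t. \<forall>x. peval L (\<lambda>i. int (c i)) x = 1"
    and step: "\<And>r v c e u xs. \<lbrakk>Suc r < k; c \<in> ent r v; e < length es; edge_of (es ! e) = {u, v};
      u < n; v < n; length xs \<le> \<mu> * k;
      \<not> int P dvd (\<Prod>x\<leftarrow>fs ! u. peval L (\<lambda>i. int (c i)) (int x) * (int x - int e));
      \<not> int P dvd (\<Prod>x\<leftarrow>xs. peval L (\<lambda>i. int (c i)) (int x) * (int x - int e))\<rbrakk> \<Longrightarrow>
      \<exists>c'\<in>ent (Suc r) u. \<not> int P dvd (\<Prod>x\<leftarrow>xs. peval L (\<lambda>i. int (c' i)) (int x))"
    and walk: "conforming_walk es fs vs l" "last vs = t" "length l < k" "set vs \<subseteq> {..<n}"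
    and U: "set l \<subseteq> U" "\<And>v. v \<in> set vs \<Longrightarrow> set (fs ! v) \<subseteq> U" "set xs \<subseteq> U"
    and xs: "set xs \<inter> set l = {}" "length xs + \<mu> * length l \<le> \<mu> * k"
  shows "\<exists>c\<in>ent (length l) (hd vs). \<not> int P dvd (\<Prod>x\<leftarrow>xs. peval L (\<lambda>i. int (c i)) (int x))"
  using walk U xs
proof (induction l arbitrary: vs xs)
  case Nil
  obtain v where "vs = [v]" using Nil.prems(1) by (cases vs; cases "tl vs") auto
  moreover obtain c where "c \<in> ent 0 t" "\<And>x. peval L (\<lambda>i. int (c i)) x = 1" using init by auto
  ultimately show ?case using Nil P by (intro bexI[of _ c]) (auto simp: map_replicate_const)
next
  case (Cons e l)
  obtain u v vs' where vs: "vs = u # v # vs'"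
    using Cons.prems(1) by (cases vs; cases "tl vs") auto
  have e: "e < length es" "edge_of (es ! e) = {u, v}" "set (fs ! u) \<inter> set (e # l) = {}"
    "conforming_walk es fs (v # vs') l" and un: "u < n" "v < n"
    using Cons.prems(1,4) by (auto simp: vs)
  have "length (fs ! u) \<le> \<mu>" using len_f un by simp
  \<comment> \<open>One entry has to serve both the prefix and \<open>u\<close>, so
    \<open>fs ! u\<close> is appended to \<open>xs\<close> before the induction hypothesis is
    used.\<close>
  then have "\<exists>c\<in>ent (length l) (hd (v # vs')).
      \<not> int P dvd (\<Prod>x\<leftarrow>xs @ fs ! u. peval L (\<lambda>i. int (c i)) (int x))"
    using Cons.prems e by (intro Cons.IH) (auto simp: vs)
  then obtain c where c0: "c \<in> ent (length l) v"
    "\<not> int P dvd (\<Prod>x\<leftarrow>xs. peval L (\<lambda>i. int (c i)) (int x)) *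
      (\<Prod>x\<leftarrow>fs ! u. peval L (\<lambda>i. int (c i)) (int x))" by auto
  then have c: "c \<in> ent (length l) v"
    "\<not> int P dvd (\<Prod>x\<leftarrow>xs. peval L (\<lambda>i. int (c i)) (int x))"
    "\<not> int P dvd (\<Prod>x\<leftarrow>fs ! u. peval L (\<lambda>i. int (c i)) (int x))"
    using dvd_mult dvd_mult2 by blast+
  \<comment> \<open>Injectivity on \<open>U\<close> enters here: distinct positions stay distinct
    modulo \<open>P\<close>, so every factor \<open>x - e\<close> is a unit.\<close>
  have lab: "\<not> int P dvd (\<Prod>x\<leftarrow>ys. int x - int e)" if "set ys \<subseteq> U" "e \<notin> set ys" for ys
    using that
  proof (induction ys)
    case Nil
    then show ?case using P by auto
  next
    case (Cons y ys)
    have "e \<in> U" using \<open>set (e # l) \<subseteq> U\<close> by simp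
    then have "y mod P \<noteq> e mod P" using inj Cons.prems by (auto simp: inj_on_def)
    then have "\<not> int P dvd int y - int e"
      by (metis mod_eq_dvd_iff of_nat_eq_iff zmod_int)
    then show ?case using Cons P by (simp add: prime_dvd_mult_iff)
  qed
  have both: "\<not> int P dvd (\<Prod>x\<leftarrow>ys. peval L (\<lambda>i. int (c i)) (int x) * (int x - int e))"
    if "\<not> int P dvd (\<Prod>x\<leftarrow>ys. peval L (\<lambda>i. int (c i)) (int x))" "set ys \<subseteq> U" "e \<notin> set ys" for ys
    using that lab[OF that(2,3)] P by (simp add: prod_list_map_mult prime_dvd_mult_iff)
  have "\<exists>c'\<in>ent (Suc (length l)) u. \<not> int P dvd (\<Prod>x\<leftarrow>xs. peval L (\<lambda>i. int (c' i)) (int x))"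
    using Cons.prems c e un both[OF c(2)] both[OF c(3)]
    by (intro step[OF _ c(1) e(1,2)]) (auto simp: vs)
  then show ?case by (simp add: vs)
qed

end

section \<open>The program\<close>

text \<open>
  Registers: 0 answer, 1 \<open>n\<close>, 2 \<open>m\<close>, 3 \<open>k\<close>, 4 \<open>s\<close>, 5 \<open>t\<close>, 6 \<open>\<mu>\<close>, 7 \<open>L\<close>, 8 \<open>D = 2 ^ L\<close>, 9 size \<open>S\<close> of a slot,
  10 start of the table of entry counts, 11 start of the slots, 12 number \<open>K\<close> of primes to try, 13 number
  of primes found, 14 candidate \<open>P\<close>, 15 layer \<open>i\<close> (walks with \<open>i\<close> edges), 16 oriented edge,
  17 \<open>- e mod P\<close>, 18 address of the count of the target cell, 19 its first slot, 20 current slot of the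
  source cell, 21 count of the source cell, 22 and 23 start and length of the list of \<open>f u\<close>, 24 index of
  the current source entry, 25 new slot, 26 product of the values of the new polynomial on \<open>f u\<close>.
  Registers from 27 on are scratch, and during the setup and the primality test so are those from 13
  and 15 on. Apart from register 0, an inner loop only changes registers with larger
  numbers than the loop counters of its callers.
\<close>

abbreviation plus_exp (infixl ".+" 65) where "a .+ b \<equiv> Bin Plus a b"
abbreviation minus_exp (infixl ".-" 65) where "a .- b \<equiv> Bin Minus a b"
abbreviation times_exp (infixl ".*" 70) where "a .* b \<equiv> Bin Times a b"
abbreviation quot_exp (infixl ".'/" 70) where "a ./ b \<equiv> Bin Quot a b"
abbreviation rem_exp (infixl ".%" 70) where "a .% b \<equiv> Bin Rem a b"
abbreviation assign_com (infix "::=" 61) where "x ::= a \<equiv> Assign x a"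
abbreviation seq_com (infixr ";;" 60) where "P ;; Q \<equiv> Seq P Q"

definition coef_prog :: com where
  "coef_prog = (27 ::= N 0;; 28 ::= N 0);;
     While (Less (R 28) (R 7 .+ N 1)) (
       29 ::= M (R 20 .+ N 1 .+ R 28);;
       Store (R 25 .+ N 1 .+ R 28) ((R 27 .+ R 17 .* R 29) .% R 14);;
       27 ::= R 29;;
       28 ::= R 28 .+ N 1)"

definition horner_prog :: com where
  "horner_prog =
     While (Less (R 30) (R 7 .+ N 1)) (
       29 ::= (R 29 .* R 28 .+ M ((R 25 .+ N 1 .+ R 7) .- R 30)) .% R 14;;
       30 ::= R 30 .+ N 1)"

definition eval_prog :: com where
  "eval_prog = (26 ::= N 1;; 27 ::= N 0);;
     While (Less (R 27) (R 23)) (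
       (28 ::= M (R 22 .+ R 27) .% R 14;; 29 ::= N 0;; 30 ::= N 0);;
       horner_prog;;
       (26 ::= (R 26 .* R 29) .% R 14;; 27 ::= R 27 .+ N 1))"

definition mon_prog :: com where
  "mon_prog =
     While (Less (R 31) (R 7)) (
       Cond (Equal (R 29 .% N 2) (N 1)) (30 ::= R 30 .+ N 1) (28 ::= (R 28 .* M (R 30)) .% R 14);;
       29 ::= R 29 ./ N 2;;
       31 ::= R 31 .+ N 1)"

text \<open>The accumulator starts at register 26 instead of 1, so the whole vector is multiplied by
  the product of the values on \<open>f(u)\<close>. A forbidden extension becomes the zero vector,
  and the pivot search rejects it without a separate test.\<close>

definition monv_prog :: com where
  "monv_prog = 27 ::= N 0;;
     While (Less (R 27) (R 8)) (
       (28 ::= R 26;; 29 ::= R 27;; 30 ::= R 25 .+ N 1;; 31 ::= N 0);;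
       mon_prog;;
       (Store (R 25 .+ R 7 .+ N 2 .+ R 27) (R 28);; 27 ::= R 27 .+ N 1))"

definition combine_prog :: com where
  "combine_prog =
     While (Less (R 34) (R 8)) (
       Store (R 33 .+ R 34) ((R 32 .* M (R 33 .+ R 34) .+ R 31 .* M (R 30 .+ R 34)) .% R 14);;
       34 ::= R 34 .+ N 1)"

definition reduce_prog :: com where
  "reduce_prog = (27 ::= N 0;; 28 ::= R 19;; 29 ::= M (R 18);; 33 ::= R 25 .+ R 7 .+ N 2);;
     While (Less (R 27) (R 29)) (
       (30 ::= R 28 .+ R 7 .+ N 2;; 31 ::= M (R 28);; 32 ::= M (R 30 .+ R 31);;
        31 ::= R 14 .- M (R 33 .+ R 31);; 34 ::= N 0);;
       combine_prog;;
       (28 ::= R 28 .+ R 9;; 27 ::= R 27 .+ N 1))"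

text \<open>Register 27 becomes 1 if a nonzero entry is found, and is added to the count; with 0 the
  candidate stays behind the counted slots and is overwritten by the next one for this cell. The
  last nonzero position becomes the pivot.\<close>

definition pivot_prog :: com where
  "pivot_prog = (27 ::= N 0;; 28 ::= N 0;; 29 ::= R 25 .+ R 7 .+ N 2);;
     While (Less (R 28) (R 8)) (
       Cond (Equal (M (R 29 .+ R 28)) (N 0)) Skip (27 ::= N 1;; Store (R 25) (R 28));;
       28 ::= R 28 .+ N 1);;
     Store (R 18) (M (R 18) .+ R 27)"

text \<open>The candidate is built in place in the first free slot of the target cell. This is why a
  cell has \<open>D + 1\<close> slots although at most \<open>D\<close> entries are kept.\<close>

definition insert_prog :: com where
  "insert_prog = 25 ::= R 19 .+ M (R 18) .* R 9;;
     coef_prog;; eval_prog;; monv_prog;; reduce_prog;; pivot_prog"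

section \<open>Correctness of the inner loops\<close>

lemma runs_While_wpb:
  fixes I :: "nat \<Rightarrow> (reg \<Rightarrow> nat) \<Rightarrow> (nat \<Rightarrow> nat) \<Rightarrow> bool"
  assumes "I 0 r m"
    and "\<And>j r m. j < l \<Longrightarrow> I j r m \<Longrightarrow> bsafe w b r m \<and> bv b r m \<and> wpb w P (I (Suc j)) r m"
    and "\<And>r m. I l r m \<Longrightarrow> bsafe w b r m \<and> \<not> bv b r m"
    and A: "1 + bcost b + cost_bound P \<le> A" "l * A + A \<le> C"
  shows "runs w (While b P) r m C (I l)"
proof (rule runs_While[where B = "cost_bound P"])
  have "l * (1 + bcost b + cost_bound P) \<le> l * A" using A(1) by (rule mult_le_mono2)
  then show "l * (1 + bcost b + cost_bound P) + 1 + bcost b \<le> C" using A by linarith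
qed (use assms(1-3) in \<open>auto simp: bval_bsafe intro: runs_wpb\<close>)

lemma runs_While_body:
  fixes I :: "nat \<Rightarrow> (reg \<Rightarrow> nat) \<Rightarrow> (nat \<Rightarrow> nat) \<Rightarrow> bool"
  assumes "I 0 r m"
    and "\<And>j r m. j < l \<Longrightarrow> I j r m \<Longrightarrow> bsafe w b r m \<and> bv b r m \<and> runs w P r m B (I (Suc j))"
    and "\<And>r m. I l r m \<Longrightarrow> bsafe w b r m \<and> \<not> bv b r m"
    and A: "1 + bcost b + B \<le> A" "l * A + A \<le> C"
  shows "runs w (While b P) r m C (I l)"
proof (rule runs_While[where B = B])
  have "l * (1 + bcost b + B) \<le> l * A" using A(1) by (rule mult_le_mono2)
  then show "l * (1 + bcost b + B) + 1 + bcost b \<le> C" using A by linarith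
qed (use assms(1-3) in \<open>auto simp: bval_bsafe\<close>)

definition same :: "nat \<Rightarrow> (reg \<Rightarrow> nat) \<Rightarrow> (reg \<Rightarrow> nat) \<Rightarrow> bool" where
  "same l r r' \<longleftrightarrow> (\<forall>x<l. r' x = r x)"

lemma same_refl [simp]: "same l r r"
  by (simp add: same_def)

lemma sameD: "same l r r' \<Longrightarrow> x < l \<Longrightarrow> r' x = r x"
  by (simp add: same_def)

lemma same_upd [simp]: "l \<le> x \<Longrightarrow> same l r (r'(x := a)) \<longleftrightarrow> same l r r'"
  by (auto simp: same_def)

definition wr :: "(nat \<Rightarrow> nat) \<Rightarrow> nat \<Rightarrow> nat \<Rightarrow> (nat \<Rightarrow> nat) \<Rightarrow> nat \<Rightarrow> nat" where
  "wr m B l f a = (if B \<le> a \<and> a < B + l then f (a - B) else m a)"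

lemma wr_0 [simp]: "wr m B 0 f = m"
  by (simp add: wr_def fun_eq_iff)

lemma wr_Suc: "(wr m B j f)(B + j := f j) = wr m B (Suc j) f"
  by (auto simp: wr_def fun_eq_iff)

lemma wr_inside [simp]: "i < l \<Longrightarrow> wr m B l f (B + i) = f i"
  by (simp add: wr_def)

lemma wr_outside: "a < B \<or> B + l \<le> a \<Longrightarrow> wr m B l f a = m a"
  by (auto simp: wr_def)

lemma wr_cong: "(\<And>i. i < l \<Longrightarrow> f i = g i) \<Longrightarrow> wr m B l f = wr m B l g"
  by (auto simp: wr_def fun_eq_iff)

lemma two_less_word: "P \<ge> 2 \<Longrightarrow> 2 * (P * P) < 2 ^ w \<Longrightarrow> 2 < (2::nat) ^ w" for P :: nat
  using mult_le_mono[of 2 P 2 P] by simp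

lemma mod_less_word: "P \<ge> 2 \<Longrightarrow> 2 * (P * P) < 2 ^ w \<Longrightarrow> x mod P < (2::nat) ^ w" for P :: nat
  using mod_less_divisor[of P x] mult_le_mono[of 1 P P P] by linarith

lemma runs_coef:
  assumes r: "r 7 = L" "r 14 = P" "r 17 = d" "r 20 = C" "r 25 = B"
    and P: "P \<ge> 2" "2 * (P * P) < 2 ^ w" and d: "d \<le> P" and c: "\<And>i. i \<le> L \<Longrightarrow> m (C + 1 + i) < P"
    and addr: "C + L + 2 < 2 ^ w" "B + L + 2 < 2 ^ w" and disj: "C + L + 1 < B + 1 \<or> B + L + 1 < C + 1"
  shows "runs w coef_prog r m (40 * (L + 2)) (\<lambda>r' m'. same 26 r r' \<and>
    m' = wr m (B + 1) (L + 1) (shift_coef P L d (\<lambda>i. m (C + 1 + i))))"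
proof -
  let ?f = "shift_coef P L d (\<lambda>i. m (C + 1 + i))"
  \<comment> \<open>Register 27 holds the source coefficient with index \<open>j - 1\<close>, stored
    at \<open>C + 1 + (j - 1)\<close>, and 0 at the start.\<close>
  define I where "I = (\<lambda>j r' m'. same 26 r r' \<and> r' 28 = j \<and>
    r' 27 = (if j = 0 then 0 else m (C + j)) \<and> m' = wr m (B + 1) j ?f)"
  have small: "2 < (2::nat) ^ w" using P mult_le_mono[of 2 P 2 P] by simp
  have loop: "runs w (While (Less (R 28) (R 7 .+ N 1)) (29 ::= M (R 20 .+ N 1 .+ R 28);;
       Store (R 25 .+ N 1 .+ R 28) ((R 27 .+ R 17 .* R 29) .% R 14);;
       27 ::= R 29;;
       28 ::= R 28 .+ N 1))
      r0 m0 (35 * (L + 2)) (\<lambda>r' m'. same 26 r r' \<and> m' = wr m (B + 1) (L + 1) ?f)"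
    if "I 0 r0 m0" for r0 m0
  proof (rule runs_mono[OF runs_While_wpb[where I = I and l = "L + 1" and A = 35, OF that _ _ _ order.refl]])
      fix j r' m' assume j: "j < L + 1" and "I j r' m'"
      then have s: "same 26 r r'" and r': "r' 28 = j" "r' 27 = (if j = 0 then 0 else m (C + j))"
        and m': "m' = wr m (B + 1) j ?f" by (auto simp: I_def)
      have q: "r' 7 = L" "r' 14 = P" "r' 17 = d" "r' 20 = C" "r' 25 = B"
        using r sameD[OF s] by simp_all
      have mc: "m' (C + 1 + j) = m (C + 1 + j)" unfolding m' using disj j by (intro wr_outside) auto
      have le: "r' 27 \<le> P" unfolding r' using c[of "j - 1"] j by (cases j) auto
      have "d * m (C + 1 + j) \<le> P * P" using d c[of j] j by (intro mult_le_mono) auto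
      moreover have "P \<le> P * P" using P by simp
      ultimately have bnd: "r' 27 + d * m (C + 1 + j) < 2 ^ w" "d * m (C + 1 + j) < 2 ^ w"
        using le P(2) by linarith+
      have "(r' 27 + d * m (C + 1 + j)) mod P = ?f j"
        using j by (cases j) (auto simp: shift_coef_def r')
      moreover from this have "?f j < 2 ^ w" using mod_less_word[OF P] by metis
      moreover have "(wr m (B + 1) j ?f)(B + 1 + j := ?f j) = wr m (B + 1) (Suc j) ?f" by (rule wr_Suc)
      ultimately show "bsafe w (Less (R 28) (R 7 .+ N 1)) r' m' \<and> bv (Less (R 28) (R 7 .+ N 1)) r' m' \<and>
        wpb w (29 ::= M (R 20 .+ N 1 .+ R 28);;
         Store (R 25 .+ N 1 .+ R 28) ((R 27 .+ R 17 .* R 29) .% R 14);;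
         27 ::= R 29;;
         28 ::= R 28 .+ N 1) (I (Suc j)) r' m'"
        using s mc bnd q r'(1) j addr small P by (simp add: I_def m')
    next
      fix r' m' assume "I (L + 1) r' m'"
      then show "bsafe w (Less (R 28) (R 7 .+ N 1)) r' m' \<and> \<not> bv (Less (R 28) (R 7 .+ N 1)) r' m'"
        using r addr small by (auto simp: I_def sameD)
  qed (auto simp: I_def)
  show ?thesis
    unfolding coef_prog_def
    by (rule runs_Seq_wpb[where B' = "35 * (L + 2)"]) (use loop r small in \<open>simp_all add: I_def\<close>)
qed

lemma runs_horner:
  assumes r: "r 7 = L" "r 14 = P" "r 25 = B" "r 28 = y" "r 29 = 0" "r 30 = 0"
    and P: "P \<ge> 2" "2 * (P * P) < 2 ^ w" and y: "y < P" and c: "\<And>i. i \<le> L \<Longrightarrow> m (B + 1 + i) < P"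
    and addr: "B + L + 2 < 2 ^ w"
  shows "runs w horner_prog r m (40 * (L + 2)) (\<lambda>r' m'. same 29 r r' \<and> m' = m \<and>
    r' 29 < P \<and> [r' 29 = peval L (\<lambda>i. m (B + 1 + i)) y] (mod P))"
proof -
  let ?c = "\<lambda>i. m (B + 1 + i)"
  \<comment> \<open>The value of the polynomial formed by the \<open>j\<close> highest
    coefficients.\<close>
  define H where "H = (\<lambda>j. \<Sum>i<j. ?c (L + 1 - j + i) * y ^ i)"
  define I where "I = (\<lambda>j r' m'. same 29 r r' \<and> r' 30 = j \<and> r' 29 < P \<and>
    [r' 29 = H j] (mod P) \<and> m' = m)"
  have small: "2 < (2::nat) ^ w" using P by (rule two_less_word)
  have H_Suc: "H (Suc j) = H j * y + ?c (L - j)" if "j \<le> L" for j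
  proof -
    have "H (Suc j) = ?c (L - j) + (\<Sum>i<j. ?c (L - j + Suc i) * y ^ Suc i)"
      unfolding H_def by (subst sum.lessThan_Suc_shift) simp
    also have "(\<Sum>i<j. ?c (L - j + Suc i) * y ^ Suc i) = (\<Sum>i<j. ?c (L + 1 - j + i) * y ^ i * y)"
      using that by (intro sum.cong) (auto simp: Suc_diff_le)
    finally show ?thesis by (simp add: H_def sum_distrib_right)
  qed
  show ?thesis
    unfolding horner_prog_def
  proof (rule runs_mono[OF runs_While_wpb[where I = I and l = "L + 1" and A = 35, OF _ _ _ _ order.refl]])
    fix j r' m' assume j: "j < L + 1" and "I j r' m'"
    then have s: "same 29 r r'" and r': "r' 30 = j" "r' 29 < P" "[r' 29 = H j] (mod P)"
      and m': "m' = m" by (auto simp: I_def)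
    have q: "r' 7 = L" "r' 14 = P" "r' 28 = y" "r' 25 = B"
      using r sameD[OF s] by simp_all
    have "r' 29 * y \<le> P * P" using r'(2) y by (intro mult_le_mono) auto
    moreover have "P \<le> P * P" using P by simp
    moreover have "?c (L - j) < P" by (rule c) simp
    ultimately have bnd: "r' 29 * y < 2 ^ w" "r' 29 * y + ?c (L - j) < 2 ^ w"
      using P(2) by linarith+
    have idx: "B + 1 + L - j = B + 1 + (L - j)" using j by simp
    have "[r' 29 * y + ?c (L - j) = H j * y + ?c (L - j)] (mod P)"
      by (intro cong_add cong_mult cong_refl r'(3))
    then have "[(r' 29 * y + ?c (L - j)) mod P = H (Suc j)] (mod P)"
      using j H_Suc[of j] by simp
    moreover have "(r' 29 * y + ?c (L - j)) mod P < P" using P by simp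
    ultimately show "bsafe w (Less (R 30) (R 7 .+ N 1)) r' m' \<and> bv (Less (R 30) (R 7 .+ N 1)) r' m' \<and>
      wpb w (29 ::= (R 29 .* R 28 .+ M ((R 25 .+ N 1 .+ R 7) .- R 30)) .% R 14;;
       30 ::= R 30 .+ N 1) (I (Suc j)) r' m'"
      using s bnd q r'(1) j addr small P idx
      by (simp add: I_def m' mod_less_word)
  next
    fix r' m' assume "I (L + 1) r' m'"
    then show "bsafe w (Less (R 30) (R 7 .+ N 1)) r' m' \<and> \<not> bv (Less (R 30) (R 7 .+ N 1)) r' m'"
      using r addr small by (auto simp: I_def sameD)
  next
    fix r' m' assume "I (L + 1) r' m'"
    moreover have "H (L + 1) = peval L ?c y"
      by (simp add: H_def peval_def lessThan_Suc_atMost)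
    ultimately show "same 29 r r' \<and> m' = m \<and> r' 29 < P \<and> [r' 29 = peval L ?c y] (mod P)"
      by (simp add: I_def)
  qed (use r P in \<open>auto simp: I_def H_def\<close>)
qed

lemma cong_peval_mod: "[peval L c (x mod P) = peval L c x] (mod P)" for x P :: nat
  unfolding peval_def by (intro cong_sum cong_mult[OF cong_refl] cong_pow cong_mod_leftI cong_refl)

lemma runs_eval:
  assumes r: "r 7 = L" "r 14 = P" "r 22 = F" "r 23 = l" "r 25 = B"
    and P: "P \<ge> 2" "2 * (P * P) < 2 ^ w" and c: "\<And>i. i \<le> L \<Longrightarrow> m (B + 1 + i) < P"
    and addr: "B + L + 2 < 2 ^ w" "F + l < 2 ^ w"
  shows "runs w eval_prog r m (100 * (L + 2) * (l + 1)) (\<lambda>r' m'. same 26 r r' \<and> m' = m \<and>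
    r' 26 < P \<and> [r' 26 = (\<Prod>i\<leftarrow>[0..<l]. peval L (\<lambda>i. m (B + 1 + i)) (m (F + i)))] (mod P))"
proof -
  let ?c = "\<lambda>i. m (B + 1 + i)"
  define H where "H = (\<lambda>j. \<Prod>i\<leftarrow>[0..<j]. peval L ?c (m (F + i)))"
  define I where "I = (\<lambda>j r' m'. same 26 r r' \<and> r' 27 = j \<and> r' 26 < P \<and>
    [r' 26 = H j] (mod P) \<and> m' = m)"
  have small: "2 < (2::nat) ^ w" using P by (rule two_less_word)
  have Pw: "P < 2 ^ w" using P mult_le_mono[of 1 P P P] by linarith
  let ?body = "(28 ::= M (R 22 .+ R 27) .% R 14;; 29 ::= N 0;; 30 ::= N 0);;
       horner_prog;; (26 ::= (R 26 .* R 29) .% R 14;; 27 ::= R 27 .+ N 1)"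
  have body: "runs w ?body r' m' (40 * (L + 2) + 30) (I (Suc j))"
    if j: "j < l" and I: "I j r' m'" for j r' m'
  proof -
    have s: "same 26 r r'" and r': "r' 27 = j" "r' 26 < P" "[r' 26 = H j] (mod P)"
      and m': "m' = m" using I by (auto simp: I_def)
    have q: "r' 7 = L" "r' 14 = P" "r' 22 = F" "r' 23 = l" "r' 25 = B"
      using r sameD[OF s] by simp_all
    define y where "y = m (F + j) mod P"
    define r1 where "r1 = r'(28 := y, 29 := 0, 30 := 0)"
    have y: "y < P" using P by (simp add: y_def)
    show ?thesis
    proof (rule runs_Seq_wpb)
      have "runs w (horner_prog;; (26 ::= (R 26 .* R 29) .% R 14;; 27 ::= R 27 .+ N 1)) r1 m
          (40 * (L + 2) + 14) (I (Suc j))"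
      proof (rule runs_Seq[OF runs_horner[where y = y]])
        show "r1 7 = L" "r1 14 = P" "r1 25 = B" "r1 28 = y" "r1 29 = 0" "r1 30 = 0"
          using q by (simp_all add: r1_def)
        fix r2 m2
        assume a: "same 29 r1 r2 \<and> m2 = m \<and> r2 29 < P \<and> [r2 29 = peval L ?c y] (mod P)"
        have t: "r2 14 = P" "r2 26 = r' 26" "r2 27 = j" using a q r' by (simp_all add: same_def r1_def)
        have "same 26 r r2"
          using a s by (auto simp: same_def r1_def)
        moreover have "[r' 26 * r2 29 = H (Suc j)] (mod P)"
        proof -
          have "[r2 29 = peval L ?c (m (F + j))] (mod P)"
            using a cong_peval_mod[of L ?c "m (F + j)" P] unfolding y_def by (blast intro: cong_trans)
          then show ?thesis using r'(3) by (simp add: H_def cong_mult)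
        qed
        moreover have "r' 26 * r2 29 \<le> P * P" using a r' by (intro mult_le_mono) auto
        ultimately show "runs w (26 ::= (R 26 .* R 29) .% R 14;; 27 ::= R 27 .+ N 1) r2 m2 13 (I (Suc j))"
          using a t P addr j by (intro runs_wpb) (auto simp: I_def mod_less_word)
      qed (use P y c addr in auto)
      then show "wpb w (28 ::= M (R 22 .+ R 27) .% R 14;; 29 ::= N 0;; 30 ::= N 0)
          (\<lambda>r' m'. runs w (horner_prog;; (26 ::= (R 26 .* R 29) .% R 14;; 27 ::= R 27 .+ N 1)) r' m'
          (40 * (L + 2) + 14) (I (Suc j))) r' m'"
        using q r' addr j small y Pw by (simp add: m' r1_def y_def mod_less_word[OF P])
    qed simp
  qed
  have loop: "runs w (While (Less (R 27) (R 23)) ?body) r0 m0 ((40 * (L + 2) + 50) * (l + 1))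
      (\<lambda>r' m'. same 26 r r' \<and> m' = m \<and> r' 26 < P \<and> [r' 26 = H l] (mod P))"
    if "I 0 r0 m0" for r0 m0
  proof (rule runs_mono[OF runs_While_body[where I = I and l = l and A = "40 * (L + 2) + 50", OF that _ _ _ order.refl]])
    fix j r' m' assume j: "j < l" and I: "I j r' m'"
    then show "bsafe w (Less (R 27) (R 23)) r' m' \<and> bv (Less (R 27) (R 23)) r' m' \<and>
        runs w ?body r' m' (40 * (L + 2) + 30) (I (Suc j))"
      using body[OF j I] r by (auto simp: I_def sameD)
  next
    fix r' m' assume "I l r' m'"
    then show "bsafe w (Less (R 27) (R 23)) r' m' \<and> \<not> bv (Less (R 27) (R 23)) r' m'"
      using r by (auto simp: I_def sameD)
  qed (auto simp: I_def)
  show ?thesis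
    unfolding eval_prog_def
    by (rule runs_Seq_wpb[where B' = "(40 * (L + 2) + 50) * (l + 1)"])
      (use loop small P in \<open>simp_all add: I_def H_def algebra_simps\<close>)
qed

lemma runs_mon:
  assumes r: "r 7 = L" "r 14 = P" "r 28 = h" "r 29 = b" "r 30 = B + 1" "r 31 = 0"
    and P: "P \<ge> 2" "2 * (P * P) < 2 ^ w" and h: "h < P"
    and c: "\<And>i. i \<le> L \<Longrightarrow> m (B + 1 + i) = c i" "\<And>i. i \<le> L \<Longrightarrow> c i < P"
    and addr: "B + L + 2 < 2 ^ w" and b: "b < 2 ^ w"
  shows "runs w mon_prog r m (40 * (L + 1)) (\<lambda>r' m'. same 28 r r' \<and> m' = m \<and>
    r' 28 = h * monv L c b mod P)"
proof -
  \<comment> \<open>The accumulator times the part of the monomial encoded by the remaining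
    \<open>L - j\<close> bits is constant modulo \<open>P\<close>; \<open>i\<close> counts the 1s
    read so far.\<close>
  define I where "I = (\<lambda>j r' m'. same 28 r r' \<and> r' 31 = j \<and> r' 28 < P \<and> r' 29 < 2 ^ w \<and>
    (\<exists>i\<le>j. r' 30 = B + 1 + i \<and> r' 28 * mon c i (r' 29) (L - j) mod P = h * mon c 0 b L mod P) \<and> m' = m)"
  have small: "2 < (2::nat) ^ w" using P by (rule two_less_word)
  show ?thesis
    unfolding mon_prog_def
  proof (rule runs_mono[OF runs_While_wpb[where I = I and l = L and A = 40, OF _ _ _ _ order.refl]])
    fix j r' m' assume j: "j < L" and "I j r' m'"
    then obtain i where s: "same 28 r r'" and r': "r' 31 = j" "r' 28 < P" "r' 29 < 2 ^ w" "i \<le> j"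
      "r' 30 = B + 1 + i" "r' 28 * mon c i (r' 29) (L - j) mod P = h * mon c 0 b L mod P"
      and m': "m' = m" by (auto simp: I_def)
    have q: "r' 7 = L" "r' 14 = P" using r sameD[OF s] by simp_all
    have Lj: "L - j = Suc (L - Suc j)" using j by simp
    have ci: "c i < P" "m (Suc (B + i)) = c i" using c(1,2)[of i] r'(4) j by simp_all
    have "r' 28 * c i \<le> P * P" using r'(2) ci by (intro mult_le_mono) auto
    then have bnd: "r' 28 * c i < 2 ^ w" using P by linarith
    have b2: "r' 29 div 2 < 2 ^ w" "r' 29 mod 2 < 2 ^ w" using r'(3) small by auto
    have "I (Suc j) (r'(30 := r' 30 + 1, 29 := r' 29 div 2, 31 := Suc j)) m" if "odd (r' 29)"
      unfolding I_def using that s r' b2 Lj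
      by (auto intro!: exI[of _ "Suc i"])
    moreover have "I (Suc j) (r'(28 := r' 28 * c i mod P, 29 := r' 29 div 2, 31 := Suc j)) m"
      if "even (r' 29)"
      unfolding I_def using that s r' b2 Lj P
      by (auto intro!: exI[of _ i] simp: mult.assoc mod_mult_left_eq)
    ultimately show "bsafe w (Less (R 31) (R 7)) r' m' \<and> bv (Less (R 31) (R 7)) r' m' \<and>
      wpb w (Cond (Equal (R 29 .% N 2) (N 1)) (30 ::= R 30 .+ N 1) (28 ::= (R 28 .* M (R 30)) .% R 14);;
       29 ::= R 29 ./ N 2;;
       31 ::= R 31 .+ N 1) (I (Suc j)) r' m'"
      using q r'(1,4,5) j addr small bnd b2 ci
      by (auto simp: m' mod_less_word[OF P] odd_iff_mod_2_eq_one fun_upd_twist)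
  next
    fix r' m' assume "I L r' m'"
    then show "bsafe w (Less (R 31) (R 7)) r' m' \<and> \<not> bv (Less (R 31) (R 7)) r' m'"
      using r by (auto simp: I_def sameD)
  next
    fix r' m' assume "I L r' m'"
    then show "same 28 r r' \<and> m' = m \<and> r' 28 = h * monv L c b mod P"
      by (auto simp: I_def monv_def)
  qed (use r h b in \<open>auto simp: I_def\<close>)
qed

lemma runs_monv:
  assumes r: "r 7 = L" "r 8 = D" "r 14 = P" "r 25 = B" "r 26 = h"
    and P: "P \<ge> 2" "2 * (P * P) < 2 ^ w" and h: "h < P"
    and c: "\<And>i. i \<le> L \<Longrightarrow> m (B + 1 + i) = c i" "\<And>i. i \<le> L \<Longrightarrow> c i < P"
    and addr: "B + L + 2 + D < 2 ^ w"
  shows "runs w monv_prog r m (100 * (L + 1) * (D + 1)) (\<lambda>r' m'. same 27 r r' \<and>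
    m' = wr m (B + L + 2) D (\<lambda>x. h * monv L c x mod P))"
proof -
  let ?f = "\<lambda>x. h * monv L c x mod P"
  define I where "I = (\<lambda>j r' m'. same 27 r r' \<and> r' 27 = j \<and> m' = wr m (B + L + 2) j ?f)"
  have small: "2 < (2::nat) ^ w" using P by (rule two_less_word)
  let ?body = "(28 ::= R 26;; 29 ::= R 27;; 30 ::= R 25 .+ N 1;; 31 ::= N 0);;
       mon_prog;;
       (Store (R 25 .+ R 7 .+ N 2 .+ R 27) (R 28);; 27 ::= R 27 .+ N 1)"
  have body: "runs w ?body r' m' (40 * (L + 1) + 40) (I (Suc j))"
    if j: "j < D" and I: "I j r' m'" for j r' m'
  proof -
    have s: "same 27 r r'" and r': "r' 27 = j" and m': "m' = wr m (B + L + 2) j ?f"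
      using I by (auto simp: I_def)
    have q: "r' 7 = L" "r' 14 = P" "r' 25 = B" "r' 26 = h"
      using r sameD[OF s] by simp_all
    define r1 where "r1 = r'(28 := h, 29 := j, 30 := B + 1, 31 := 0)"
    have "runs w (mon_prog;; (Store (R 25 .+ R 7 .+ N 2 .+ R 27) (R 28);; 27 ::= R 27 .+ N 1)) r1 m'
        (40 * (L + 1) + 20) (I (Suc j))"
    proof (rule runs_Seq[OF runs_mon[where c = c and b = j and h = h]])
      show "m' (B + 1 + i) = c i" if "i \<le> L" for i
        using c(1)[OF that] that by (simp add: m' wr_outside)
      fix r2 m2 assume a: "same 28 r1 r2 \<and> m2 = m' \<and> r2 28 = h * monv L c j mod P"
      have t: "r2 25 = B" "r2 7 = L" "r2 27 = j" using a q r' by (simp_all add: same_def r1_def)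
      have "same 27 r r2" using a s by (auto simp: same_def r1_def)
      then show "runs w (Store (R 25 .+ R 7 .+ N 2 .+ R 27) (R 28);; 27 ::= R 27 .+ N 1) r2 m2 18 (I (Suc j))"
        using a t addr j small wr_Suc[of m "B + L + 2" j ?f]
        by (intro runs_wpb) (auto simp: I_def m')
    qed (use P h c(2) addr j q in \<open>auto simp: r1_def\<close>)
    then show ?thesis
      using q r' addr small
      by (intro runs_Seq_wpb[where B' = "40 * (L + 1) + 20"]) (simp_all add: r1_def)
  qed
  have loop: "runs w (While (Less (R 27) (R 8)) ?body) r0 m0 ((40 * (L + 1) + 50) * (D + 1))
      (\<lambda>r' m'. same 27 r r' \<and> m' = wr m (B + L + 2) D ?f)"
    if "I 0 r0 m0" for r0 m0
  proof (rule runs_mono[OF runs_While_body[where I = I and l = D and A = "40 * (L + 1) + 50",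
        OF that _ _ _ order.refl]])
    fix j r' m' assume j: "j < D" and I: "I j r' m'"
    then show "bsafe w (Less (R 27) (R 8)) r' m' \<and> bv (Less (R 27) (R 8)) r' m' \<and>
        runs w ?body r' m' (40 * (L + 1) + 40) (I (Suc j))"
      using body[OF j I] r by (auto simp: I_def sameD)
  next
    fix r' m' assume "I D r' m'"
    then show "bsafe w (Less (R 27) (R 8)) r' m' \<and> \<not> bv (Less (R 27) (R 8)) r' m'"
      using r by (auto simp: I_def sameD)
  qed (auto simp: I_def)
  show ?thesis
    unfolding monv_prog_def
    by (rule runs_Seq_wpb[where B' = "(40 * (L + 1) + 50) * (D + 1)"])
      (use loop in \<open>simp_all add: I_def algebra_simps\<close>)
qed

lemma runs_combine:
  assumes r: "r 8 = D" "r 14 = P" "r 30 = rb" "r 31 = b" "r 32 = a" "r 33 = vb" "r 34 = 0"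
    and P: "P \<ge> 2" "2 * (P * P) < 2 ^ w" and ab: "a < P" "b \<le> P"
    and v: "\<And>x. x < D \<Longrightarrow> m (vb + x) < P" "\<And>x. x < D \<Longrightarrow> m (rb + x) < P"
    and addr: "vb + D < 2 ^ w" "rb + D < 2 ^ w" and disj: "rb + D \<le> vb"
  shows "runs w combine_prog r m (50 * (D + 1)) (\<lambda>r' m'. same 34 r r' \<and>
    m' = wr m vb D (\<lambda>x. (a * m (vb + x) + b * m (rb + x)) mod P))"
proof -
  let ?f = "\<lambda>x. (a * m (vb + x) + b * m (rb + x)) mod P"
  define I where "I = (\<lambda>j r' m'. same 34 r r' \<and> r' 34 = j \<and> m' = wr m vb j ?f)"
  have small: "2 < (2::nat) ^ w" using P by (rule two_less_word)
  show ?thesis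
    unfolding combine_prog_def
  proof (rule runs_mono[OF runs_While_wpb[where I = I and l = D and A = 40, OF _ _ _ _ order.refl]])
    fix j r' m' assume j: "j < D" and "I j r' m'"
    then have s: "same 34 r r'" and r': "r' 34 = j" and m': "m' = wr m vb j ?f"
      by (auto simp: I_def)
    have q: "r' 8 = D" "r' 14 = P" "r' 30 = rb" "r' 31 = b" "r' 32 = a" "r' 33 = vb"
      using r sameD[OF s] by simp_all
    have mm: "m' (vb + j) = m (vb + j)" "m' (rb + j) = m (rb + j)"
      using disj j by (auto simp: m' wr_outside)
    have "a * m (vb + j) \<le> P * P" "b * m (rb + j) \<le> P * P"
      using ab v[OF j] by (intro mult_le_mono; simp)+
    then have bnd: "a * m (vb + j) < 2 ^ w" "b * m (rb + j) < 2 ^ w"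
      "a * m (vb + j) + b * m (rb + j) < 2 ^ w"
      using P by linarith+
    show "bsafe w (Less (R 34) (R 8)) r' m' \<and> bv (Less (R 34) (R 8)) r' m' \<and>
      wpb w (Store (R 33 .+ R 34) ((R 32 .* M (R 33 .+ R 34) .+ R 31 .* M (R 30 .+ R 34)) .% R 14);;
       34 ::= R 34 .+ N 1) (I (Suc j)) r' m'"
      using q r' j addr small bnd mm s wr_Suc[of m vb j ?f]
      by (simp add: mod_less_word[OF P] I_def m')
  next
    fix r' m' assume "I D r' m'"
    then show "bsafe w (Less (R 34) (R 8)) r' m' \<and> \<not> bv (Less (R 34) (R 8)) r' m'"
      using r by (auto simp: I_def sameD)
  qed (use r in \<open>auto simp: I_def\<close>)
qed

lemma runs_reduce:
  fixes B L D TS S t :: nat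
  defines "V \<equiv> B + L + 2"
  assumes r: "r 7 = L" "r 8 = D" "r 9 = S" "r 14 = P" "r 18 = CA" "r 19 = TS" "r 25 = B"
    and P: "P \<ge> 2" "2 * (P * P) < 2 ^ w" and S: "S = L + 2 + D" and B: "B = TS + t * S"
    and t: "m CA = t" and CA: "CA < TS"
    and pv: "\<And>q. q < t \<Longrightarrow> m (TS + q * S) < D"
    and rw: "\<And>q x. q < t \<Longrightarrow> x < D \<Longrightarrow> m (TS + q * S + L + 2 + x) < P"
    and v: "\<And>x. x < D \<Longrightarrow> m (V + x) < P"
    and addr: "B + S < 2 ^ w"
  shows "runs w reduce_prog r m (150 * (D + 1) * (t + 1)) (\<lambda>r' m'. same 27 r r' \<and>
    m' = wr m V D (reduce P (\<lambda>q x. m (TS + q * S + L + 2 + x)) (\<lambda>q. m (TS + q * S)) t (\<lambda>x. m (V + x))))"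
proof -
  let ?rw = "\<lambda>q x. m (TS + q * S + L + 2 + x)" and ?pv = "\<lambda>q. m (TS + q * S)"
  define f where "f = (\<lambda>q. reduce P ?rw ?pv q (\<lambda>x. m (V + x)))"
  define I where "I = (\<lambda>q r' m'. same 27 r r' \<and> r' 27 = q \<and> r' 28 = TS + q * S \<and> r' 29 = t \<and>
    r' 33 = V \<and> m' = wr m V D (f q))"
  have small: "2 < (2::nat) ^ w" using P by (rule two_less_word)
  have Pw: "P < 2 ^ w" using P mult_le_mono[of 1 P P P] by linarith
  have slot: "TS + q * S + S \<le> B" if "q < t" for q
    using mult_le_mono1[of "Suc q" t S] that by (simp add: B)
  have fP: "f q x < P" if "x < D" for q x
    unfolding f_def using v that by (intro reduce_less[where D = D]) auto
  have tB: "t \<le> B" using S B by simp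
  let ?body = "(30 ::= R 28 .+ R 7 .+ N 2;; 31 ::= M (R 28);; 32 ::= M (R 30 .+ R 31);;
        31 ::= R 14 .- M (R 33 .+ R 31);; 34 ::= N 0);;
       combine_prog;;
       (28 ::= R 28 .+ R 9;; 27 ::= R 27 .+ N 1)"
  have body: "runs w ?body r' m' (50 * (D + 1) + 70) (I (Suc q))"
    if q: "q < t" and I: "I q r' m'" for q r' m'
  proof -
    have s: "same 27 r r'" and r': "r' 27 = q" "r' 28 = TS + q * S" "r' 29 = t" "r' 33 = V"
      and m': "m' = wr m V D (f q)"
      using I by (auto simp: I_def)
    have g: "r' 7 = L" "r' 9 = S" "r' 14 = P"
      using r sameD[OF s] by simp_all
    note sl = slot[OF q]
    have out: "m' a = m a" if "a < TS + q * S + S" for a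
      using sl that by (simp add: m' wr_outside V_def)
    define p where "p = ?pv q"
    have p: "p < D" using pv[OF q] by (simp add: p_def)
    have rwq: "m' (TS + q * S + L + 2 + x) = ?rw q x" if "x < D" for x
      using out that S by simp
    have vq: "m' (V + x) = f q x" if "x < D" for x using that by (simp add: m')
    have fS: "f (Suc q) x = (?rw q p * f q x + (P - f q p) * ?rw q x) mod P" for x
      by (simp add: f_def p_def)
    define r1 where "r1 = r'(30 := TS + q * S + L + 2, 31 := p, 32 := ?rw q p, 31 := P - f q p, 34 := 0)"
    have "runs w (combine_prog;; (28 ::= R 28 .+ R 9;; 27 ::= R 27 .+ N 1)) r1 m'
        (50 * (D + 1) + 20) (I (Suc q))"
    proof (rule runs_Seq[OF runs_combine[where D = D and vb = V and rb = "TS + q * S + L + 2"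
            and a = "?rw q p" and b = "P - f q p"]])
      show "r1 8 = D" using r sameD[OF s] by (simp add: r1_def)
      show "?rw q p < P" using rw[OF q p] .
      fix r2 m2 assume a: "same 34 r1 r2 \<and>
        m2 = wr m' V D (\<lambda>x. (?rw q p * m' (V + x) + (P - f q p) * m' (TS + q * S + L + 2 + x)) mod P)"
      have t: "r2 28 = TS + q * S" "r2 9 = S" "r2 27 = q" "r2 29 = t" "r2 33 = V"
        using a g r' by (simp_all add: same_def r1_def)
      have s2: "same 27 r r2" using a s by (auto simp: same_def r1_def)
      have "m2 = wr m' V D (\<lambda>x. (?rw q p * m' (V + x) +
          (P - f q p) * m' (TS + q * S + L + 2 + x)) mod P)" using a by blast
      also have "\<dots> = wr m' V D (f (Suc q))"
        by (rule wr_cong) (simp only: vq rwq fS)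
      also have "\<dots> = wr m V D (f (Suc q))" by (auto simp: m' wr_def fun_eq_iff)
      finally show "runs w (28 ::= R 28 .+ R 9;; 27 ::= R 27 .+ N 1) r2 m2 10 (I (Suc q))"
        using s2 t addr sl tB q by (intro runs_wpb) (auto simp: I_def)
    qed (use P addr g r' sl rw[OF q] rwq vq fP S in \<open>auto simp: r1_def V_def\<close>)
    moreover have "TS + q * S + L + 2 + p < 2 ^ w" "V + p < 2 ^ w"
      using addr sl p S by (auto simp: V_def)
    moreover have "m' (TS + q * S) = p" using out[of "TS + q * S"] S by (simp add: p_def)
    ultimately show ?thesis
      using g r' small rwq[OF p] vq[OF p] Pw
      by (intro runs_Seq_wpb[where B' = "50 * (D + 1) + 20"])
        (simp_all add: r1_def)
  qed
  have loop: "runs w (While (Less (R 27) (R 29)) ?body) r0 m0 ((50 * (D + 1) + 80) * (t + 1))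
      (\<lambda>r' m'. same 27 r r' \<and> m' = wr m V D (f t))"
    if "I 0 r0 m0" for r0 m0
  proof (rule runs_mono[OF runs_While_body[where I = I and l = t and A = "50 * (D + 1) + 80",
        OF that _ _ _ order.refl]])
    fix j r' m' assume j: "j < t" and I: "I j r' m'"
    then show "bsafe w (Less (R 27) (R 29)) r' m' \<and> bv (Less (R 27) (R 29)) r' m' \<and>
        runs w ?body r' m' (50 * (D + 1) + 70) (I (Suc j))"
      using body[OF j I] by (auto simp: I_def)
  next
    fix r' m' assume "I t r' m'"
    then show "bsafe w (Less (R 27) (R 29)) r' m' \<and> \<not> bv (Less (R 27) (R 29)) r' m'"
      by (auto simp: I_def)
  qed (auto simp: I_def)
  have "wr m V D (f 0) = m" by (auto simp: wr_def f_def fun_eq_iff)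
  then show ?thesis
    unfolding reduce_prog_def f_def[symmetric]
    by (intro runs_Seq_wpb[where B' = "(50 * (D + 1) + 80) * (t + 1)"])
      (use loop r t addr small S in \<open>simp_all add: I_def V_def algebra_simps f_def\<close>)
qed

lemma runs_pivot:
  assumes r: "r 7 = L" "r 8 = D" "r 18 = CA" "r 25 = B"
    and t: "m CA = t" "t + 1 < 2 ^ w" and CA: "CA < B" and small: "2 < (2::nat) ^ w"
    and addr: "B + L + 2 + D < 2 ^ w"
  shows "runs w pivot_prog r m (60 * (D + 1)) (\<lambda>r' m'. same 27 r r' \<and>
    ((\<forall>x<D. m (B + L + 2 + x) = 0) \<and> m' = m \<or>
     (\<exists>p<D. m (B + L + 2 + p) \<noteq> 0 \<and> m' = m(B := p, CA := Suc t))))"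
proof -
  define V where "V = B + L + 2"
  define I where "I = (\<lambda>j r' m'. same 27 r r' \<and> r' 28 = j \<and> r' 29 = V \<and>
    ((\<forall>x<j. m (V + x) = 0) \<and> r' 27 = 0 \<and> m' = m \<or>
     (\<exists>p<j. m (V + p) \<noteq> 0 \<and> r' 27 = 1 \<and> m' = m(B := p))))"
  let ?loop = "While (Less (R 28) (R 8)) (
       Cond (Equal (M (R 29 .+ R 28)) (N 0)) Skip (27 ::= N 1;; Store (R 25) (R 28));;
       28 ::= R 28 .+ N 1)"
  have loop: "runs w ?loop r0 m0 (35 * (D + 1)) (I D)" if "I 0 r0 m0" for r0 m0
  proof (rule runs_While_wpb[where I = I and l = D and A = 35, OF that])
    fix j r' m' assume j: "j < D" and I: "I j r' m'"
    then have s: "same 27 r r'" and r': "r' 28 = j" "r' 29 = V" by (auto simp: I_def)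
    have q: "r' 8 = D" "r' 25 = B" using r sameD[OF s] by simp_all
    have mV: "m' (V + j) = m (V + j)" using I by (auto simp: I_def V_def)
    have "I (Suc j) (r'(28 := Suc j)) m'" if "m (V + j) = 0"
      using I that by (auto simp: I_def less_Suc_eq)
    moreover have "I (Suc j) (r'(27 := 1, 28 := Suc j)) (m'(B := j))" if "m (V + j) \<noteq> 0"
      using I that by (auto simp: I_def less_Suc_eq intro!: exI[of _ j])
    ultimately show "bsafe w (Less (R 28) (R 8)) r' m' \<and> bv (Less (R 28) (R 8)) r' m' \<and>
      wpb w (Cond (Equal (M (R 29 .+ R 28)) (N 0)) Skip (27 ::= N 1;; Store (R 25) (R 28));;
       28 ::= R 28 .+ N 1) (I (Suc j)) r' m'"
      using q r' mV j small addr by (auto simp: V_def)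
  next
    fix r' m' assume "I D r' m'"
    then show "bsafe w (Less (R 28) (R 8)) r' m' \<and> \<not> bv (Less (R 28) (R 8)) r' m'"
      using r by (auto simp: I_def sameD)
  qed auto
  have fin: "runs w (?loop;; Store (R 18) (M (R 18) .+ R 27)) r0 m0 (35 * (D + 1) + 10)
    (\<lambda>r' m'. same 27 r r' \<and>
    ((\<forall>x<D. m (V + x) = 0) \<and> m' = m \<or>
     (\<exists>p<D. m (V + p) \<noteq> 0 \<and> m' = m(B := p, CA := Suc t))))" if "I 0 r0 m0" for r0 m0
  proof (rule runs_Seq[OF loop[OF that]])
    fix r' m' assume I: "I D r' m'"
    then have q: "r' 18 = CA" using r sameD[of 27 r r' 18] by (simp add: I_def)
    have "m' CA = t" using I CA t by (auto simp: I_def)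
    moreover have "m(CA := t) = m" using t by auto
    ultimately show "runs w (Store (R 18) (M (R 18) .+ R 27)) r' m' 9
      (\<lambda>r' m'. same 27 r r' \<and> ((\<forall>x<D. m (V + x) = 0) \<and> m' = m \<or>
       (\<exists>p<D. m (V + p) \<noteq> 0 \<and> m' = m(B := p, CA := Suc t))))"
      using I q t(2) by (intro runs_wpb) (auto simp: I_def)
  qed simp
  show ?thesis
    unfolding pivot_prog_def V_def[symmetric]
    by (rule runs_Seq_wpb[where B' = "35 * (D + 1) + 10"])
      (use fin r small addr in \<open>simp_all add: I_def V_def\<close>)
qed

text \<open>A slot at address \<open>a\<close> holds a pivot at \<open>a\<close>, coefficients at \<open>a + 1, \<dots>, a + L + 1\<close>, and a row of
  length \<open>2 ^ L\<close> from \<open>a + L + 2\<close>.\<close>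

definition coefs :: "nat \<Rightarrow> (nat \<Rightarrow> nat) \<Rightarrow> nat \<Rightarrow> nat \<Rightarrow> nat" where
  "coefs L m a i = (if i \<le> L then m (a + 1 + i) else 0)"

definition slots_ok :: "nat \<Rightarrow> nat \<Rightarrow> nat \<Rightarrow> (nat \<Rightarrow> nat) \<Rightarrow> nat \<Rightarrow> nat \<Rightarrow> bool" where
  "slots_ok P L S m a t \<longleftrightarrow> echelon P L t (\<lambda>q. m (a + q * S)) (\<lambda>q x. m (a + q * S + L + 2 + x))
     (\<lambda>q. coefs L m (a + q * S))"

lemma slots_ok_cong:
  assumes "slots_ok P L S m a t" "S = L + 2 + 2 ^ L"
    and "\<And>b. a \<le> b \<Longrightarrow> b < a + t * S \<Longrightarrow> m' b = m b"
  shows "slots_ok P L S m' a t"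
proof -
  have le: "q * S + S \<le> t * S" if "q < t" for q using mult_le_mono1[of "Suc q" t S] that by simp
  show ?thesis
    using assms(1) unfolding slots_ok_def
  proof (rule echelon_cong)
    fix q assume q: "q < t"
    show "m' (a + q * S) = m (a + q * S)" using le[OF q] assms(2) by (intro assms(3)) auto
    show "m' (a + q * S + L + 2 + x) = m (a + q * S + L + 2 + x)" if "x < 2 ^ L" for x
      using le[OF q] assms(2) that by (intro assms(3)) auto
    show "coefs L m' (a + q * S) = coefs L m (a + q * S)"
      unfolding coefs_def using le[OF q] assms(2) by (intro ext if_cong assms(3)) auto
  qed
qed

lemma reduce_cong:
  assumes "\<And>q x. q < t \<Longrightarrow> x < D \<Longrightarrow> rw q x = rw' q x" "\<And>q. q < t \<Longrightarrow> pv q = pv' q"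
    "\<And>q. q < t \<Longrightarrow> pv q < D" "\<And>x. x < D \<Longrightarrow> v x = v' x" "x < D"
  shows "reduce P rw pv t v x = reduce P rw' pv' t v' x"
  using assms
proof (induction t arbitrary: x)
  case (Suc t)
  have "reduce P rw pv t v y = reduce P rw' pv' t v' y" if "y < D" for y
    using Suc.prems that by (intro Suc.IH) auto
  then show ?case using Suc.prems by auto
qed simp

text \<open>If the reduced vector is zero, the candidate is forbidden or already represented;
  otherwise it becomes a new echelon row. Only the count and the candidate's own slot can change, so
  the other cells and the older slots survive.\<close>

lemma runs_insert:
  fixes L D TS S t P :: nat
  defines "B \<equiv> TS + t * S"
  assumes r: "r 7 = L" "r 8 = D" "r 9 = S" "r 14 = P" "r 17 = d" "r 18 = CA" "r 19 = TS" "r 20 = C"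
      "r 22 = F" "r 23 = l"
    and P: "prime P" "2 * (P * P) < 2 ^ w" and d: "d \<le> P" and D: "D = 2 ^ L" and S: "S = L + 2 + D"
    and t: "m CA = t" and ok: "slots_ok P L S m TS t"
    and c: "\<And>i. coefs L m C i < P"
    and lay: "F + l \<le> CA" "CA < TS" "C + S \<le> TS \<or> B + S \<le> C"
    and addr: "B + S < 2 ^ w" "C + S < 2 ^ w"
    and c'_def: "c' = shift_coef P L d (coefs L m C)"
    and h_def: "h = (\<Prod>i\<leftarrow>[0..<l]. peval L c' (m (F + i)))"
  shows "runs w insert_prog r m (1000 * (L + 2) * (D + 1) * (D + 1) + 100 * (L + 2) * (l + 1)) (\<lambda>r' m'. same 25 r r' \<and>
    (\<forall>a. a \<noteq> CA \<and> (a < B \<or> B + S \<le> a) \<longrightarrow> m' a = m a) \<and>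
    (m' CA = t \<and> (\<not> P dvd h \<longrightarrow> represented P L t (\<lambda>q. coefs L m (TS + q * S)) c') \<or>
     m' CA = Suc t \<and> \<not> P dvd h \<and> slots_ok P L S m' TS (Suc t) \<and> coefs L m' B = c'))"
proof -
  have P2: "P \<ge> 2" using P(1) by (rule prime_ge_2_nat)
  have small: "2 < (2::nat) ^ w" using P2 P(2) by (rule two_less_word)
  have tD: "t \<le> D" using ok echelon_le unfolding slots_ok_def D by blast
  define V where "V = B + L + 2"
  define pv where "pv = (\<lambda>q. m (TS + q * S))"
  define rw where "rw = (\<lambda>q x. m (TS + q * S + L + 2 + x))"
  define cf where "cf = (\<lambda>q. coefs L m (TS + q * S))"
  have ech: "echelon P L t pv rw cf" using ok by (simp add: slots_ok_def pv_def rw_def cf_def)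
  have slot: "TS + q * S + S \<le> B" if "q < t" for q
    using mult_le_mono1[of "Suc q" t S] that by (simp add: B_def)
  have tB: "t \<le> t * S" using S by simp
  have tw: "t * S < 2 ^ w" "t + 1 < 2 ^ w" using addr(1) S tB by (auto simp: B_def)
  have CAB: "CA < B" using lay by (simp add: B_def)
  have disj: "C + S \<le> B \<or> B + S \<le> C" using lay(3) by (auto simp: B_def)
  have c'P: "c' i < P" for i using P2 by (simp add: c'_def shift_coef_def)
  have c'0: "c' i = 0" if "i > L" for i using that by (simp add: c'_def shift_coef_def)
  define r1 where "r1 = r(25 := B)"
  have r1: "r1 7 = L" "r1 8 = D" "r1 9 = S" "r1 14 = P" "r1 17 = d" "r1 18 = CA" "r1 19 = TS" "r1 20 = C"
      "r1 22 = F" "r1 23 = l" "r1 25 = B" using r by (simp_all add: r1_def)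
  define m1 where "m1 = wr m (B + 1) (L + 1) c'"
  have "shift_coef P L d (\<lambda>i. m (C + 1 + i)) = c'"
    by (auto simp: c'_def shift_coef_def coefs_def fun_eq_iff)
  note shift = this
  have coef: "runs w coef_prog r1 m (40 * (L + 2)) (\<lambda>r' m'. same 26 r1 r' \<and> m' = m1)"
  proof (rule runs_mono[OF runs_coef[OF r1(1,4,5,8,11) P2 P(2) d] order.refl])
    show "m (C + 1 + i) < P" if "i \<le> L" for i using c[of i] that by (simp add: coefs_def)
    show "C + L + 1 < B + 1 \<or> B + L + 1 < C + 1" using disj S by auto
  qed (use addr S shift in \<open>auto simp: m1_def\<close>)
  have m1c: "m1 (B + 1 + i) = c' i" if "i \<le> L" for i
    unfolding m1_def using that by (subst wr_inside) auto
  have m1F: "m1 (F + i) = m (F + i)" if "i < l" for i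
    using that lay CAB by (simp add: m1_def wr_outside)
  \<comment> \<open>The machine knows \<open>h\<close> only modulo \<open>P\<close>, which suffices
    because only divisibility by \<open>P\<close> matters.\<close>
  define h0 where "h0 = h mod P"
  have pc: "peval L (\<lambda>i. m1 (B + 1 + i)) = peval L c'"
    unfolding peval_def using m1c by (intro ext sum.cong) auto
  have hh: "(\<Prod>i\<leftarrow>[0..<l]. peval L (\<lambda>i. m1 (B + 1 + i)) (m1 (F + i))) = h"
    unfolding pc h_def using m1F by (intro arg_cong[where f = prod_list] map_cong) auto
  have eval: "runs w eval_prog r2 m1 (100 * (L + 2) * (l + 1))
      (\<lambda>r' m'. same 26 r1 r' \<and> m' = m1 \<and> r' 26 = h0)" if s: "same 26 r1 r2" for r2
  proof (rule runs_mono[OF runs_eval[OF _ _ _ _ _ P2 P(2)] order.refl])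
    show "r2 7 = L" "r2 14 = P" "r2 22 = F" "r2 23 = l" "r2 25 = B" using r1 sameD[OF s] by simp_all
    show "m1 (B + 1 + i) < P" if "i \<le> L" for i using m1c[OF that] c'P by simp
    fix r' m' assume "same 26 r2 r' \<and> m' = m1 \<and> r' 26 < P \<and>
      [r' 26 = (\<Prod>i\<leftarrow>[0..<l]. peval L (\<lambda>i. m1 (B + 1 + i)) (m1 (F + i)))] (mod P)"
    then show "same 26 r1 r' \<and> m' = m1 \<and> r' 26 = h0"
      using s unfolding hh by (auto simp: same_def h0_def cong_def)
  qed (use addr lay S CAB in auto)
  define u where "u = (\<lambda>x. h0 * monv L c' x mod P)"
  define m2 where "m2 = wr m1 V D u"
  have monv: "runs w monv_prog r2 m1 (100 * (L + 1) * (D + 1))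
      (\<lambda>r' m'. same 26 r1 r' \<and> m' = m2)" if s: "same 26 r1 r2" "r2 26 = h0" for r2
  proof (rule runs_mono[OF runs_monv[OF _ _ _ _ _ P2 P(2)] order.refl])
    show "r2 7 = L" "r2 8 = D" "r2 14 = P" "r2 25 = B" "r2 26 = h0" using r1 sameD[OF s(1)] s(2) by simp_all
    show "h0 < P" using P2 by (simp add: h0_def)
    fix r' m' assume "same 27 r2 r' \<and> m' = wr m1 (B + L + 2) D (\<lambda>x. h0 * monv L c' x mod P)"
    then show "same 26 r1 r' \<and> m' = m2"
      using s(1) by (auto simp: same_def m2_def u_def V_def)
  qed (use addr S c'P m1c in auto)
  have m2out: "m2 a = m a" if "a < B + 1" for a
    using that by (simp add: m2_def m1_def V_def wr_outside)
  have below: "m2 (TS + q * S) = pv q" "x < D \<Longrightarrow> m2 (TS + q * S + L + 2 + x) = rw q x"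
    if "q < t" for q x
    using slot[OF that] S by (auto simp: pv_def rw_def m2out)
  have m2V: "m2 (V + x) = u x" if "x < D" for x
    using that by (simp add: m2_def)
  have pvD: "pv q < D" "rw q (pv q) \<noteq> 0" "x < D \<Longrightarrow> rw q x < P" if "q < t" for q x
    using ech that by (auto simp: echelon_def D)
  define v where "v = reduce P rw pv t u"
  define m3 where "m3 = wr m2 V D v"
  have red: "runs w reduce_prog r2 m2 (150 * (D + 1) * (t + 1))
      (\<lambda>r' m'. same 26 r1 r' \<and> m' = m3)" if s: "same 26 r1 r2" for r2
  proof (rule runs_mono[OF runs_reduce[OF _ _ _ _ _ _ _ P2 P(2) S] order.refl])
    show "r2 7 = L" "r2 8 = D" "r2 9 = S" "r2 14 = P" "r2 18 = CA" "r2 19 = TS" "r2 25 = B"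
      using r1 sameD[OF s] by simp_all
    show "B = TS + t * S" by (simp add: B_def)
    show "m2 CA = t" using CAB t by (simp add: m2out)
    show "m2 (TS + q * S) < D" if "q < t" for q using below pvD that by simp
    show "m2 (TS + q * S + L + 2 + x) < P" if "q < t" "x < D" for q x using below pvD that by simp
    show "m2 (B + L + 2 + x) < P" if "x < D" for x
      using m2V[OF that] P2 by (simp add: V_def u_def)
    fix r' m' assume a: "same 27 r2 r' \<and> m' = wr m2 (B + L + 2) D
      (reduce P (\<lambda>q x. m2 (TS + q * S + L + 2 + x)) (\<lambda>q. m2 (TS + q * S)) t (\<lambda>x. m2 (B + L + 2 + x)))"
    have "wr m2 (B + L + 2) D
      (reduce P (\<lambda>q x. m2 (TS + q * S + L + 2 + x)) (\<lambda>q. m2 (TS + q * S)) t (\<lambda>x. m2 (B + L + 2 + x))) = m3"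
      unfolding m3_def v_def V_def
      by (intro wr_cong reduce_cong[where D = D]) (use below pvD m2V V_def in auto)
    then show "same 26 r1 r' \<and> m' = m3" using a s by (auto simp: same_def)
  qed (use addr lay in auto)
  have m3out: "m3 a = m2 a" if "a < V" for a using that by (simp add: m3_def wr_outside)
  have m3V: "m3 (V + x) = v x" if "x < D" for x using that by (simp add: m3_def)
  let ?Q = "\<lambda>r' m'. same 25 r r' \<and>
    (\<forall>a. a \<noteq> CA \<and> (a < B \<or> B + S \<le> a) \<longrightarrow> m' a = m a) \<and>
    (m' CA = t \<and> (\<not> P dvd h \<longrightarrow> represented P L t (\<lambda>q. coefs L m (TS + q * S)) c') \<or>
     m' CA = Suc t \<and> \<not> P dvd h \<and> slots_ok P L S m' TS (Suc t) \<and> coefs L m' B = c')"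
  have m3CA: "m3 CA = t" using CAB t by (simp add: m3out m2out V_def)
  have m3a: "m3 a = m a" if "a < B \<or> B + S \<le> a" for a
    using that S by (auto simp: m3_def m2_def m1_def V_def wr_def)
  have hP: "P dvd h0 \<longleftrightarrow> P dvd h" by (simp add: h0_def dvd_mod_iff)
  have v: "v = reduce P rw pv t (\<lambda>x. h0 * monv L c' x mod P)" by (simp add: v_def u_def)
  have pivot: "runs w pivot_prog r2 m3 (60 * (D + 1)) ?Q" if s: "same 26 r1 r2" for r2
  proof (rule runs_mono[OF runs_pivot order.refl])
    show "r2 7 = L" "r2 8 = D" "r2 18 = CA" "r2 25 = B" using r1 sameD[OF s] by simp_all
    fix r' m' assume a: "same 27 r2 r' \<and> ((\<forall>x<D. m3 (B + L + 2 + x) = 0) \<and> m' = m3 \<or>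
     (\<exists>p<D. m3 (B + L + 2 + p) \<noteq> 0 \<and> m' = m3(B := p, CA := Suc t)))"
    have "same 25 r r'" using a s by (auto simp: same_def r1_def)
    moreover have "m' a = m a" if "a \<noteq> CA" "a < B \<or> B + S \<le> a" for a
      using a m3a[OF that(2)] that S by auto
    moreover have "m' CA = t \<and> (\<not> P dvd h \<longrightarrow> represented P L t cf c') \<or>
      m' CA = Suc t \<and> \<not> P dvd h \<and> slots_ok P L S m' TS (Suc t) \<and> coefs L m' B = c'"
    proof (cases "\<forall>x<D. v x = 0")
      case True
      then have "m' = m3" using a m3V unfolding V_def by auto
      moreover have "represented P L t cf c'" if "\<not> P dvd h"
        by (rule represented_of_reduce_0[OF P(1) ech, of h0]) (use that hP True v D in auto)
      ultimately show ?thesis using m3CA by auto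
    next
      case False
      then obtain p where p: "p < D" "v p \<noteq> 0" "m' = m3(B := p, CA := Suc t)"
        using a m3V unfolding V_def by auto
      have nd: "\<not> P dvd h"
        using not_dvd_of_reduce[of P rw pv t h0 L c' p cf] p ech v D hP by simp
      have e: "echelon P L (Suc t) (pv(t := p)) (rw(t := v)) (cf(t := c'))"
        using p D by (intro echelon_extend[OF P(1) ech v]) auto
      have cB: "coefs L m' B = c'"
        unfolding coefs_def p(3) using CAB m1c c'0
        by (auto simp: fun_eq_iff m3out V_def m2_def wr_outside)
      have "slots_ok P L S m' TS (Suc t)"
        unfolding slots_ok_def
      proof (rule echelon_cong[OF e])
        fix q assume q: "q < Suc t"
        show "m' (TS + q * S) = (pv(t := p)) q"
        proof (cases "q = t")
          case True
          then show ?thesis using p(3) CAB by (simp add: B_def)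
        next
          case False
          then show ?thesis using q p(3) slot[of q] S lay m3a by (auto simp: pv_def)
        qed
        show "m' (TS + q * S + L + 2 + x) = (rw(t := v)) q x" if "x < 2 ^ L" for x
        proof (cases "q = t")
          case True
          then show ?thesis using p(3) CAB that m3V[of x] D by (simp add: V_def B_def)
        next
          case False
          then show ?thesis using q p(3) slot[of q] S lay m3a that D by (auto simp: rw_def)
        qed
        show "coefs L m' (TS + q * S) = (cf(t := c')) q"
        proof (cases "q = t")
          case True
          then show ?thesis using cB by (simp add: B_def)
        next
          case False
          then show ?thesis using q p(3) slot[of q] S lay m3a by (auto simp: cf_def coefs_def fun_eq_iff)
        qed
      qed
      then show ?thesis using p(3) nd cB by simp
    qed
    ultimately show "?Q r' m'" unfolding cf_def by blast
  qed (use m3CA tw CAB small addr S in auto)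
  have s1: "runs w (reduce_prog;; pivot_prog) r2 m2 (1 + 150 * (D + 1) * (t + 1) + 60 * (D + 1)) ?Q"
    if "same 26 r1 r2" for r2
    by (rule runs_Seq[OF red[OF that] _ order.refl]) (use pivot in blast)
  have s2: "runs w (monv_prog;; reduce_prog;; pivot_prog) r2 m1
      (1 + 100 * (L + 1) * (D + 1) + (1 + 150 * (D + 1) * (t + 1) + 60 * (D + 1))) ?Q"
    if "same 26 r1 r2" "r2 26 = h0" for r2
    by (rule runs_Seq[OF monv[OF that] _ order.refl]) (use s1 in blast)
  have s3: "runs w (eval_prog;; monv_prog;; reduce_prog;; pivot_prog) r2 m1
      (1 + 100 * (L + 2) * (l + 1) + (1 + 100 * (L + 1) * (D + 1) +
        (1 + 150 * (D + 1) * (t + 1) + 60 * (D + 1)))) ?Q"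
    if "same 26 r1 r2" for r2
    by (rule runs_Seq[OF eval[OF that] _ order.refl]) (use s2 in blast)
  show ?thesis
    unfolding insert_prog_def
  proof (rule runs_Seq_wpb)
    have "runs w (coef_prog;; eval_prog;; monv_prog;; reduce_prog;; pivot_prog) r1 m
      (1 + 40 * (L + 2) + (1 + 100 * (L + 2) * (l + 1) + (1 + 100 * (L + 1) * (D + 1) +
        (1 + 150 * (D + 1) * (t + 1) + 60 * (D + 1))))) ?Q"
      by (rule runs_Seq[OF coef _ order.refl]) (use s3 in blast)
    then show "wpb w (25 ::= R 19 .+ M (R 18) .* R 9)
      (\<lambda>r' m'. runs w (coef_prog;; eval_prog;; monv_prog;; reduce_prog;; pivot_prog) r' m'
      (1 + 40 * (L + 2) + (1 + 100 * (L + 2) * (l + 1) + (1 + 100 * (L + 1) * (D + 1) +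
        (1 + 150 * (D + 1) * (t + 1) + 60 * (D + 1))))) ?Q) r m"
      using r t tw addr S by (simp add: r1_def B_def)
    define X where "X = (L + 2) * (D + 1) * (D + 1)"
    have "(L + 2) * 1 * 1 \<le> X" "(L + 1) * (D + 1) * 1 \<le> X" "1 * (D + 1) * (t + 1) \<le> X"
      "1 * (D + 1) * 1 \<le> X" "1 * 1 * 1 \<le> X"
      unfolding X_def using tD by (intro mult_le_mono; simp)+
    moreover have "8 + (1 + 40 * a + (1 + 100 * y + (1 + 100 * b + (1 + 150 * e + 60 * g)))) \<le> 1000 * x + 100 * y"
      if "a * 1 * 1 \<le> x" "b * 1 \<le> x" "1 * e' * e'' \<le> x" "e = e' * e''" "1 * g * 1 \<le> x" "1 * 1 * 1 \<le> x"
      for a b e e' e'' g x y :: nat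
      using that by simp
    ultimately have "8 + (1 + 40 * (L + 2) + (1 + 100 * ((L + 2) * (l + 1)) + (1 + 100 * ((L + 1) * (D + 1)) +
        (1 + 150 * ((D + 1) * (t + 1)) + 60 * (D + 1))))) \<le> 1000 * X + 100 * ((L + 2) * (l + 1))"
      by blast
    then show "1 + cost_bound (25 ::= R 19 .+ M (R 18) .* R 9) +
      (1 + 40 * (L + 2) + (1 + 100 * (L + 2) * (l + 1) + (1 + 100 * (L + 1) * (D + 1) +
        (1 + 150 * (D + 1) * (t + 1) + 60 * (D + 1)))))
      \<le> 1000 * (L + 2) * (D + 1) * (D + 1) + 100 * (L + 2) * (l + 1)"
      by (simp add: X_def mult.assoc del: mult_Suc mult_Suc_right)
  qed
qed

section \<open>Processing a layer\<close>

definition entries_prog :: com where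
  "entries_prog =
     While (Less (R 24) (R 21)) (insert_prog;; (20 ::= R 20 .+ R 9;; 24 ::= R 24 .+ N 1))"

text \<open>The end points of edge \<open>e\<close> are stored at \<open>5 + 2 * e\<close> and \<open>6 + 2 * e\<close>; the loop index \<open>g\<close> is the
  position of the end point \<open>v\<close> that already carries entries, and \<open>u\<close> is the other end point.\<close>

definition edge_setup :: com where
  "edge_setup =
     24 ::= M (N 5 .+ R 16);;
     25 ::= M ((N 6 .+ N 4 .* (R 16 ./ N 2)) .- R 16);;
     17 ::= R 14 .- (R 16 ./ N 2) .% R 14;;
     23 ::= M (N 5 .+ N 2 .* R 2 .+ R 25);;
     22 ::= R 23 ./ (R 2 .+ N 1);;
     23 ::= R 23 .% (R 2 .+ N 1);;
     24 ::= R 15 .* R 1 .+ R 24;;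
     25 ::= (R 15 .+ N 1) .* R 1 .+ R 25;;
     21 ::= M (R 10 .+ R 24);;
     18 ::= R 10 .+ R 25;;
     20 ::= R 11 .+ R 24 .* (R 8 .+ N 1) .* R 9;;
     19 ::= R 11 .+ R 25 .* (R 8 .+ N 1) .* R 9;;
     24 ::= N 0"

definition edges_prog :: com where
  "edges_prog =
     While (Less (R 16) (N 2 .* R 2)) (edge_setup;; entries_prog;; 16 ::= R 16 .+ N 1)"

definition layers_prog :: com where
  "layers_prog = 15 ::= N 0;;
     While (Less (R 15) (R 3)) (
       (Cond (Equal (M (R 10 .+ (R 15 .* R 1 .+ R 4))) (N 0)) Skip (0 ::= N 1);; 16 ::= N 0);;
       edges_prog;;
       15 ::= R 15 .+ N 1)"

section \<open>Memory layout and invariants of the layered search\<close>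

locale machine = encoded_instance +
  fixes w L D S CNT SB src trg :: nat and off :: "nat \<Rightarrow> nat"
  assumes L_def: "L = 2 * \<mu> * k" and D_def: "D = 2 ^ L" and S_def: "S = L + 2 + D"
    and SB_def: "SB = CNT + (k + 1) * n"
    and top: "SB + (k + 1) * n * (D + 1) * S < 2 ^ w"
    and edges_fit: "4 * length es + 6 < 2 ^ w"
    and CNT: "5 + 2 * length es + n \<le> CNT"
    and off: "\<And>v. v < n \<Longrightarrow> off v + length (fs ! v) \<le> CNT"
    and src: "src < n" and trg: "trg < n"
begin

text \<open>A cell is a pair of a layer and a vertex. Expanding layer \<open>i\<close> writes layer
  \<open>i + 1\<close> for every \<open>i < k\<close>, hence the \<open>k + 1\<close> layers in the
  memory layout.\<close>

definition cell :: "nat \<Rightarrow> nat \<Rightarrow> nat" where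
  "cell r v = r * n + v"

definition cnt :: "(nat \<Rightarrow> nat) \<Rightarrow> nat \<Rightarrow> nat \<Rightarrow> nat" where
  "cnt m r v = m (CNT + cell r v)"

definition slots :: "nat \<Rightarrow> nat \<Rightarrow> nat" where
  "slots r v = SB + cell r v * (D + 1) * S"

definition entry :: "(nat \<Rightarrow> nat) \<Rightarrow> nat \<Rightarrow> nat \<Rightarrow> nat \<Rightarrow> nat \<Rightarrow> nat" where
  "entry m r v q = coefs L m (slots r v + q * S)"

text \<open>Start and length of a list share a word: the length is at most the number of edges, so
  quotient and remainder by \<open>length es + 1\<close> recover both.\<close>

definition input_ok :: "(nat \<Rightarrow> nat) \<Rightarrow> bool" where
  "input_ok m \<longleftrightarrow>
     (\<forall>e<length es. m (5 + 2 * e) = fst (es ! e) \<and> m (6 + 2 * e) = snd (es ! e)) \<and>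
     (\<forall>v<n. m (5 + 2 * length es + v) = off v * (length es + 1) + length (fs ! v) \<and>
       (\<forall>i<length (fs ! v). m (off v + i) = fs ! v ! i))"

text \<open>Elimination data are demanded from layer 1 on only: layer 0 is the trivial walk, written
  directly without a pivot or a row.\<close>

definition good :: "nat \<Rightarrow> (nat \<Rightarrow> nat) \<Rightarrow> bool" where
  "good P m \<longleftrightarrow> input_ok m \<and>
     (\<forall>r\<le>k. \<forall>v<n. cnt m r v \<le> D \<and>
       (\<forall>q<cnt m r v. sound_entry P L trg r v (entry m r v q) \<and> (\<forall>i. entry m r v q i < P))) \<and>
     (\<forall>r<k. \<forall>v<n. slots_ok P L S m (slots (Suc r) v) (cnt m (Suc r) v)) \<and>
     (\<forall>v<n. cnt m 0 v = (if v = trg then 1 else 0)) \<and> entry m 0 trg 0 = (\<lambda>i. if i = 0 then 1 else 0)"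

definition extends :: "nat \<Rightarrow> (nat \<Rightarrow> nat) \<Rightarrow> (nat \<Rightarrow> nat) \<Rightarrow> bool" where
  "extends i m m' \<longleftrightarrow> (\<forall>r\<le>k. \<forall>v<n. cnt m r v \<le> cnt m' r v \<and> (r \<noteq> i \<longrightarrow> cnt m' r v = cnt m r v) \<and>
     (\<forall>q<cnt m r v. entry m' r v q = entry m r v q))"

text \<open>The completeness half of the invariant, for one extension of one entry;
  \<open>good\<close> contains the soundness half.\<close>

definition processed :: "nat \<Rightarrow> (nat \<Rightarrow> nat) \<Rightarrow> nat \<Rightarrow> nat \<Rightarrow> nat \<Rightarrow> nat \<Rightarrow> nat \<Rightarrow> bool" where
  "processed P m r v q e u \<longleftrightarrow>
     (let c = shift_coef P L (P - e mod P) (entry m r v q) in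
       \<not> P dvd (\<Prod>x\<leftarrow>fs ! u. peval L c x) \<longrightarrow> represented P L (cnt m (Suc r) u) (entry m (Suc r) u) c)"

lemma extends_refl [simp]: "extends i m m"
  by (simp add: extends_def)

lemma extends_trans:
  assumes "extends i m m'" "extends i m' m''"
  shows "extends i m m''"
  unfolding extends_def
proof (intro allI impI conjI)
  fix r v assume rv: "r \<le> k" "v < n"
  have 1: "cnt m r v \<le> cnt m' r v" "r \<noteq> i \<Longrightarrow> cnt m' r v = cnt m r v"
    "\<And>q. q < cnt m r v \<Longrightarrow> entry m' r v q = entry m r v q"
    using assms(1) rv unfolding extends_def by blast+
  have 2: "cnt m' r v \<le> cnt m'' r v" "r \<noteq> i \<Longrightarrow> cnt m'' r v = cnt m' r v"
    "\<And>q. q < cnt m' r v \<Longrightarrow> entry m'' r v q = entry m' r v q"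
    using assms(2) rv unfolding extends_def by blast+
  show "cnt m r v \<le> cnt m'' r v" using 1 2 by simp
  show "cnt m'' r v = cnt m r v" if "r \<noteq> i" using 1 2 that by simp
  show "entry m'' r v q = entry m r v q" if "q < cnt m r v" for q using 1 2 that by simp
qed

text \<open>Growth of layer \<open>i + 1\<close> leaves the source entry alone because
  \<open>r \<le> i\<close>, and more entries in the target cell can only enlarge the span.\<close>

lemma processed_extends:
  assumes "processed P m r v q e u" "extends (Suc i) m m'" "r \<le> i" "i < k" "q < cnt m r v" "v < n" "u < n"
  shows "processed P m' r v q e u"
proof -
  have 1: "entry m' r v q = entry m r v q"
    using assms by (auto simp: extends_def)
  have 2: "cnt m (Suc r) u \<le> cnt m' (Suc r) u" "\<And>q. q < cnt m (Suc r) u \<Longrightarrow> entry m' (Suc r) u q = entry m (Suc r) u q"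
    using assms by (auto simp: extends_def)
  show ?thesis
    using assms(1) represented_mono[of P L "cnt m (Suc r) u" "entry m (Suc r) u" _ "cnt m' (Suc r) u", OF _ 2]
    unfolding processed_def Let_def 1 by blast
qed

lemma n_pos: "n > 0"
  using trg by simp

lemma cell_less: "r \<le> k \<Longrightarrow> v < n \<Longrightarrow> cell r v < (k + 1) * n"
  using mult_le_mono1[of r k n] unfolding cell_def add_mult_distrib mult_1 by linarith

lemma cell_eq_iff: "v < n \<Longrightarrow> v' < n \<Longrightarrow> cell r v = cell r' v' \<longleftrightarrow> r = r' \<and> v = v'"
proof -
  assume v: "v < n" "v' < n"
  then have "cell r v div n = r" "cell r v mod n = v" "cell r' v' div n = r'" "cell r' v' mod n = v'"
    by (simp_all add: cell_def)
  then show ?thesis by metis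
qed

lemma cell_Suc_le: "v < n \<Longrightarrow> cell r v < cell (Suc r) u"
  by (simp add: cell_def)

lemma slots_disjoint:
  assumes "cell r v < cell r' v'"
  shows "slots r v + (D + 1) * S \<le> slots r' v'"
proof -
  have "(cell r v + 1) * ((D + 1) * S) \<le> cell r' v' * ((D + 1) * S)"
    using assms by (intro mult_le_mono1) simp
  then show ?thesis by (simp add: slots_def algebra_simps)
qed

lemma slots_top: "r \<le> k \<Longrightarrow> v < n \<Longrightarrow> slots r v + (D + 1) * S < 2 ^ w"
proof -
  assume "r \<le> k" "v < n"
  then have "(cell r v + 1) * ((D + 1) * S) \<le> ((k + 1) * n) * ((D + 1) * S)"
    using cell_less[of r v] by (intro mult_le_mono1) simp
  moreover have "((k + 1) * n) * ((D + 1) * S) = (k + 1) * n * (D + 1) * S"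
    by (simp only: mult.assoc)
  ultimately show ?thesis using top unfolding slots_def by (simp add: algebra_simps)
qed

lemma slot_le: "q \<le> D \<Longrightarrow> q * S + S \<le> (D + 1) * S"
  using mult_le_mono1[of q D S] by simp

lemma cnt_addr: "r \<le> k \<Longrightarrow> v < n \<Longrightarrow> CNT + cell r v < SB"
  using cell_less by (simp add: SB_def)

lemma SB_le_slots: "SB \<le> slots r v"
  by (simp add: slots_def)

lemma L_ge: "\<mu> * k + k \<le> L" "k < L"
proof -
  have "k \<le> \<mu> * k" using \<mu> by simp
  then show "\<mu> * k + k \<le> L" "k < L" using k by (simp_all add: L_def)
qed

lemma runs_insert_entry:
  assumes P: "prime P" "2 * (P * P) < 2 ^ w" and good: "good P m"
    and i: "i < k" and uv: "u < n" "v < n" and q: "q < cnt m i v"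
    and e: "e < length es" "edge_of (es ! e) = {u, v}"
    and r: "r 7 = L" "r 8 = D" "r 9 = S" "r 14 = P" "r 17 = P - e mod P" "r 18 = CNT + cell (Suc i) u"
      "r 19 = slots (Suc i) u" "r 20 = slots i v + q * S" "r 22 = off u" "r 23 = length (fs ! u)"
  shows "runs w insert_prog r m (1000 * (L + 2) * (D + 1) * (D + 1) + 100 * (L + 2) * (\<mu> + 1))
    (\<lambda>r' m'. same 25 r r' \<and> good P m' \<and> extends (Suc i) m m' \<and> processed P m' i v q e u)"
proof -
  let ?TS = "slots (Suc i) u" and ?CA = "CNT + cell (Suc i) u" and ?t = "cnt m (Suc i) u"
  let ?B = "?TS + ?t * S" and ?C = "slots i v + q * S"
  define c' where "c' = shift_coef P L (P - e mod P) (coefs L m ?C)"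
  define h where "h = (\<Prod>j\<leftarrow>[0..<length (fs ! u)]. peval L c' (m (off u + j)))"
  have Suci: "Suc i \<le> k" using i by simp
  have ok: "slots_ok P L S m ?TS ?t" using good i uv by (simp add: good_def)
  have tD: "?t \<le> D" using good Suci uv unfolding good_def by blast
  have qD: "q \<le> D" using good i uv q unfolding good_def by (meson le_trans less_imp_le)
  have cell: "cell i v < cell (Suc i) u" using uv by (intro cell_Suc_le)
  note disj = slots_disjoint[OF cell]
  have h_eq: "h = (\<Prod>x\<leftarrow>fs ! u. peval L c' x)"
  proof -
    have "map (\<lambda>j. peval L c' (m (off u + j))) [0..<length (fs ! u)] = map (peval L c') (fs ! u)"
      using good uv by (intro nth_equalityI) (auto simp: good_def input_ok_def)
    then show ?thesis unfolding h_def by simp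
  qed
  have entq: "entry m i v q = coefs L m ?C" by (simp add: entry_def)
  have src_ok: "sound_entry P L trg i v (coefs L m ?C)" "\<And>j. coefs L m ?C j < P"
    using good i uv q unfolding good_def entry_def by (meson less_imp_le)+
  have P0: "P > 0" using P(1) by (rule prime_gt_0_nat)
  show ?thesis
  proof (rule runs_mono[OF runs_insert[OF r P _ D_def S_def _ ok src_ok(2) _ _ _ _ _ c'_def h_def]])
    show "P - e mod P \<le> P" by simp
    show "m ?CA = ?t" by (simp add: cnt_def)
    show "off u + length (fs ! u) \<le> ?CA" using off[OF uv(1)] by simp
    show "?CA < ?TS" using cnt_addr[OF Suci uv(1)] SB_le_slots by (rule less_le_trans)
    show "?C + S \<le> ?TS \<or> ?TS + ?t * S + S \<le> ?C" using disj slot_le[OF qD] by linarith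
    show "?TS + ?t * S + S < 2 ^ w" using slot_le[OF tD] slots_top[OF Suci uv(1)] by linarith
    show "?C + S < 2 ^ w" using slot_le[OF qD] slots_top[of i v] i uv by linarith
    show "1000 * (L + 2) * (D + 1) * (D + 1) + 100 * (L + 2) * (length (fs ! u) + 1) \<le>
      1000 * (L + 2) * (D + 1) * (D + 1) + 100 * (L + 2) * (\<mu> + 1)"
      using len_f[OF uv(1)] by (intro add_mono mult_le_mono order.refl)
    fix r' m' assume a: "same 25 r r' \<and> (\<forall>a. a \<noteq> ?CA \<and> (a < ?B \<or> ?B + S \<le> a) \<longrightarrow> m' a = m a) \<and>
      (m' ?CA = ?t \<and> (\<not> P dvd h \<longrightarrow> represented P L ?t (\<lambda>q. coefs L m (?TS + q * S)) c') \<or>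
       m' ?CA = Suc ?t \<and> \<not> P dvd h \<and> slots_ok P L S m' ?TS (Suc ?t) \<and> coefs L m' ?B = c')"
    then have m': "\<And>a. a \<noteq> ?CA \<Longrightarrow> a < ?B \<or> ?B + S \<le> a \<Longrightarrow> m' a = m a" by blast
    have CAS: "?CA < SB" using cnt_addr[OF Suci uv(1)] .
    have SBB: "SB \<le> ?B" using SB_le_slots[of "Suc i" u] by simp
    have inp: "m' a = m a" if "a < CNT" for a
      using that CAS SBB SB_def by (intro m') auto
    have cnt': "cnt m' r v = cnt m r v" if "r \<le> k" "v < n" "(r, v) \<noteq> (Suc i, u)" for r v
    proof -
      have "cell r v \<noteq> cell (Suc i) u" using that uv cell_eq_iff by blast
      then show ?thesis unfolding cnt_def using cnt_addr[OF that(1,2)] SBB by (intro m') auto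
    qed
    have cntT: "cnt m' (Suc i) u = ?t \<or> cnt m' (Suc i) u = Suc ?t"
      using a by (auto simp: cnt_def)
    \<comment> \<open>The count lies below all slots, the other writes stay inside the
      \<open>D + 1\<close> slots of the target cell, and the slot ranges of distinct cells are
      disjoint.\<close>
    have region: "m' b = m b"
      if "r \<le> k" "v < n" "(r, v) \<noteq> (Suc i, u)" "slots r v \<le> b" "b < slots r v + (D + 1) * S" for r v b
    proof -
      have "cell r v < cell (Suc i) u \<or> cell (Suc i) u < cell r v"
        using that uv cell_eq_iff by (metis nat_neq_iff)
      then have "slots r v + (D + 1) * S \<le> ?TS \<or> ?TS + (D + 1) * S \<le> slots r v"
        using slots_disjoint by blast
      then show ?thesis
        using that CAS SB_le_slots[of r v] slot_le[OF tD] by (intro m') linarith+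
    qed
    have ent': "entry m' r v q = entry m r v q" if "r \<le> k" "v < n" "q < cnt m r v" for r v q
    proof (cases "(r, v) = (Suc i, u)")
      case True
      then have "q * S + S \<le> ?t * S" using that mult_le_mono1[of "Suc q" ?t S] by simp
      then show ?thesis using True CAS SB_le_slots[of r v] S_def
        unfolding entry_def coefs_def by (intro ext if_cong refl m') auto
    next
      case False
      have "q \<le> D" using that good unfolding good_def by (meson le_trans less_imp_le)
      then have "q * S + S \<le> (D + 1) * S" by (rule slot_le)
      then show ?thesis using that False S_def
        unfolding entry_def coefs_def by (intro ext if_cong refl region[of r v]) auto
    qed
    have ext: "extends (Suc i) m m'"
      unfolding extends_def
    proof (intro allI impI conjI)
      fix r v assume rv: "r \<le> k" "v < n"
      show "cnt m r v \<le> cnt m' r v"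
        using cnt'[OF rv] cntT by (cases "(r, v) = (Suc i, u)") auto
      show "cnt m' r v = cnt m r v" if "r \<noteq> Suc i" using cnt'[OF rv] that by simp
      show "entry m' r v q = entry m r v q" if "q < cnt m r v" for q using ent'[OF rv that] .
    qed
    have input: "input_ok m'"
    proof -
      have "m' (5 + 2 * e) = m (5 + 2 * e)" "m' (6 + 2 * e) = m (6 + 2 * e)" if "e < length es" for e
        using that CNT by (auto intro: inp)
      moreover have "m' (5 + 2 * length es + v) = m (5 + 2 * length es + v)" if "v < n" for v
        using that CNT by (auto intro: inp)
      moreover have "m' (off v + j) = m (off v + j)" if "v < n" "j < length (fs ! v)" for v j
        using that off[OF that(1)] by (auto intro: inp)
      ultimately show ?thesis using good unfolding good_def input_ok_def by simp
    qed
    have new: "\<not> P dvd h" "slots_ok P L S m' ?TS (Suc ?t)" "entry m' (Suc i) u ?t = c'"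
      if "cnt m' (Suc i) u = Suc ?t"
      using a that by (auto simp: cnt_def entry_def)
    have old: "\<not> P dvd h \<longrightarrow> represented P L ?t (entry m (Suc i) u) c'" if "cnt m' (Suc i) u = ?t"
    proof -
      have "entry m (Suc i) u = (\<lambda>q. coefs L m (?TS + q * S))" by (simp add: fun_eq_iff entry_def)
      then show ?thesis using a that by (auto simp: cnt_def)
    qed
    have sound: "sound_entry P L trg (Suc i) u c'" if "\<not> P dvd h"
    proof (rule sound_entry_Suc[OF src_ok(1) P0 _ e c'_def])
      show "i < L" using i L_ge by simp
      have "int h = (\<Prod>x\<leftarrow>fs ! u. peval L (\<lambda>i. int (c' i)) (int x))"
      proof -
        have "int (prod_list xs) = prod_list (map int xs)" for xs by (induction xs) auto
        then show ?thesis unfolding h_eq by (simp add: o_def of_nat_peval)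
      qed
      then show "\<not> int P dvd (\<Prod>x\<leftarrow>fs ! u. peval L (\<lambda>i. int (c' i)) (int x))"
        using that by (metis int_dvd_int_iff)
    qed
    have c'P: "c' j < P" for j using P0 by (simp add: c'_def shift_coef_def)
    have "good P m'"
      unfolding good_def
    proof (intro conjI allI impI)
      fix r v assume rv: "r \<le> k" "v < n"
      have old_cnt: "cnt m r v \<le> D" using good rv unfolding good_def by blast
      show "cnt m' r v \<le> D"
      proof (cases "(r, v) = (Suc i, u) \<and> cnt m' (Suc i) u = Suc ?t")
        case True
        then show ?thesis using echelon_le new(2) unfolding slots_ok_def D_def by auto
      next
        case False
        then show ?thesis using cnt'[OF rv] cntT old_cnt by (cases "(r, v) = (Suc i, u)") auto
      qed
      fix q assume q: "q < cnt m' r v"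
      have "sound_entry P L trg r v (entry m' r v q) \<and> (\<forall>i. entry m' r v q i < P)"
      proof (cases "q < cnt m r v")
        case True
        then show ?thesis using good rv ent'[OF rv True] unfolding good_def by simp
      next
        case False
        then have rv': "r = Suc i" "v = u" using q cnt'[OF rv] by fastforce+
        then have "cnt m' (Suc i) u = Suc ?t" "q = ?t" using q False cntT by auto
        then show ?thesis using new sound c'P rv' by simp
      qed
      then show "sound_entry P L trg r v (entry m' r v q)" "\<And>i. entry m' r v q i < P" by auto
    next
      fix r v assume rv: "r < k" "v < n"
      show "slots_ok P L S m' (slots (Suc r) v) (cnt m' (Suc r) v)"
      proof (cases "(r, v) = (i, u) \<and> cnt m' (Suc i) u = Suc ?t")
        case True
        then show ?thesis using new(2) by auto
      next
        case False
        then have c: "cnt m' (Suc r) v = cnt m (Suc r) v"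
          using cnt'[of "Suc r" v] rv cntT by (cases "(r, v) = (i, u)") auto
        have ok: "slots_ok P L S m (slots (Suc r) v) (cnt m (Suc r) v)"
          using good rv by (simp add: good_def)
        have cD: "cnt m (Suc r) v \<le> D" using good rv unfolding good_def by (meson Suc_leI)
        show ?thesis
          unfolding c
        proof (rule slots_ok_cong[OF ok S_def[unfolded D_def]])
          fix b assume b: "slots (Suc r) v \<le> b" "b < slots (Suc r) v + cnt m (Suc r) v * S"
          show "m' b = m b"
          proof (cases "(r, v) = (i, u)")
            case True
            then show ?thesis using b CAS SB_le_slots[of "Suc r" v] by (intro m') auto
          next
            case False
            moreover have "b < slots (Suc r) v + (D + 1) * S"
              using b(2) mult_le_mono1[OF cD, of S] unfolding add_mult_distrib mult_1 by linarith
            ultimately show ?thesis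
              using b rv by (intro region[of "Suc r" v]) auto
          qed
        qed
      qed
    next
      show "input_ok m'" by (rule input)
      have g0: "\<And>v. v < n \<Longrightarrow> cnt m 0 v = (if v = trg then 1 else 0)"
        "entry m 0 trg 0 = (\<lambda>i. if i = 0 then 1 else 0)"
        using good by (auto simp: good_def)
      show "cnt m' 0 v = (if v = trg then 1 else 0)" if "v < n" for v
        using cnt'[of 0 v] that g0(1) by simp
      show "entry m' 0 trg 0 = (\<lambda>i. if i = 0 then 1 else 0)" using ent'[of 0 trg 0] trg g0 by simp
    qed
    moreover have "processed P m' i v q e u"
    proof -
      have "entry m' i v q = entry m i v q" using ent' i uv q by simp
      then have c: "shift_coef P L (P - e mod P) (entry m' i v q) = c'" by (simp add: c'_def entq)
      \<comment> \<open>If the count did not grow, the candidate was in the span already; if it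
        grew, the candidate is itself the last entry.\<close>
      have "represented P L (cnt m' (Suc i) u) (entry m' (Suc i) u) c'" if "\<not> P dvd h"
      proof (cases "cnt m' (Suc i) u = ?t")
        case True
        then show ?thesis
          using represented_mono[OF old[OF True, rule_format, OF that], of ?t "entry m' (Suc i) u"]
            ent'[OF Suci uv(1)] by simp
      next
        case False
        then have "cnt m' (Suc i) u = Suc ?t" using cntT by blast
        then show ?thesis
          using represented_refl[of ?t "Suc ?t" "entry m' (Suc i) u" c' P L] new(3) by simp
      qed
      then show ?thesis unfolding processed_def Let_def c h_eq[symmetric] by (rule impI)
    qed
    ultimately show "same 25 r r' \<and> good P m' \<and> extends (Suc i) m m' \<and> processed P m' i v q e u"
      using conjunct1[OF a] ext by (intro conjI)
  qed
qed

end

text \<open>Names the assigned value right away; in a long straight-line program the substituted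
  expressions would otherwise nest.\<close>

lemma wpb_assign:
  "safe w a r m \<Longrightarrow> av a r m = x \<Longrightarrow> wpb w P Q (r(y := x)) m \<Longrightarrow> wpb w (y ::= a;; P) Q r m"
  by simp

context machine
begin

definition insert_cost :: nat where
  "insert_cost = 1000 * (L + 2) * (D + 1) * (D + 1) + 100 * (L + 2) * (\<mu> + 1)"

definition regs :: "nat \<Rightarrow> (reg \<Rightarrow> nat) \<Rightarrow> bool" where
  "regs P r \<longleftrightarrow> r 1 = n \<and> r 2 = length es \<and> r 3 = k \<and> r 4 = src \<and> r 7 = L \<and> r 8 = D \<and> r 9 = S \<and>
     r 10 = CNT \<and> r 11 = SB \<and> r 14 = P"

lemma extends_cnt: "extends (Suc i) m m' \<Longrightarrow> r \<le> i \<Longrightarrow> i < k \<Longrightarrow> v < n \<Longrightarrow> cnt m' r v = cnt m r v"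
  by (auto simp: extends_def)

lemma runs_entries:
  assumes P: "prime P" "2 * (P * P) < 2 ^ w" and good: "good P m"
    and i: "i < k" and uv: "u < n" "v < n"
    and e: "e < length es" "edge_of (es ! e) = {u, v}"
    and r: "r 7 = L" "r 8 = D" "r 9 = S" "r 14 = P" "r 17 = P - e mod P" "r 18 = CNT + cell (Suc i) u"
      "r 19 = slots (Suc i) u" "r 20 = slots i v" "r 21 = cnt m i v" "r 22 = off u"
      "r 23 = length (fs ! u)" "r 24 = 0"
  shows "runs w entries_prog r m ((D + 1) * (insert_cost + 20))
    (\<lambda>r' m'. same 17 r r' \<and> good P m' \<and> extends (Suc i) m m' \<and>
      (\<forall>q<cnt m' i v. processed P m' i v q e u))"
proof -
  define I where "I = (\<lambda>q r' m'. (\<forall>x<25. x \<noteq> 20 \<and> x \<noteq> 24 \<longrightarrow> r' x = r x) \<and> r' 24 = q \<and>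
    r' 20 = slots i v + q * S \<and> good P m' \<and> extends (Suc i) m m' \<and> (\<forall>q'<q. processed P m' i v q' e u))"
  have cD: "cnt m i v \<le> D" using good i uv unfolding good_def by (meson less_imp_le)
  have small: "2 < (2::nat) ^ w" using prime_ge_2_nat[OF P(1)] P(2) by (rule two_less_word)
  show ?thesis
    unfolding entries_prog_def
  proof (rule runs_mono[OF runs_While_body[where I = I and l = "cnt m i v" and A = "insert_cost + 20",
        OF _ _ _ _ order.refl]])
    show "I 0 r m" using r good by (simp add: I_def)
    fix q r' m' assume q: "q < cnt m i v" and I: "I q r' m'"
    have q': "q < cnt m' i v" using I extends_cnt[of i m m' i v] i uv q by (simp add: I_def)
    have "runs w insert_prog r' m' insert_cost
      (\<lambda>r2 m2. same 25 r' r2 \<and> good P m2 \<and> extends (Suc i) m' m2 \<and> processed P m2 i v q e u)"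
      unfolding insert_cost_def
      by (rule runs_insert_entry[OF P _ i uv q' e]) (use I r in \<open>auto simp: I_def\<close>)
    moreover have "runs w (20 ::= R 20 .+ R 9;; 24 ::= R 24 .+ N 1) r2 m2 10 (I (Suc q))"
      if a: "same 25 r' r2 \<and> good P m2 \<and> extends (Suc i) m' m2 \<and> processed P m2 i v q e u" for r2 m2
    proof -
      have *: "r2 x = r' x" if "x < 25" for x using a sameD that by blast
      have "processed P m2 i v q' e u" if "q' < q" for q'
        using I a that q' i uv by (intro processed_extends[of P m' i v q' e u i m2]) (auto simp: I_def)
      then have pr: "processed P m2 i v q' e u" if "q' < Suc q" for q'
        using a that by (cases "q' = q") auto
      have b: "slots i v + q * S + S < 2 ^ w" "q + 1 < 2 ^ w"
      proof -
        have "q \<le> D" "q \<le> q * S" using q cD S_def by auto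
        then show "slots i v + q * S + S < 2 ^ w" "q + 1 < 2 ^ w"
          using slots_top[of i v] i uv slot_le[of q] S_def by linarith+
      qed
      show ?thesis
        using * b small I a pr extends_trans[of "Suc i" m m' m2] r
        by (intro runs_wpb) (auto simp: I_def)
    qed
    ultimately have "runs w (insert_prog;; (20 ::= R 20 .+ R 9;; 24 ::= R 24 .+ N 1)) r' m'
        (1 + insert_cost + 10) (I (Suc q))"
      by (rule runs_Seq[OF _ _ order.refl])
    then show "bsafe w (Less (R 24) (R 21)) r' m' \<and> bv (Less (R 24) (R 21)) r' m' \<and>
      runs w (insert_prog;; (20 ::= R 20 .+ R 9;; 24 ::= R 24 .+ N 1)) r' m' (1 + insert_cost + 10) (I (Suc q))"
      using I q r by (auto simp: I_def)
  next
    fix r' m' assume "I (cnt m i v) r' m'"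
    then show "bsafe w (Less (R 24) (R 21)) r' m' \<and> \<not> bv (Less (R 24) (R 21)) r' m'"
      using r by (auto simp: I_def)
  next
    have "(cnt m i v + 1) * (insert_cost + 20) \<le> (D + 1) * (insert_cost + 20)"
      using cD by (intro mult_le_mono1) simp
    then show "cnt m i v * (insert_cost + 20) + (insert_cost + 20) \<le> (D + 1) * (insert_cost + 20)"
      by (simp add: algebra_simps)
  next
    fix r' m' assume "I (cnt m i v) r' m'"
    then show "same 17 r r' \<and> good P m' \<and> extends (Suc i) m m' \<and>
      (\<forall>q<cnt m' i v. processed P m' i v q e u)"
      using extends_cnt[of i m m' i v] i uv by (auto simp: I_def same_def)
  qed simp
qed

definition endpoint :: "nat \<Rightarrow> nat" where
  "endpoint g = (if even g then fst (es ! (g div 2)) else snd (es ! (g div 2)))"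

definition other_endpoint :: "nat \<Rightarrow> nat" where
  "other_endpoint g = (if even g then snd (es ! (g div 2)) else fst (es ! (g div 2)))"

lemma endpoint_less:
  assumes "g < 2 * length es"
  shows "endpoint g < n" "other_endpoint g < n"
    "edge_of (es ! (g div 2)) = {other_endpoint g, endpoint g}"
  using assms edges[of "g div 2"] by (auto simp: endpoint_def other_endpoint_def edge_of_def)

text \<open>The ends of edge \<open>e\<close> are stored at \<open>5 + 2 * e\<close> and
  \<open>6 + 2 * e\<close>, whose sum is \<open>11 + 4 * e\<close>. Subtracting \<open>5 + g\<close>
  from this sum gives the address of the other end without a case distinction.\<close>

lemma input_endpoint:
  assumes "input_ok m" "g < 2 * length es"
  shows "m (5 + g) = endpoint g" "m (6 + 4 * (g div 2) - g) = other_endpoint g"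
proof -
  have e: "g div 2 < length es" using assms(2) by auto
  have m: "m (5 + 2 * (g div 2)) = fst (es ! (g div 2))" "m (6 + 2 * (g div 2)) = snd (es ! (g div 2))"
    using assms(1) e by (auto simp: input_ok_def)
  show "m (5 + g) = endpoint g"
  proof (cases "even g")
    case True
    then show ?thesis using m(1) by (simp add: endpoint_def)
  next
    case False
    then have eq: "5 + g = 6 + 2 * (g div 2)" by presburger
    show ?thesis using m(2)[folded eq] False by (simp add: endpoint_def)
  qed
  show "m (6 + 4 * (g div 2) - g) = other_endpoint g"
  proof (cases "even g")
    case True
    then have eq: "6 + 4 * (g div 2) - g = 6 + 2 * (g div 2)" by presburger
    show ?thesis using m(2)[folded eq] True by (simp add: other_endpoint_def)
  next
    case False
    then have eq: "6 + 4 * (g div 2) - g = 5 + 2 * (g div 2)" by presburger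
    show ?thesis using m(1)[folded eq] False by (simp add: other_endpoint_def)
  qed
qed

lemma wpb_edge_setup:
  assumes P: "prime P" "2 * (P * P) < 2 ^ w" and inp: "input_ok m" and i: "i < k"
    and g: "g < 2 * length es" and r: "regs P r" "r 15 = i" "r 16 = g"
  shows "wpb w edge_setup (\<lambda>r' m'. m' = m \<and> same 17 r r' \<and> r' 17 = P - g div 2 mod P \<and>
    r' 18 = CNT + cell (Suc i) (other_endpoint g) \<and> r' 19 = slots (Suc i) (other_endpoint g) \<and>
    r' 20 = slots i (endpoint g) \<and> r' 21 = cnt m i (endpoint g) \<and> r' 22 = off (other_endpoint g) \<and>
    r' 23 = length (fs ! other_endpoint g) \<and> r' 24 = 0) r m"
proof -
  define v where "v = endpoint g"
  define u where "u = other_endpoint g"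
  have uv: "u < n" "v < n" using endpoint_less[OF g] by (auto simp: u_def v_def)
  have P2: "P \<ge> 2" using P(1) by (rule prime_ge_2_nat)
  have small: "2 < (2::nat) ^ w" using P2 P(2) by (rule two_less_word)
  have Pw: "P < 2 ^ w" using P2 P(2) mult_le_mono[of 1 P P P] by linarith
  have m1: "m (5 + g) = v" "m (6 + 4 * (g div 2) - g) = u"
    using input_endpoint[OF inp g] by (auto simp: u_def v_def)
  have len: "length (fs ! u) \<le> length es"
  proof -
    have "card (set (fs ! u)) \<le> card {..<length es}" using fs[OF uv(1)] by (intro card_mono) auto
    then show ?thesis using fs[OF uv(1)] by (simp add: distinct_card)
  qed
  have m2: "m (5 + 2 * length es + u) = off u * (length es + 1) + length (fs ! u)"
    using inp uv by (simp add: input_ok_def)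
  have dm: "(off u * (length es + 1) + length (fs ! u)) div (length es + 1) = off u"
    "(off u * (length es + 1) + length (fs ! u)) mod (length es + 1) = length (fs ! u)"
  proof -
    have "(off u * (length es + 1) + length (fs ! u)) div (length es + 1) =
      off u + length (fs ! u) div (length es + 1)" by (subst div_mult_self3) auto
    then show "(off u * (length es + 1) + length (fs ! u)) div (length es + 1) = off u"
      using len by simp
    have "(off u * (length es + 1) + length (fs ! u)) mod (length es + 1) =
      length (fs ! u) mod (length es + 1)" by (rule mod_mult_self3)
    then show "(off u * (length es + 1) + length (fs ! u)) mod (length es + 1) = length (fs ! u)"
      using len by simp
  qed
  have CS: "CNT \<le> SB" by (simp add: SB_def)
  have top': "SB < 2 ^ w" using top by linarith
  have Suci: "Suc i \<le> k" using i by simp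
  have b1: "5 + g < 2 ^ w" "4 * (g div 2) < 2 ^ w" "6 + 4 * (g div 2) < 2 ^ w"
    "6 + 4 * (g div 2) - g < 2 ^ w" "g div 2 < 2 ^ w"
    using edges_fit g by auto
  have b2: "2 * length es < 2 ^ w" "5 + 2 * length es < 2 ^ w" "5 + 2 * length es + u < 2 ^ w"
    "length es + 1 < 2 ^ w" "off u < 2 ^ w" "length (fs ! u) < 2 ^ w"
    using CNT CS top' uv off[OF uv(1)] by linarith+
  have SD: "S \<ge> 1" "D \<ge> 1" by (auto simp: S_def D_def)
  \<comment> \<open>Addresses are computed factor by factor; each partial product is bounded by the
    final address because the remaining factors are at least 1.\<close>
  have cb: "cell r' v' < 2 ^ w" "CNT + cell r' v' < 2 ^ w" "cell r' v' * (D + 1) < 2 ^ w"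
    "cell r' v' * (D + 1) * S < 2 ^ w" "SB + cell r' v' * (D + 1) * S < 2 ^ w"
    if "r' \<le> k" "v' < n" for r' v'
  proof -
    show 1: "SB + cell r' v' * (D + 1) * S < 2 ^ w" using slots_top[OF that] by (simp add: slots_def)
    then show 2: "cell r' v' * (D + 1) * S < 2 ^ w" by linarith
    have "cell r' v' * (D + 1) * 1 \<le> cell r' v' * (D + 1) * S" using SD by (intro mult_le_mono) auto
    with 2 show 3: "cell r' v' * (D + 1) < 2 ^ w" by linarith
    have "cell r' v' * 1 \<le> cell r' v' * (D + 1)" by (intro mult_le_mono) auto
    with 3 show "cell r' v' < 2 ^ w" by linarith
    show "CNT + cell r' v' < 2 ^ w" using cnt_addr[OF that] top' by linarith
  qed
  have b3: "i * n < 2 ^ w" "i * n + v < 2 ^ w" "i + 1 < 2 ^ w" "(i + 1) * n < 2 ^ w" "(i + 1) * n + u < 2 ^ w"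
  proof -
    show "i * n + v < 2 ^ w" using cb(1)[of i v] i uv by (simp add: cell_def)
    then show "i * n < 2 ^ w" by simp
    show 4: "(i + 1) * n + u < 2 ^ w" using cb(1)[OF Suci uv(1)] by (simp add: cell_def)
    then show 5: "(i + 1) * n < 2 ^ w" by simp
    have "(i + 1) * 1 \<le> (i + 1) * n" using n_pos by (intro mult_le_mono) auto
    then show "i + 1 < 2 ^ w" unfolding mult_1_right using 5 by (rule le_less_trans)
  qed
  have D1: "D + 1 < 2 ^ w"
  proof -
    have "S \<le> (k + 1) * n * (D + 1) * S" using n_pos by simp
    then have "D + 1 \<le> SB + (k + 1) * n * (D + 1) * S" using S_def by linarith
    then show ?thesis using top by linarith
  qed
  note R = r(1)[unfolded regs_def] r(2,3)
  have cu: "(i + 1) * n + u = cell (Suc i) u" "i * n + v = cell i v" by (simp_all add: cell_def)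
  note ci = cb[of i v, OF less_imp_le[OF i] uv(2)] and cs = cb[OF Suci uv(1)]
  show ?thesis
    unfolding edge_setup_def u_def[symmetric] v_def[symmetric]
    apply (rule wpb_assign[where x = "v"])
      apply (use R small b1 in simp)
     apply (use R m1 in simp)
    apply (rule wpb_assign[where x = "u"])
      apply (use R small b1 in simp)
     apply (use R m1 in simp)
    apply (rule wpb_assign[where x = "P - g div 2 mod P"])
      apply (use R small b1 Pw mod_less_word[OF P2 P(2)] in simp)
     apply (use R in simp)
    apply (rule wpb_assign[where x = "off u * (length es + 1) + length (fs ! u)"])
      apply (use R small b1 b2 in simp)
     apply (use R m2 in simp)
    apply (rule wpb_assign[where x = "off u"])
      apply (use R small b2 dm in simp)
     apply (use R dm in simp)
    apply (rule wpb_assign[where x = "length (fs ! u)"])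
      apply (use R small b2 dm in simp)
     apply (use R dm in simp)
    apply (rule wpb_assign[where x = "cell i v"])
      apply (use R b3 in simp)
     apply (use R cu in simp)
    apply (rule wpb_assign[where x = "cell (Suc i) u"])
      apply (use R small b3 in simp)
     apply (use R cu in simp)
    apply (rule wpb_assign[where x = "cnt m i v"])
      apply (use R ci in simp)
     apply (use R in \<open>simp add: cnt_def\<close>)
    apply (rule wpb_assign[where x = "CNT + cell (Suc i) u"])
      apply (use R cs in simp)
     apply (use R in simp)
    apply (rule wpb_assign[where x = "slots i v"])
      apply (use R ci small D1 in simp)
     apply (use R in \<open>simp add: slots_def\<close>)
    apply (rule wpb_assign[where x = "slots (Suc i) u"])
      apply (use R cs small D1 in simp)
     apply (use R in \<open>simp add: slots_def\<close>)
    apply (use R small in simp)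
    done
qed

end

text \<open>Starting at \<open>n\<close> spares the counts of layer 0, so the trivial walk is
  written once for all primes. Stale slot contents may stay: a count of 0 makes them
  invisible.\<close>

definition reset_prog :: com where
  "reset_prog = 15 ::= R 1;;
     While (Less (R 15) ((R 3 .+ N 1) .* R 1)) (Store (R 10 .+ R 15) (N 0);; 15 ::= R 15 .+ N 1)"

definition run_prog :: com where
  "run_prog = reset_prog;; layers_prog"

context machine
begin

definition edges_cost :: nat where
  "edges_cost = (2 * length es + 1) * ((D + 1) * (insert_cost + 20) + 150)"

definition layer_processed :: "nat \<Rightarrow> (nat \<Rightarrow> nat) \<Rightarrow> nat \<Rightarrow> bool" where
  "layer_processed P m i \<longleftrightarrow> (\<forall>u<n. \<forall>v<n. \<forall>e<length es. edge_of (es ! e) = {u, v} \<longrightarrow>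
     (\<forall>q<cnt m i v. processed P m i v q e u))"

lemma layer_processed_extends:
  "layer_processed P m r \<Longrightarrow> extends (Suc i) m m' \<Longrightarrow> r \<le> i \<Longrightarrow> i < k \<Longrightarrow> layer_processed P m' r"
  unfolding layer_processed_def using extends_cnt processed_extends by metis

lemma runs_edges:
  assumes P: "prime P" "2 * (P * P) < 2 ^ w" and good: "good P m" and i: "i < k"
    and r: "regs P r" "r 15 = i" "r 16 = 0"
  shows "runs w edges_prog r m edges_cost
    (\<lambda>r' m'. same 16 r r' \<and> good P m' \<and> extends (Suc i) m m' \<and> layer_processed P m' i)"
proof -
  define I where "I = (\<lambda>g r' m'. same 16 r r' \<and> r' 16 = g \<and> good P m' \<and> extends (Suc i) m m' \<and>
    (\<forall>g'<g. \<forall>q<cnt m' i (endpoint g'). processed P m' i (endpoint g') q (g' div 2) (other_endpoint g')))"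
  have small: "2 < (2::nat) ^ w" using prime_ge_2_nat[OF P(1)] P(2) by (rule two_less_word)
  let ?body = "edge_setup;; entries_prog;; 16 ::= R 16 .+ N 1"
  let ?cost = "1 + 120 + (1 + (D + 1) * (insert_cost + 20) + 4)"
  have es2: "2 * length es + 1 < 2 ^ w" using edges_fit by linarith
  have cost: "cost_bound edge_setup \<le> 120" by (simp add: edge_setup_def)
  have body: "runs w ?body r' m' ?cost (I (Suc g))"
    if g: "g < 2 * length es" and I: "I g r' m'" for g r' m'
  proof -
    have s: "same 16 r r'" "r' 16 = g" "good P m'" "extends (Suc i) m m'"
      and pr: "\<And>g' q. g' < g \<Longrightarrow> q < cnt m' i (endpoint g') \<Longrightarrow>
        processed P m' i (endpoint g') q (g' div 2) (other_endpoint g')"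
      using I by (auto simp: I_def)
    have regs: "regs P r'" "r' 15 = i" using r sameD[OF s(1)] by (simp_all add: regs_def)
    have inp: "input_ok m'" using s(3) by (simp add: good_def)
    note ep = endpoint_less[OF g]
    have ge: "g div 2 < length es" using g by auto
    show ?thesis
    proof (rule runs_Seq[OF runs_wpb[OF wpb_edge_setup[OF P inp i g regs s(2)] cost] _ order.refl])
      fix r1 m1 assume a: "m1 = m' \<and> same 17 r' r1 \<and> r1 17 = P - g div 2 mod P \<and>
        r1 18 = CNT + cell (Suc i) (other_endpoint g) \<and> r1 19 = slots (Suc i) (other_endpoint g) \<and>
        r1 20 = slots i (endpoint g) \<and> r1 21 = cnt m' i (endpoint g) \<and> r1 22 = off (other_endpoint g) \<and>
        r1 23 = length (fs ! other_endpoint g) \<and> r1 24 = 0"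
      then have m1: "m1 = m'" and s1: "same 17 r' r1" by auto
      have q: "r1 7 = L" "r1 8 = D" "r1 9 = S" "r1 14 = P"
        using regs sameD[OF s1] by (simp_all add: regs_def)
      show "runs w (entries_prog;; 16 ::= R 16 .+ N 1) r1 m1 (1 + (D + 1) * (insert_cost + 20) + 4) (I (Suc g))"
        unfolding m1
      proof (rule runs_Seq[OF runs_entries[OF P s(3) i ep(2,1) ge ep(3) q] _ order.refl])
        fix r2 m2 assume b: "same 17 r1 r2 \<and> good P m2 \<and> extends (Suc i) m' m2 \<and>
          (\<forall>q<cnt m2 i (endpoint g). processed P m2 i (endpoint g) q (g div 2) (other_endpoint g))"
        then have b1: "same 17 r1 r2" and b2: "good P m2" "extends (Suc i) m' m2" by auto
        have "processed P m2 i (endpoint g') q (g' div 2) (other_endpoint g')"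
          if "g' < Suc g" "q < cnt m2 i (endpoint g')" for g' q
        proof (cases "g' = g")
          case True
          then show ?thesis using b that by blast
        next
          case False
          then have g': "g' < g" "g' < 2 * length es" using that g by auto
          have q: "q < cnt m' i (endpoint g')"
            using that extends_cnt[OF b2(2) order.refl i endpoint_less(1)[OF g'(2)]] by simp
          show ?thesis
            using pr[OF g'(1) q] b2(2) order.refl i q endpoint_less(1,2)[OF g'(2)]
            by (rule processed_extends)
        qed
        moreover have "extends (Suc i) m m2" using s(4) b2(2) by (rule extends_trans)
        moreover have "r2 16 = g" using sameD[OF b1, of 16] sameD[OF s1, of 16] s(2) by simp
        moreover have "same 16 r r2" using s(1) s1 b1 by (auto simp: same_def)
        ultimately show "runs w (16 ::= R 16 .+ N 1) r2 m2 4 (I (Suc g))"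
          using b2 es2 g small by (intro runs_wpb) (auto simp: I_def)
      qed (use a in auto)
    qed
  qed
  show ?thesis
    unfolding edges_prog_def
  proof (rule runs_mono[OF runs_While_body[where I = I and l = "2 * length es"
        and A = "(D + 1) * (insert_cost + 20) + 150" and B = ?cost, OF _ _ _ _ order.refl]])
    show "I 0 r m" using good r by (simp add: I_def)
    fix g r' m' assume g: "g < 2 * length es" and I: "I g r' m'"
    then have "r' 2 = length es" "r' 16 = g" using r sameD[of 16 r r' 2] by (auto simp: I_def regs_def)
    then show "bsafe w (Less (R 16) (N 2 .* R 2)) r' m' \<and> bv (Less (R 16) (N 2 .* R 2)) r' m' \<and>
      runs w ?body r' m' ?cost (I (Suc g))"
      using body[OF g I] g es2 small by simp
  next
    fix r' m' assume I: "I (2 * length es) r' m'"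
    then have "r' 2 = length es" "r' 16 = 2 * length es"
      using r sameD[of 16 r r' 2] by (auto simp: I_def regs_def)
    then show "bsafe w (Less (R 16) (N 2 .* R 2)) r' m' \<and> \<not> bv (Less (R 16) (N 2 .* R 2)) r' m'"
      using es2 small by simp
  next
    fix r' m' assume I: "I (2 * length es) r' m'"
    have "layer_processed P m' i"
      unfolding layer_processed_def
    proof (intro allI impI)
      fix u v e q
      assume uv: "u < n" "v < n" and e: "e < length es" "edge_of (es ! e) = {u, v}" and q: "q < cnt m' i v"
      have "(fst (es ! e) = v \<and> snd (es ! e) = u) \<or> (fst (es ! e) = u \<and> snd (es ! e) = v)"
        using e(2) by (auto simp: edge_of_def doubleton_eq_iff)
      \<comment> \<open>Each edge is visited in both orientations, as \<open>g = 2 * e\<close> and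
        \<open>g = 2 * e + 1\<close>.\<close>
      then obtain g where g: "g < 2 * length es" "g div 2 = e" "endpoint g = v" "other_endpoint g = u"
      proof
        assume a: "fst (es ! e) = v \<and> snd (es ! e) = u"
        show thesis
          by (rule that[of "2 * e"]) (use a e in \<open>auto simp: endpoint_def other_endpoint_def\<close>)
      next
        assume a: "fst (es ! e) = u \<and> snd (es ! e) = v"
        show thesis
          by (rule that[of "Suc (2 * e)"]) (use a e in \<open>auto simp: endpoint_def other_endpoint_def\<close>)
      qed
      then show "processed P m' i v q e u" using I q unfolding I_def by blast
    qed
    then show "same 16 r r' \<and> good P m' \<and> extends (Suc i) m m' \<and> layer_processed P m' i"
      using I by (simp add: I_def)
  qed (simp_all add: edges_cost_def algebra_simps)
qed

text \<open>The count of \<open>src\<close> in layer \<open>i\<close> is tested just before that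
  layer is expanded; it is final by then, since layer \<open>i\<close> grows only while layer
  \<open>i - 1\<close> is expanded. Testing the layers \<open>i < k\<close> matches walks on at most
  \<open>k\<close> vertices.\<close>

lemma runs_layers:
  assumes P: "prime P" "2 * (P * P) < 2 ^ w" and good: "good P m" and r: "regs P r"
  shows "runs w layers_prog r m ((k + 1) * (edges_cost + 60) + 3)
    (\<lambda>r' m'. (\<forall>x<15. x \<noteq> 0 \<longrightarrow> r' x = r x) \<and> good P m' \<and> (\<forall>i<k. layer_processed P m' i) \<and>
      r' 0 = (if \<exists>i<k. cnt m' i src \<noteq> 0 then 1 else r 0))"
proof -
  define I where "I = (\<lambda>i r' m'. (\<forall>x<15. x \<noteq> 0 \<longrightarrow> r' x = r x) \<and> r' 15 = i \<and> good P m' \<and>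
    (\<forall>i'<i. layer_processed P m' i') \<and> r' 0 = (if \<exists>i'<i. cnt m' i' src \<noteq> 0 then 1 else r 0))"
  have small: "2 < (2::nat) ^ w" using prime_ge_2_nat[OF P(1)] P(2) by (rule two_less_word)
  let ?check = "Cond (Equal (M (R 10 .+ (R 15 .* R 1 .+ R 4))) (N 0)) Skip (0 ::= N 1);; 16 ::= N 0"
  let ?body = "?check;; edges_prog;; 15 ::= R 15 .+ N 1"
  let ?cost = "1 + 20 + (1 + edges_cost + 4)"
  have k: "k + 1 < 2 ^ w"
  proof -
    have "(k + 1) * 1 \<le> (k + 1) * n" using n_pos by (intro mult_le_mono) auto
    also have "\<dots> \<le> SB" by (simp add: SB_def)
    finally show ?thesis using top by simp
  qed
  have body: "runs w ?body r' m' ?cost (I (Suc i))"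
    if i: "i < k" and I: "I i r' m'" for i r' m'
  proof -
    define r1 where "r1 = (if cnt m' i src = 0 then r'(16 := 0) else r'(0 := 1, 16 := 0))"
    have regs: "regs P r'" using I r by (simp add: I_def regs_def)
    have c: "CNT + cell i src < 2 ^ w" using cnt_addr[of i src] i src top by simp
    have c1: "CNT + (i * n + src) < 2 ^ w" "i * n + src < 2 ^ w" "i * n < 2 ^ w"
      using c by (simp_all add: cell_def)
    have wp: "wpb w ?check (\<lambda>r m. r = r1 \<and> m = m') r' m'"
      using regs I c1 small by (simp add: regs_def I_def r1_def cnt_def cell_def)
    have regs1: "regs P r1" "r1 15 = i" "r1 16 = 0" using regs I by (auto simp: r1_def regs_def I_def)
    have good': "good P m'" using I by (simp add: I_def)
    show ?thesis
    proof (rule runs_Seq[OF runs_wpb[OF wp, of 20] _ order.refl])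
      fix r2 m2 assume "r2 = r1 \<and> m2 = m'"
      then have [simp]: "r2 = r1" "m2 = m'" by auto
      have "runs w (edges_prog;; 15 ::= R 15 .+ N 1) r1 m' (1 + edges_cost + 4) (I (Suc i))"
      proof (rule runs_Seq[OF runs_edges[OF P good' i regs1] _ order.refl])
        fix r3 m3 assume a: "same 16 r1 r3 \<and> good P m3 \<and> extends (Suc i) m' m3 \<and> layer_processed P m3 i"
        then have s: "same 16 r1 r3" and e: "extends (Suc i) m' m3" by auto
        have cn: "cnt m3 i' src = cnt m' i' src" if "i' \<le> i" for i'
          using extends_cnt[OF e that i src] .
        have "layer_processed P m3 i'" if "i' < Suc i" for i'
          using a that I layer_processed_extends[OF _ e _ i, of P i'] unfolding I_def
          by (cases "i' = i") auto
        moreover have "r3 0 = (if \<exists>i'<Suc i. cnt m3 i' src \<noteq> 0 then 1 else r 0)"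
        proof -
          have "r3 0 = r1 0" using sameD[OF s, of 0] by simp
          also have "\<dots> = (if \<exists>i'<Suc i. cnt m' i' src \<noteq> 0 then 1 else r 0)"
            using I by (auto simp: r1_def I_def less_Suc_eq)
          also have "(\<exists>i'<Suc i. cnt m' i' src \<noteq> 0) \<longleftrightarrow> (\<exists>i'<Suc i. cnt m3 i' src \<noteq> 0)"
            using cn by auto
          finally show ?thesis .
        qed
        moreover have "r3 x = r x" if "x < 15" "x \<noteq> 0" for x
          using that sameD[OF s, of x] I by (auto simp: I_def r1_def)
        moreover have "r3 15 = i" using sameD[OF s, of 15] regs1 by simp
        ultimately show "runs w (15 ::= R 15 .+ N 1) r3 m3 4 (I (Suc i))"
          using a k small i by (intro runs_wpb) (auto simp: I_def)
      qed
      then show "runs w (edges_prog;; 15 ::= R 15 .+ N 1) r2 m2 (1 + edges_cost + 4) (I (Suc i))"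
        by simp
    qed simp
  qed
  have loop: "runs w (While (Less (R 15) (R 3)) ?body) r0 m0 ((k + 1) * (edges_cost + 60))
    (\<lambda>r' m'. (\<forall>x<15. x \<noteq> 0 \<longrightarrow> r' x = r x) \<and> good P m' \<and> (\<forall>i<k. layer_processed P m' i) \<and>
      r' 0 = (if \<exists>i<k. cnt m' i src \<noteq> 0 then 1 else r 0))"
    if "I 0 r0 m0" for r0 m0
  proof (rule runs_mono[OF runs_While_body[where I = I and l = k and A = "edges_cost + 60" and B = ?cost,
        OF that _ _ _ order.refl]])
    fix i r' m' assume i: "i < k" and I: "I i r' m'"
    then show "bsafe w (Less (R 15) (R 3)) r' m' \<and> bv (Less (R 15) (R 3)) r' m' \<and> runs w ?body r' m' ?cost (I (Suc i))"
      using body[OF i I] r by (simp add: I_def regs_def)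
  next
    fix r' m' assume "I k r' m'"
    then show "bsafe w (Less (R 15) (R 3)) r' m' \<and> \<not> bv (Less (R 15) (R 3)) r' m'"
      using r by (simp add: I_def regs_def)
  qed (simp_all add: I_def)
  have "I 0 (r(15 := 0)) m" using good by (simp add: I_def)
  from loop[OF this] show ?thesis
    unfolding layers_prog_def by (intro runs_Seq_wpb[where B' = "(k + 1) * (edges_cost + 60)"]) simp_all
qed

text \<open>The part of the invariant that does not depend on the prime: layer 0 holds the trivial walk.\<close>

definition base_ok :: "(nat \<Rightarrow> nat) \<Rightarrow> bool" where
  "base_ok m \<longleftrightarrow> input_ok m \<and> (\<forall>v<n. cnt m 0 v = (if v = trg then 1 else 0)) \<and>
     entry m 0 trg 0 = (\<lambda>i. if i = 0 then 1 else 0)"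

lemma good_imp_base_ok: "good P m \<Longrightarrow> base_ok m"
  by (simp add: good_def base_ok_def)

lemma runs_reset:
  assumes P: "prime P" "2 * (P * P) < 2 ^ w" and base: "base_ok m" and r: "regs P r"
  shows "runs w reset_prog r m (30 * (k * n + 2)) (\<lambda>r' m'. same 15 r r' \<and> good P m')"
proof -
  define I where "I = (\<lambda>j r' m'. same 15 r r' \<and> r' 15 = n + j \<and> m' = wr m (CNT + n) j (\<lambda>_. 0))"
  have P2: "P \<ge> 2" using P(1) by (rule prime_ge_2_nat)
  have small: "2 < (2::nat) ^ w" using P2 P(2) by (rule two_less_word)
  have SBw: "SB < 2 ^ w" using top by linarith
  have kn: "CNT + (k + 1) * n < 2 ^ w" "(k + 1) * n < 2 ^ w" "k + 1 < 2 ^ w"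
  proof -
    show 1: "CNT + (k + 1) * n < 2 ^ w" using SBw by (simp add: SB_def)
    then show 2: "(k + 1) * n < 2 ^ w" by linarith
    have "(k + 1) * 1 \<le> (k + 1) * n" using n_pos by (intro mult_le_mono) auto
    then show "k + 1 < 2 ^ w" unfolding mult_1_right using 2 by (rule le_less_trans)
  qed
  let ?body = "Store (R 10 .+ R 15) (N 0);; 15 ::= R 15 .+ N 1"
  have loop: "runs w (While (Less (R 15) ((R 3 .+ N 1) .* R 1)) ?body) r0 m0 (30 * (k * n + 1)) (I (k * n))"
    if "I 0 r0 m0" for r0 m0
  proof (rule runs_While_wpb[where I = I and l = "k * n" and A = 30, OF that])
    fix j r' m' assume j: "j < k * n" and I: "I j r' m'"
    then have s: "same 15 r r'" "r' 15 = n + j" and m': "m' = wr m (CNT + n) j (\<lambda>_. 0)"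
      by (auto simp: I_def)
    have q: "r' 1 = n" "r' 3 = k" "r' 10 = CNT" using r sameD[OF s(1)] by (simp_all add: regs_def)
    have lt: "n + j < (k + 1) * n" using j by simp
    have b: "CNT + (n + j) < 2 ^ w" "n + j + 1 < 2 ^ w" using lt kn by linarith+
    have "(wr m (CNT + n) j (\<lambda>_. 0))(CNT + (n + j) := 0) = wr m (CNT + n) (Suc j) (\<lambda>_. 0)"
      using wr_Suc[of m "CNT + n" j "\<lambda>_. 0"] by (simp add: add.assoc)
    then have "wpb w ?body (I (Suc j)) r' m'"
      using q s small b by (simp add: I_def m')
    then show "bsafe w (Less (R 15) ((R 3 .+ N 1) .* R 1)) r' m' \<and>
      bv (Less (R 15) ((R 3 .+ N 1) .* R 1)) r' m' \<and> wpb w ?body (I (Suc j)) r' m'"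
      using q s small kn lt by simp
  next
    fix r' m' assume "I (k * n) r' m'"
    then have "same 15 r r'" "r' 15 = n + k * n" by (auto simp: I_def)
    then show "bsafe w (Less (R 15) ((R 3 .+ N 1) .* R 1)) r' m' \<and>
      \<not> bv (Less (R 15) ((R 3 .+ N 1) .* R 1)) r' m'"
      using r sameD[of 15 r r' 1] sameD[of 15 r r' 3] small kn by (simp add: regs_def)
  qed auto
  have good: "good P m'" if m': "m' = wr m (CNT + n) (k * n) (\<lambda>_. 0)" for m'
  proof -
    have inp: "m' a = m a" if "a < CNT + n" for a using that by (simp add: m' wr_outside)
    have slot: "m' a = m a" if "SB \<le> a" for a using that by (simp add: m' wr_outside SB_def)
    have c0: "cnt m' 0 v = cnt m 0 v" if "v < n" for v
      using that by (simp add: cnt_def cell_def inp)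
    have cS: "cnt m' (Suc r) v = 0" if "r < k" "v < n" for r v
    proof -
      have "cell (Suc r) v < (k + 1) * n" using that by (intro cell_less) auto
      then show ?thesis by (simp add: cnt_def cell_def m' wr_def)
    qed
    have ent: "entry m' r v q = entry m r v q" for r v q
      unfolding entry_def coefs_def using SB_le_slots[of r v]
      by (intro ext if_cong refl slot) simp
    have input: "input_ok m'"
    proof -
      have "m' (5 + 2 * e) = m (5 + 2 * e)" "m' (6 + 2 * e) = m (6 + 2 * e)" if "e < length es" for e
        using that CNT by (auto intro: inp)
      moreover have "m' (5 + 2 * length es + v) = m (5 + 2 * length es + v)" if "v < n" for v
        using that CNT by (auto intro: inp)
      moreover have "m' (off v + j) = m (off v + j)" if "v < n" "j < length (fs ! v)" for v j
        using that off[OF that(1)] by (auto intro: inp)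
      ultimately show ?thesis using base unfolding base_ok_def input_ok_def by simp
    qed
    have D1: "1 \<le> D" by (simp add: D_def)
    show ?thesis
      unfolding good_def
    proof (intro conjI allI impI)
      fix r v assume rv: "r \<le> k" "v < n"
      show "cnt m' r v \<le> D"
        using rv cS c0 base D1 by (cases r) (auto simp: base_ok_def)
      fix q assume "q < cnt m' r v"
      then have "r = 0 \<and> v = trg \<and> q = 0"
        using rv cS c0 base by (cases r) (auto simp: base_ok_def split: if_splits)
      then have e: "r = 0" "v = trg" "entry m' r v q = (\<lambda>i. if i = 0 then 1 else 0)"
        using ent base by (auto simp: base_ok_def)
      then show "sound_entry P L trg r v (entry m' r v q)" using sound_entry_0 by simp
      show "entry m' r v q j < P" for j using e P2 by simp
    next
      show "slots_ok P L S m' (slots (Suc r) v) (cnt m' (Suc r) v)" if "r < k" "v < n" for r v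
        using cS[OF that] by (simp add: slots_ok_def)
    qed (use input c0 ent base in \<open>auto simp: base_ok_def\<close>)
  qed
  have "I 0 (r(15 := n)) m" by (simp add: I_def)
  then have "runs w (While (Less (R 15) ((R 3 .+ N 1) .* R 1)) ?body) (r(15 := n)) m (30 * (k * n + 1))
    (\<lambda>r' m'. same 15 r r' \<and> good P m')"
    using good by (intro runs_mono[OF loop order.refl]) (auto simp: I_def)
  then show ?thesis
    unfolding reset_prog_def
    by (intro runs_Seq_wpb[where B' = "30 * (k * n + 1)"]) (use r in \<open>simp_all add: regs_def\<close>)
qed

lemma path_of_cnt:
  assumes "good P m" "i < k" "cnt m i src \<noteq> 0"
  shows "has_short_conforming_path {..<n} (edge_of ` set es) f src trg k"
proof (rule sound_entry_imp_path[OF _ assms(2) src])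
  have "\<forall>q<cnt m i src. sound_entry P L trg i src (entry m i src q)"
    using assms(1,2) src unfolding good_def by (meson less_imp_le)
  then show "sound_entry P L trg i src (entry m i src 0)" using assms(3) by blast
qed

text \<open>An instance of \<open>complete_entries\<close> for the entries in memory. Its
  \<open>step\<close> is where linear algebra enters: the extension of a kept entry may be missing,
  but \<open>represented_prod\<close> exchanges it for a kept one that fits the same prefix.\<close>

lemma cnt_of_path:
  assumes P: "prime P" and good: "good P m" and all_done: "\<forall>i<k. layer_processed P m i"
    and walk: "conforming_walk es fs vs l" "hd vs = src" "last vs = trg" "length l < k" "set vs \<subseteq> {..<n}"
    and inj: "inj_on (\<lambda>x. x mod P) (set l \<union> (\<Union>v\<in>set vs. set (fs ! v)))"
  shows "\<exists>i<k. cnt m i src \<noteq> 0"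
proof -
  define ent where "ent = (\<lambda>r v. {entry m r v q | q. q < cnt m r v})"
  have P0: "P > 0" using P by (rule prime_gt_0_nat)
  have sound: "sound_entry P L trg r v (entry m r v q)" if "r \<le> k" "v < n" "q < cnt m r v" for r v q
    using good that unfolding good_def by blast
  have zero: "entry m r v q j = 0" if "r \<le> k" "v < n" "q < cnt m r v" "j > r" for r v q j
    using sound[OF that(1-3)] that(4) by (simp add: sound_entry_def)
  \<comment> \<open>For the empty prefix the product is 1, so the claim only says that the cell of
    \<open>src\<close> in this layer has an entry.\<close>
  have "\<exists>c\<in>ent (length l) (hd vs). \<not> int P dvd (\<Prod>x\<leftarrow>[]. peval L (\<lambda>i. int (c i)) (int x))"
  proof (rule complete_entries[OF P inj _ _ walk(1,3,4,5)])
    have c1: "cnt m 0 trg = 1" and e1: "entry m 0 trg 0 = (\<lambda>i. if i = 0 then 1 else 0)"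
      using good trg by (auto simp: good_def)
    have "peval L (\<lambda>i. int (entry m 0 trg 0 i)) x = 1" for x
      by (simp add: peval_def e1 if_distrib[of int] if_distrib[of "\<lambda>y. y * _"] cong: if_cong)
    then show "\<exists>c\<in>ent 0 trg. \<forall>x. peval L (\<lambda>i. int (c i)) x = 1"
      using c1 unfolding ent_def by auto
  next
    fix r v c e u and xs :: "nat list"
    assume r: "Suc r < k" and c: "c \<in> ent r v" and e: "e < length es" "edge_of (es ! e) = {u, v}"
      and uv: "u < n" "v < n" and len: "length xs \<le> \<mu> * k"
      and nd: "\<not> int P dvd (\<Prod>x\<leftarrow>fs ! u. peval L (\<lambda>i. int (c i)) (int x) * (int x - int e))"
        "\<not> int P dvd (\<Prod>x\<leftarrow>xs. peval L (\<lambda>i. int (c i)) (int x) * (int x - int e))"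
    obtain q where q: "c = entry m r v q" "q < cnt m r v" using c by (auto simp: ent_def)
    define c' where "c' = shift_coef P L (P - e mod P) c"
    have c0: "c j = 0" if "j > r" for j using zero[of r v q j] q uv r that by simp
    have sh: "[(\<Prod>x\<leftarrow>ys. peval L (\<lambda>i. int (c' i)) (int x)) =
      (\<Prod>x\<leftarrow>ys. peval L (\<lambda>i. int (c i)) (int x) * (int x - int e))] (mod int P)" for ys
      unfolding c'_def using c0 r L_ge P0 by (intro cong_prod_list peval_shift_coef) auto
    have "int (\<Prod>x\<leftarrow>fs ! u. peval L c' x) = (\<Prod>x\<leftarrow>fs ! u. peval L (\<lambda>i. int (c' i)) (int x))"
    proof -
      have "int (prod_list xs) = prod_list (map int xs)" for xs by (induction xs) auto
      then show ?thesis by (simp add: o_def of_nat_peval)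
    qed
    moreover have "\<not> int P dvd (\<Prod>x\<leftarrow>fs ! u. peval L (\<lambda>i. int (c' i)) (int x))"
      using nd(1) cong_dvd_iff[OF sh[of "fs ! u"]] by blast
    ultimately have "\<not> P dvd (\<Prod>x\<leftarrow>fs ! u. peval L c' x)" by (metis int_dvd_int_iff)
    moreover have "processed P m r v q e u"
      using all_done r uv e q(2) unfolding layer_processed_def by (meson Suc_lessD)
    ultimately have rep: "represented P L (cnt m (Suc r) u) (entry m (Suc r) u) c'"
      unfolding processed_def Let_def q(1)[symmetric] c'_def by blast
    have "\<exists>q<cnt m (Suc r) u. \<not> int P dvd prod_list (map (peval L (\<lambda>i. int (entry m (Suc r) u q i))) (map int xs))"
    proof (rule represented_prod[OF rep])
      show "length (map int xs) + Suc r \<le> L" using len r L_ge by simp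
      show "c' j = 0" if "j > Suc r" for j using c0 that by (simp add: c'_def shift_coef_def)
      show "entry m (Suc r) u q j = 0" if "q < cnt m (Suc r) u" "j > Suc r" for q j
        using zero[of "Suc r" u q j] that uv r by simp
      show "\<not> int P dvd prod_list (map (peval L (\<lambda>i. int (c' i))) (map int xs))"
        using nd(2) cong_dvd_iff[OF sh[of xs]] by (simp add: o_def)
    qed
    then show "\<exists>c'\<in>ent (Suc r) u. \<not> int P dvd (\<Prod>x\<leftarrow>xs. peval L (\<lambda>i. int (c' i)) (int x))"
      unfolding ent_def by (auto simp: o_def)
  qed (use walk in auto)
  then have "cnt m (length l) src \<noteq> 0" using walk(2) by (auto simp: ent_def)
  then show ?thesis using walk(4) by blast
qed

text \<open>The error is one-sided: register 0 is at most raised to 1, and then a path exists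
  whatever the prime; injectivity on the positions belonging to a concrete walk is what forces it to
  be 1.\<close>

lemma runs_run:
  assumes P: "prime P" "2 * (P * P) < 2 ^ w" and base: "base_ok m" and r: "regs P r"
  shows "runs w run_prog r m (30 * (k * n + 2) + (k + 1) * (edges_cost + 60) + 4)
    (\<lambda>r' m'. (\<forall>x<15. x \<noteq> 0 \<longrightarrow> r' x = r x) \<and> base_ok m' \<and> (r' 0 = 1 \<or> r' 0 = r 0) \<and>
      (r' 0 \<noteq> r 0 \<longrightarrow> has_short_conforming_path {..<n} (edge_of ` set es) f src trg k) \<and>
      (\<forall>vs l. conforming_walk es fs vs l \<and> hd vs = src \<and> last vs = trg \<and> length l < k \<and> set vs \<subseteq> {..<n} \<and>
        inj_on (\<lambda>x. x mod P) (set l \<union> (\<Union>v\<in>set vs. set (fs ! v))) \<longrightarrow> r' 0 = 1))"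
  unfolding run_prog_def
proof (rule runs_Seq[OF runs_reset[OF P base r]])
  fix r1 m1 assume a: "same 15 r r1 \<and> good P m1"
  then have regs: "regs P r1" using r by (auto simp: same_def regs_def)
  have g: "good P m1" using a by simp
  show "runs w layers_prog r1 m1 ((k + 1) * (edges_cost + 60) + 3)
    (\<lambda>r' m'. (\<forall>x<15. x \<noteq> 0 \<longrightarrow> r' x = r x) \<and> base_ok m' \<and> (r' 0 = 1 \<or> r' 0 = r 0) \<and>
      (r' 0 \<noteq> r 0 \<longrightarrow> has_short_conforming_path {..<n} (edge_of ` set es) f src trg k) \<and>
      (\<forall>vs l. conforming_walk es fs vs l \<and> hd vs = src \<and> last vs = trg \<and> length l < k \<and> set vs \<subseteq> {..<n} \<and>
        inj_on (\<lambda>x. x mod P) (set l \<union> (\<Union>v\<in>set vs. set (fs ! v))) \<longrightarrow> r' 0 = 1))"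
  proof (rule runs_mono[OF runs_layers[OF P g regs] order.refl])
    fix r' m' assume b: "(\<forall>x<15. x \<noteq> 0 \<longrightarrow> r' x = r1 x) \<and> good P m' \<and> (\<forall>i<k. layer_processed P m' i) \<and>
      r' 0 = (if \<exists>i<k. cnt m' i src \<noteq> 0 then 1 else r1 0)"
    have r0: "r1 0 = r 0" using a by (simp add: same_def)
    have "\<forall>x<15. x \<noteq> 0 \<longrightarrow> r' x = r x" using a b by (simp add: same_def)
    moreover have "base_ok m'" using b good_imp_base_ok by blast
    moreover have "r' 0 = 1 \<or> r' 0 = r 0" using b r0 by (auto split: if_splits)
    moreover have "has_short_conforming_path {..<n} (edge_of ` set es) f src trg k" if "r' 0 \<noteq> r 0"
    proof -
      obtain i where "i < k" "cnt m' i src \<noteq> 0" using b r0 \<open>r' 0 \<noteq> r 0\<close> by (auto split: if_splits)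
      then show ?thesis using path_of_cnt b by blast
    qed
    moreover have "r' 0 = 1"
      if "conforming_walk es fs vs l" "hd vs = src" "last vs = trg" "length l < k" "set vs \<subseteq> {..<n}"
        "inj_on (\<lambda>x. x mod P) (set l \<union> (\<Union>v\<in>set vs. set (fs ! v)))" for vs l
    proof -
      have "\<exists>i<k. cnt m' i src \<noteq> 0" using b that by (intro cnt_of_path[OF P(1)]) auto
      then show ?thesis using b by auto
    qed
    ultimately show "(\<forall>x<15. x \<noteq> 0 \<longrightarrow> r' x = r x) \<and> base_ok m' \<and> (r' 0 = 1 \<or> r' 0 = r 0) \<and>
      (r' 0 \<noteq> r 0 \<longrightarrow> has_short_conforming_path {..<n} (edge_of ` set es) f src trg k) \<and>
      (\<forall>vs l. conforming_walk es fs vs l \<and> hd vs = src \<and> last vs = trg \<and> length l < k \<and> set vs \<subseteq> {..<n} \<and>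
        inj_on (\<lambda>x. x mod P) (set l \<union> (\<Union>v\<in>set vs. set (fs ! v))) \<longrightarrow> r' 0 = 1)"
      by blast
  qed
qed simp

end

section \<open>The loop over the primes\<close>

definition prime_test :: com where
  "prime_test = (15 ::= N 1;; 16 ::= N 2);;
     While (Less (R 16) (R 14)) (
       Cond (Equal (R 14 .% R 16) (N 0)) (15 ::= N 0) Skip;;
       16 ::= R 16 .+ N 1)"

definition primes_prog :: com where
  "primes_prog = (13 ::= N 0;; 14 ::= N 1);;
     While (Less (R 13) (R 12)) (
       14 ::= R 14 .+ N 1;;
       prime_test;;
       Cond (Equal (R 15) (N 1)) (13 ::= R 13 .+ N 1;; run_prog) Skip)"

lemma prime_nat_iff_trial:
  fixes p :: nat
  assumes "p \<ge> 2"
  shows "prime p \<longleftrightarrow> (\<forall>d. 2 \<le> d \<longrightarrow> d < p \<longrightarrow> \<not> d dvd p)"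
proof
  assume "prime p"
  then show "\<forall>d. 2 \<le> d \<longrightarrow> d < p \<longrightarrow> \<not> d dvd p" by (auto simp: prime_nat_iff)
next
  assume a: "\<forall>d. 2 \<le> d \<longrightarrow> d < p \<longrightarrow> \<not> d dvd p"
  show "prime p"
    unfolding prime_nat_iff
  proof (intro conjI allI impI)
    fix d assume d: "d dvd p"
    then have "d \<le> p" using assms by (intro dvd_imp_le) auto
    moreover have "d \<noteq> 0" using d assms by (cases "d = 0") auto
    ultimately show "d = 1 \<or> d = p" using a d by (cases "d = 1 \<or> d = p") auto
  qed (use assms in simp)
qed

lemma runs_prime_test:
  assumes "r 14 = P" "P \<ge> 2" "P + 2 < 2 ^ w"
  shows "runs w prime_test r m (30 * (P + 1)) (\<lambda>r' m'. same 15 r r' \<and> m' = m \<and>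
    r' 15 = (if prime P then 1 else 0))"
proof -
  define I where "I = (\<lambda>j r' m'. same 15 r r' \<and> r' 16 = 2 + j \<and> m' = m \<and>
    r' 15 = (if \<forall>d. 2 \<le> d \<longrightarrow> d < 2 + j \<longrightarrow> \<not> d dvd P then 1 else 0))"
  let ?body = "Cond (Equal (R 14 .% R 16) (N 0)) (15 ::= N 0) Skip;; 16 ::= R 16 .+ N 1"
  have loop: "runs w (While (Less (R 16) (R 14)) ?body) r0 m0 (30 * (P - 2 + 1))
    (\<lambda>r' m'. same 15 r r' \<and> m' = m \<and> r' 15 = (if prime P then 1 else 0))"
    if "I 0 r0 m0" for r0 m0
  proof (rule runs_mono[OF runs_While_wpb[where I = I and l = "P - 2" and A = 30, OF that _ _ _ order.refl]])
    fix j r' m' assume j: "j < P - 2" and I: "I j r' m'"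
    then have q: "r' 14 = P" "r' 16 = 2 + j" using assms(1) sameD[of 15 r r' 14] by (auto simp: I_def)
    have b: "P mod (2 + j) < 2 ^ w" using assms(3) by (rule le_less_trans[OF mod_less_eq_dividend add_lessD1])
    have "I (Suc j) (r'(15 := 0, 16 := Suc (Suc (Suc j)))) m'" if "(2 + j) dvd P"
    proof -
      have "\<not> (\<forall>d. 2 \<le> d \<longrightarrow> d < 2 + Suc j \<longrightarrow> \<not> d dvd P)"
        using that by (intro notI) (auto dest!: spec[of _ "2 + j"])
      then show ?thesis using I by (simp add: I_def)
    qed
    moreover have "I (Suc j) (r'(16 := Suc (Suc (Suc j)))) m'" if "\<not> (2 + j) dvd P"
    proof -
      have "(\<forall>d. 2 \<le> d \<longrightarrow> d < 2 + Suc j \<longrightarrow> \<not> d dvd P) \<longleftrightarrow> (\<forall>d. 2 \<le> d \<longrightarrow> d < 2 + j \<longrightarrow> \<not> d dvd P)"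
        using that by (auto simp: less_Suc_eq)
      then show ?thesis using I by (simp add: I_def)
    qed
    ultimately show "bsafe w (Less (R 16) (R 14)) r' m' \<and> bv (Less (R 16) (R 14)) r' m' \<and>
      wpb w ?body (I (Suc j)) r' m'"
      using q j assms b by (auto simp: mod_eq_0_iff_dvd)
  next
    fix r' m' assume "I (P - 2) r' m'"
    then show "bsafe w (Less (R 16) (R 14)) r' m' \<and> \<not> bv (Less (R 16) (R 14)) r' m'"
      using assms sameD[of 15 r r' 14] by (auto simp: I_def)
  next
    fix r' m' assume "I (P - 2) r' m'"
    then show "same 15 r r' \<and> m' = m \<and> r' 15 = (if prime P then 1 else 0)"
      using prime_nat_iff_trial[OF assms(2)] assms(2) by (simp add: I_def)
  qed auto
  have "I 0 (r(15 := 1, 16 := 2)) m" by (simp add: I_def)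
  from loop[OF this] show ?thesis
    unfolding prime_test_def
    by (intro runs_Seq_wpb[where B' = "30 * (P - 2 + 1)"]) (use assms in simp_all)
qed

context machine
begin

definition run_cost :: nat where
  "run_cost = 30 * (k * n + 2) + (k + 1) * (edges_cost + 60) + 4"

text \<open>At most \<open>k\<close> vertices delete at most \<open>\<mu>\<close> edges each, and
  the walk has fewer than \<open>k\<close> edges; the sum is covered by
  \<open>\<mu> * k + k \<le> L\<close>.\<close>

lemma card_walk_labels:
  assumes "conforming_walk es fs vs l" "length l < k" "set vs \<subseteq> {..<n}"
  shows "card (set l \<union> (\<Union>v\<in>set vs. set (fs ! v))) \<le> L"
proof -
  have "card (\<Union>v\<in>set vs. set (fs ! v)) \<le> (\<Sum>v\<in>set vs. card (set (fs ! v)))"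
    by (rule card_UN_le) simp
  also have "\<dots> \<le> (\<Sum>v\<in>set vs. \<mu>)"
  proof (rule sum_mono)
    fix v assume "v \<in> set vs"
    then show "card (set (fs ! v)) \<le> \<mu>" using len_f[of v] assms(3) card_length[of "fs ! v"] by fastforce
  qed
  also have "\<dots> = card (set vs) * \<mu>" by simp
  also have "\<dots> \<le> k * \<mu>"
    using card_length[of vs] length_conforming_walk[OF assms(1)] assms(2) by (intro mult_le_mono1) simp
  finally have "card (\<Union>v\<in>set vs. set (fs ! v)) \<le> \<mu> * k" by (simp add: mult.commute)
  moreover have "card (set l) \<le> k" using card_length[of l] assms(2) by simp
  ultimately show ?thesis using card_Un_le[of "set l" "\<Union>v\<in>set vs. set (fs ! v)"] L_ge(1) by linarith
qed

text \<open>How many candidates are tested is not known beforehand, so the loop is charged to a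
  potential: the candidates left up to \<open>X\<close> pay for trial division, the primes left up
  to \<open>K\<close> pay for the runs.\<close>

lemma runs_primes:
  fixes K lg :: nat
  defines "K \<equiv> L * L * lg" and "X \<equiv> 2 * K\<^sup>2"
  assumes X: "2 * (X * X) < 2 ^ w" and lg: "length es < 2 ^ lg" "lg \<ge> 1"
    and base: "base_ok m" and r: "r 12 = K" "r 0 = 0" "\<And>P. regs P (r(14 := P))"
  shows "runs w primes_prog r m (X * (30 * (X + 1) + 60) + K * (run_cost + 30) + 20)
    (\<lambda>r' m'. r' 0 = (if has_short_conforming_path {..<n} (edge_of ` set es) f src trg k then 1 else 0))"
proof -
  let ?path = "has_short_conforming_path {..<n} (edge_of ` set es) f src trg k"
  define primes where "primes = (\<lambda>P. {p::nat. prime p \<and> p \<le> P})"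
  have fin: "finite (primes P)" for P unfolding primes_def by (rule finite_subset[of _ "{..P}"]) auto
  define complete where "complete = (\<lambda>p. \<exists>vs l. conforming_walk es fs vs l \<and> hd vs = src \<and> last vs = trg \<and>
    length l < k \<and> set vs \<subseteq> {..<n} \<and> inj_on (\<lambda>x. x mod p) (set l \<union> (\<Union>v\<in>set vs. set (fs ! v))))"
  define I where "I = (\<lambda>r' m'. (\<forall>x. 0 < x \<and> x < 13 \<longrightarrow> r' x = r x) \<and> r' 13 = card (primes (r' 14)) \<and>
    1 \<le> r' 14 \<and> r' 13 \<le> K \<and> base_ok m' \<and> (r' 0 = 0 \<or> r' 0 = 1) \<and> (r' 0 = 1 \<longrightarrow> ?path) \<and>
    (\<forall>p\<in>primes (r' 14). complete p \<longrightarrow> r' 0 = 1))"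
  define \<Phi> where "\<Phi> = (\<lambda>r' :: reg \<Rightarrow> nat. (X - r' 14) * (30 * (X + 1) + 60) + (K - r' 13) * (run_cost + 30))"
  have "\<mu> * k \<ge> 1" using \<mu> k by simp
  then have L2: "L \<ge> 2" by (simp add: L_def)
  have "2 * 2 * 1 \<le> K" unfolding K_def using L2 lg(2) by (intro mult_le_mono)
  then have K4: "K \<ge> 4" by simp
  have XK: "K \<le> card (primes X)" using many_primes[of K] K4 by (simp add: X_def primes_def)
  have X1: "X + 2 \<le> 2 * (X * X)" "1 < X"
  proof -
    have "4 * 4 \<le> K * K" using K4 by (intro mult_le_mono)
    then show "1 < X" by (simp add: X_def power2_eq_square)
    then have "2 * X \<le> X * X" by simp
    then show "X + 2 \<le> 2 * (X * X)" using \<open>1 < X\<close> by linarith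
  qed
  \<comment> \<open>By \<open>many_primes\<close> there are \<open>K\<close> primes up to
    \<open>X\<close>; as long as fewer have been found the candidate is below \<open>X\<close>, so
    the first summand of the potential never runs dry.\<close>
  have less_X: "P < X" if "card (primes P) < K" for P
  proof (rule ccontr)
    assume "\<not> P < X"
    then have "primes X \<subseteq> primes P" by (auto simp: primes_def)
    then have "card (primes X) \<le> card (primes P)" by (intro card_mono fin)
    then show False using that XK by simp
  qed
  have primes_Suc: "primes (Suc P) = (if prime (Suc P) then insert (Suc P) (primes P) else primes P)" for P
    by (auto simp: primes_def le_Suc_eq)
  have not_mem: "Suc P \<notin> primes P" for P by (simp add: primes_def)
  let ?body = "14 ::= R 14 .+ N 1;; prime_test;; Cond (Equal (R 15) (N 1)) (13 ::= R 13 .+ N 1;; run_prog) Skip"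
  have step: "\<exists>B. runs w ?body r' m' B (\<lambda>r'' m''. I r'' m'' \<and> 4 + B + \<Phi> r'' \<le> \<Phi> r')"
    if I: "I r' m'" and less: "r' 13 < K" for r' m'
  proof -
    define P where "P = Suc (r' 14)"
    have PX: "P \<le> X" using less_X[of "r' 14"] less I by (simp add: I_def P_def)
    have P2: "P \<ge> 2" using I by (simp add: I_def P_def)
    have "P * P \<le> X * X" using PX by (intro mult_le_mono)
    then have PP: "2 * (P * P) < 2 ^ w" using X by linarith
    have Pw: "P + 2 < 2 ^ w" using PX X X1 by linarith
    have Kw: "K < 2 ^ w"
    proof -
      have "1 * K \<le> (2 * K) * K" using K4 by (intro mult_le_mono1) simp
      then have "K \<le> X" by (simp add: X_def power2_eq_square)
      then show ?thesis using X X1 by linarith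
    qed
    define B where "B = 1 + 4 + (1 + 30 * (P + 1) + (1 + 3 + (if prime P then 1 + 4 + run_cost else 1)))"
    have \<Phi>1: "(X - r' 14) * (30 * (X + 1) + 60) = (X - P) * (30 * (X + 1) + 60) + (30 * (X + 1) + 60)"
    proof -
      have "X - r' 14 = Suc (X - P)" using PX by (simp add: P_def)
      then show ?thesis by simp
    qed
    have \<Phi>2: "(K - r' 13) * (run_cost + 30) = (K - Suc (r' 13)) * (run_cost + 30) + (run_cost + 30)"
    proof -
      have "K - r' 13 = Suc (K - Suc (r' 13))" using less by simp
      then show ?thesis by simp
    qed
    define r1 where "r1 = r'(14 := P)"
    let ?Q = "\<lambda>r'' m''. I r'' m'' \<and> 4 + B + \<Phi> r'' \<le> \<Phi> r'"
    have "runs w (prime_test;; Cond (Equal (R 15) (N 1)) (13 ::= R 13 .+ N 1;; run_prog) Skip) r1 m'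
      (1 + 30 * (P + 1) + (1 + 3 + (if prime P then 1 + 4 + run_cost else 1))) ?Q"
    proof (rule runs_Seq[OF runs_prime_test[OF _ P2 Pw] _ order.refl])
      show "r1 14 = P" by (simp add: r1_def)
      fix r2 m2 assume a: "same 15 r1 r2 \<and> m2 = m' \<and> r2 15 = (if prime P then 1 else 0)"
      then have s: "same 15 r1 r2" and m2: "m2 = m'" and r15: "r2 15 = (if prime P then 1 else 0)" by auto
      have low: "r2 x = r' x" if "x < 14" for x using sameD[OF s, of x] that by (simp add: r1_def)
      have r14: "r2 14 = P" using sameD[OF s, of 14] by (simp add: r1_def)
      show "runs w (Cond (Equal (R 15) (N 1)) (13 ::= R 13 .+ N 1;; run_prog) Skip) r2 m2
        (1 + 3 + (if prime P then 1 + 4 + run_cost else 1)) ?Q"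
      proof (rule runs_Cond)
        assume "bval w (Equal (R 15) (N 1)) (r2, m2)"
        then have prime: "prime P" using r15 Pw by (auto split: if_splits)
        define r3 where "r3 = r2(13 := Suc (r' 13))"
        have regs: "regs P r3"
          using r(3)[of P] I low r14 by (simp add: regs_def r3_def I_def)
        have base': "base_ok m'" using I by (simp add: I_def)
        have card: "card (primes P) = Suc (r' 13)"
          using primes_Suc[of "r' 14"] prime not_mem[of "r' 14"] fin I by (simp add: P_def I_def)
        have "runs w run_prog r3 m' run_cost ?Q"
        proof (rule runs_mono[OF runs_run[OF prime PP base' regs]])
          fix r4 m4
          assume b: "(\<forall>x<15. x \<noteq> 0 \<longrightarrow> r4 x = r3 x) \<and> base_ok m4 \<and> (r4 0 = 1 \<or> r4 0 = r3 0) \<and>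
            (r4 0 \<noteq> r3 0 \<longrightarrow> ?path) \<and>
            (\<forall>vs l. conforming_walk es fs vs l \<and> hd vs = src \<and> last vs = trg \<and> length l < k \<and> set vs \<subseteq> {..<n} \<and>
              inj_on (\<lambda>x. x mod P) (set l \<union> (\<Union>v\<in>set vs. set (fs ! v))) \<longrightarrow> r4 0 = 1)"
          have r30: "r3 0 = r' 0" using low by (simp add: r3_def)
          have r4: "r4 14 = P" "r4 13 = Suc (r' 13)" using b r14 by (simp_all add: r3_def)
          have "I r4 m4"
            unfolding I_def
          proof (intro conjI ballI impI allI)
            fix x :: reg assume "0 < x \<and> x < 13"
            then show "r4 x = r x" using b low I by (simp add: r3_def I_def)
          next
            fix p assume p: "p \<in> primes (r4 14)" "complete p"
            show "r4 0 = 1"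
            proof (cases "p = P")
              case True
              then show ?thesis using p(2) b unfolding complete_def by blast
            next
              case False
              then have "p \<in> primes (r' 14)" using p(1) r4 by (auto simp: primes_def P_def le_Suc_eq)
              then have "r' 0 = 1" using I p(2) unfolding I_def by blast
              then show ?thesis using b r30 by auto
            qed
          next
            show "r4 0 = 0 \<or> r4 0 = 1" using b r30 I by (auto simp: I_def)
          next
            assume "r4 0 = 1"
            show ?path
            proof (cases "r' 0 = 1")
              case True
              then show ?thesis using I by (simp add: I_def)
            next
              case False
              then show ?thesis using b r30 \<open>r4 0 = 1\<close> by simp
            qed
          qed (use b r4 card less P2 in auto)
          moreover have "4 + B + \<Phi> r4 \<le> \<Phi> r'"
            using \<Phi>1 \<Phi>2 PX prime unfolding \<Phi>_def r4 B_def by simp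
          ultimately show "?Q r4 m4" by blast
        qed (simp add: run_cost_def)
        then show "runs w (13 ::= R 13 .+ N 1;; run_prog) r2 m2 (if prime P then 1 + 4 + run_cost else 1) ?Q"
          using prime low less Kw unfolding m2 r3_def
          by (intro runs_Seq_wpb[where B' = run_cost]) auto
      next
        assume "\<not> bval w (Equal (R 15) (N 1)) (r2, m2)"
        moreover have "1 mod 2 ^ w = (1 :: nat)" using Pw by (intro mod_less) linarith
        ultimately have prime: "\<not> prime P" using r15 by auto
        then have pr: "primes P = primes (r' 14)" using primes_Suc[of "r' 14"] by (simp add: P_def)
        have "I r2 m2" using I low r14 pr P2 by (simp add: I_def m2)
        moreover have "4 + B + \<Phi> r2 \<le> \<Phi> r'"
          using \<Phi>1 PX prime low[of 13] unfolding \<Phi>_def r14 B_def by simp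
        ultimately show "runs w Skip r2 m2 (if prime P then 1 + 4 + run_cost else 1) ?Q"
          using prime by (intro runs_wpb) auto
      qed simp
    qed
    then have "runs w ?body r' m' B ?Q"
      unfolding B_def by (intro runs_Seq_wpb[where B' = "1 + 30 * (P + 1) + (1 + 3 + (if prime P then 1 + 4 + run_cost else 1))"])
        (use Pw in \<open>simp_all add: r1_def P_def\<close>)
    then show ?thesis by blast
  qed
  have loop: "runs w (While (Less (R 13) (R 12)) ?body) r0 m (3 + 1 + \<Phi> r0)
    (\<lambda>r' m'. r' 0 = (if ?path then 1 else 0))" if I0: "I r0 m" for r0
  proof (rule runs_mono[OF runs_While_potential[where I = I and \<Phi> = \<Phi>, OF I0]])
    fix r' m' assume I: "I r' m'" and "bval w (Less (R 13) (R 12)) (r', m')"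
    then have "r' 13 < K" using r(1) by (simp add: I_def)
    note step = step[OF I this]
    have eq: "1 + bcost (Less (R 13) (R 12)) = 4" by simp
    show "\<exists>B. runs w ?body r' m' B (\<lambda>r'' m''. I r'' m'' \<and> 1 + bcost (Less (R 13) (R 12)) + B + \<Phi> r'' \<le> \<Phi> r')"
      unfolding eq by (rule step)
  next
    fix r' m' assume a: "I r' m' \<and> \<not> bval w (Less (R 13) (R 12)) (r', m')"
    then have cK: "K \<le> card (primes (r' 14))" using r(1) by (auto simp: I_def)
    have "r' 0 = 1" if ?path
    proof -
      obtain p where p: "is_path {..<n} (edge_of ` set es) p" "conforming f p" "hd p = src" "last p = trg" "length p \<le> k"
        using \<open>?path\<close> unfolding has_short_conforming_path_def by blast
      obtain l where l: "conforming_walk es fs p l" using path_imp_conforming_walk[OF p(1,2)] by blast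
      have len: "length l < k" using length_conforming_walk[OF l] p(5) by simp
      have pn: "set p \<subseteq> {..<n}" using p(1) by (simp add: is_path_def)
      let ?U = "set l \<union> (\<Union>v\<in>set p. set (fs ! v))"
      \<comment> \<open>The loop has met at least \<open>K = L * L * lg\<close> primes, more than
        can be bad for at most \<open>L\<close> positions below \<open>2 ^ lg\<close>.\<close>
      have "\<exists>q\<in>primes (r' 14). inj_on (\<lambda>x. x mod q) ?U"
      proof (rule exists_injective_prime[OF _ card_walk_labels[OF l len pn]])
        show "x < 2 ^ lg" if "x \<in> ?U" for x
        proof -
          have "x < length es" using that conforming_walk_edges[OF l] fs pn by blast
          then show ?thesis using lg by simp
        qed
        show "L * L * lg \<le> card (primes (r' 14))" using cK by (simp add: K_def)
        show "0 < L * L * lg" using K4 unfolding K_def by linarith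
      qed (use fin in \<open>auto simp: primes_def\<close>)
      then obtain q where q: "q \<in> primes (r' 14)" "inj_on (\<lambda>x. x mod q) ?U" ..
      have "complete q"
        unfolding complete_def using l p(3,4) len pn q(2) by (intro exI[of _ p] exI[of _ l] conjI)
      moreover have "\<forall>p\<in>primes (r' 14). complete p \<longrightarrow> r' 0 = 1"
        using a unfolding I_def by (elim conjE)
      ultimately show ?thesis using q(1) by blast
    qed
    moreover have "(r' 0 = 0 \<or> r' 0 = 1) \<and> (r' 0 = 1 \<longrightarrow> ?path)"
      using a unfolding I_def by (elim conjE) (intro conjI)
    ultimately show "r' 0 = (if ?path then 1 else 0)" by metis
  qed (simp add: \<Phi>_def)
  have "primes 1 = {}" by (auto simp: primes_def dest: prime_ge_2_nat)
  then have "I (r(13 := 0, 14 := 1)) m" using base r(2) by (simp add: I_def)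
  from loop[OF this] have init: "runs w (While (Less (R 13) (R 12)) ?body) (r(13 := 0, 14 := 1)) m
    (3 + 1 + (X * (30 * (X + 1) + 60) + K * (run_cost + 30))) (\<lambda>r' m'. r' 0 = (if ?path then 1 else 0))"
  proof (rule runs_mono)
    have "(X - 1) * (30 * (X + 1) + 60) \<le> X * (30 * (X + 1) + 60)" by (intro mult_le_mono1) simp
    then show "3 + 1 + \<Phi> (r(13 := 0, 14 := 1)) \<le> 3 + 1 + (X * (30 * (X + 1) + 60) + K * (run_cost + 30))"
      by (simp add: \<Phi>_def)
  qed
  have "1 < (2::nat) ^ w" using X X1 by linarith
  then show ?thesis
    unfolding primes_prog_def
    by (intro runs_Seq_wpb[where B' = "3 + 1 + (X * (30 * (X + 1) + 60) + K * (run_cost + 30))"])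
      (use init in simp_all)
qed

end

section \<open>Reading the input\<close>

text \<open>The length of the list \<open>fs ! v\<close> is overwritten by start \<open>* (m + 1) +\<close> length, which packs both
  into one word.\<close>

definition scan_prog :: com where
  "scan_prog =
     While (Less (R 13) (R 1)) (
       14 ::= N 5 .+ N 2 .* R 2 .+ R 13;;
       15 ::= M (R 14);;
       Cond (Less (R 6) (R 15)) (6 ::= R 15) Skip;;
       Store (R 14) (R 10 .* (R 2 .+ N 1) .+ R 15);;
       10 ::= R 10 .+ R 15;;
       13 ::= R 13 .+ N 1)"

definition bits_prog :: com where
  "bits_prog = While (Less (N 0) (R 13)) (13 ::= R 13 ./ N 2;; 12 ::= R 12 .+ N 1)"

definition power_prog :: com where
  "power_prog = While (Less (R 13) (R 7)) (8 ::= R 8 .+ R 8;; 13 ::= R 13 .+ N 1)"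

text \<open>The two stores create the trivial walk at \<open>t\<close>: its count 1, and its
  constant coefficient 1, one past the start of the slot because the pivot comes first. Its other
  coefficients are 0 since the memory behind the input is.\<close>

definition layout_prog :: com where
  "layout_prog =
     9 ::= R 7 .+ N 2 .+ R 8;;
     11 ::= R 10 .+ (R 3 .+ N 1) .* R 1;;
     Store (R 10 .+ R 5) (N 1);;
     Store (R 11 .+ R 5 .* (R 8 .+ N 1) .* R 9 .+ N 1) (N 1)"

definition setup_prog :: com where
  "setup_prog =
     (1 ::= M (N 0);; 2 ::= M (N 1);; 3 ::= M (N 2);; 4 ::= M (N 3);; 5 ::= M (N 4);;
      6 ::= N 0;; 10 ::= N 5 .+ N 2 .* R 2 .+ R 1;; 13 ::= N 0);;
     scan_prog;;
     (7 ::= N 2 .* R 6 .* R 3;; 12 ::= N 0;; 13 ::= R 2);;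
     bits_prog;;
     (12 ::= R 7 .* R 7 .* R 12;; 8 ::= N 1;; 13 ::= N 0);;
     power_prog;;
     layout_prog"

definition main_prog :: com where
  "main_prog = setup_prog;; primes_prog"

definition bit_length :: "nat \<Rightarrow> nat" where
  "bit_length x = (LEAST j. x < 2 ^ j)"

lemma less_bit_length: "x < 2 ^ bit_length x"
  unfolding bit_length_def by (rule LeastI[of _ x]) (rule less_exp)

lemma bit_length_le: "j < bit_length x \<Longrightarrow> 2 ^ j \<le> x"
  unfolding bit_length_def using not_less_Least not_le by blast

context machine
begin

definition raw_input :: "(nat \<Rightarrow> nat) \<Rightarrow> bool" where
  "raw_input m \<longleftrightarrow> m 0 = n \<and> m 1 = length es \<and> m 2 = k \<and> m 3 = src \<and> m 4 = trg \<and>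
     (\<forall>e<length es. m (5 + 2 * e) = fst (es ! e) \<and> m (6 + 2 * e) = snd (es ! e)) \<and>
     (\<forall>v<n. m (5 + 2 * length es + v) = length (fs ! v) \<and>
       (\<forall>i<length (fs ! v). m (off v + i) = fs ! v ! i)) \<and>
     (\<forall>a\<ge>CNT. m a = 0)"

lemma runs_scan:
  assumes off0: "off 0 = 5 + 2 * length es + n" "\<And>v. v < n \<Longrightarrow> off (Suc v) = off v + length (fs ! v)"
      "off n = CNT"
    and \<mu>: "\<exists>v<n. length (fs ! v) = \<mu>"
    and fit: "(CNT + 1) * (length es + 1) < 2 ^ w"
    and m: "\<And>v. v < n \<Longrightarrow> m (5 + 2 * length es + v) = length (fs ! v)"
    and r: "r 1 = n" "r 2 = length es" "r 6 = 0" "r 10 = off 0" "r 13 = 0"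
  shows "runs w scan_prog r m (60 * (n + 1)) (\<lambda>r' m'. (\<forall>x<13. x \<noteq> 6 \<and> x \<noteq> 10 \<longrightarrow> r' x = r x) \<and>
    r' 6 = \<mu> \<and> r' 10 = CNT \<and>
    m' = wr m (5 + 2 * length es) n (\<lambda>v. off v * (length es + 1) + length (fs ! v)))"
proof -
  let ?M = "length es" let ?f = "\<lambda>v. off v * (length es + 1) + length (fs ! v)"
  define I where "I = (\<lambda>j r' m'. (\<forall>x<13. x \<noteq> 6 \<and> x \<noteq> 10 \<longrightarrow> r' x = r x) \<and> r' 13 = j \<and>
    r' 10 = off j \<and> r' 6 \<le> \<mu> \<and> (\<forall>v<j. length (fs ! v) \<le> r' 6) \<and> m' = wr m (5 + 2 * ?M) j ?f)"
  have CNTw: "CNT + 1 < 2 ^ w" "?M + 1 < 2 ^ w"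
  proof -
    have "(CNT + 1) * 1 \<le> (CNT + 1) * (?M + 1)" by (intro mult_le_mono) auto
    then show "CNT + 1 < 2 ^ w" unfolding mult_1_right using fit by (rule le_less_trans)
    have "1 * (?M + 1) \<le> (CNT + 1) * (?M + 1)" by (intro mult_le_mono1) auto
    then show "?M + 1 < 2 ^ w" unfolding mult_1 using fit by (rule le_less_trans)
  qed
  have five: "5 < (2::nat) ^ w" using CNTw CNT by linarith
  show ?thesis
    unfolding scan_prog_def
  proof (rule runs_mono[OF runs_While_wpb[where I = I and l = n and A = 60, OF _ _ _ _ order.refl]])
    fix j r' m' assume j: "j < n" and I: "I j r' m'"
    then have q: "r' 1 = n" "r' 2 = ?M" "r' 13 = j" "r' 10 = off j" and m': "m' = wr m (5 + 2 * ?M) j ?f"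
      using r by (auto simp: I_def)
    have mj: "m' (5 + 2 * ?M + j) = length (fs ! j)" unfolding m' using m[OF j] by (simp add: wr_outside)
    have offj: "off j + length (fs ! j) \<le> CNT" by (rule off[OF j])
    have len: "length (fs ! j) \<le> ?M"
    proof -
      have "card (set (fs ! j)) \<le> card {..<?M}" using fs[OF j] by (intro card_mono) auto
      then show ?thesis using fs[OF j] by (simp add: distinct_card)
    qed
    have b1: "off j * (?M + 1) + length (fs ! j) < 2 ^ w" "off j * (?M + 1) < 2 ^ w"
    proof -
      have "off j * (?M + 1) \<le> CNT * (?M + 1)" using offj by (intro mult_le_mono1) simp
      then have "off j * (?M + 1) + length (fs ! j) < (CNT + 1) * (?M + 1)"
        unfolding add_mult_distrib[of CNT] using len by (intro add_le_less_mono) auto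
      then show "off j * (?M + 1) + length (fs ! j) < 2 ^ w" using fit by linarith
      then show "off j * (?M + 1) < 2 ^ w" by linarith
    qed
    have b2: "2 * ?M < 2 ^ w" "5 + 2 * ?M < 2 ^ w" "5 + 2 * ?M + j < 2 ^ w" "2 < (2::nat) ^ w" "1 < (2::nat) ^ w"
      "off j + length (fs ! j) < 2 ^ w" "j + 1 < 2 ^ w"
      using CNT CNTw j offj five by linarith+
    have wr: "(wr m (5 + 2 * ?M) j ?f)(5 + 2 * ?M + j := ?f j) = wr m (5 + 2 * ?M) (Suc j) ?f" by (rule wr_Suc)
    define r6 where "r6 = max (r' 6) (length (fs ! j))"
    have r6: "r6 \<le> \<mu>" "\<forall>v<Suc j. length (fs ! v) \<le> r6"
      using I len_f[OF j] by (auto simp: r6_def I_def less_Suc_eq)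
    define rf where "rf = r'(14 := 5 + 2 * ?M + j, 15 := length (fs ! j), 6 := r6, 10 := off (Suc j), 13 := Suc j)"
    have "I (Suc j) rf (m'(5 + 2 * ?M + j := ?f j))"
      using I r6 wr by (simp add: I_def rf_def m')
    moreover have "r'(14 := 5 + 2 * ?M + j, 15 := length (fs ! j), 6 := length (fs ! j), 10 := off j + length (fs ! j), 13 := Suc j) = rf"
      if "r' 6 < length (fs ! j)"
      using that off0(2)[OF j] by (auto simp: rf_def r6_def)
    moreover have "r'(14 := 5 + 2 * ?M + j, 15 := length (fs ! j), 10 := off j + length (fs ! j), 13 := Suc j) = rf"
      if "\<not> r' 6 < length (fs ! j)"
      using that off0(2)[OF j] by (auto simp: rf_def r6_def fun_eq_iff)
    ultimately show "bsafe w (Less (R 13) (R 1)) r' m' \<and> bv (Less (R 13) (R 1)) r' m' \<and>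
      wpb w (14 ::= N 5 .+ N 2 .* R 2 .+ R 13;;
       15 ::= M (R 14);;
       Cond (Less (R 6) (R 15)) (6 ::= R 15) Skip;;
       Store (R 14) (R 10 .* (R 2 .+ N 1) .+ R 15);;
       10 ::= R 10 .+ R 15;;
       13 ::= R 13 .+ N 1) (I (Suc j)) r' m'"
      using q j five b1 b2 mj by (simp add: fun_upd_twist)
  next
    fix r' m' assume "I n r' m'"
    then show "bsafe w (Less (R 13) (R 1)) r' m' \<and> \<not> bv (Less (R 13) (R 1)) r' m'"
      using r by (auto simp: I_def)
  next
    fix r' m' assume I: "I n r' m'"
    then have "r' 6 = \<mu>" using \<mu> by (auto simp: I_def intro: antisym)
    then show "(\<forall>x<13. x \<noteq> 6 \<and> x \<noteq> 10 \<longrightarrow> r' x = r x) \<and> r' 6 = \<mu> \<and> r' 10 = CNT \<and>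
      m' = wr m (5 + 2 * ?M) n ?f" using I off0(3) by (simp add: I_def)
  qed (use r in \<open>auto simp: I_def\<close>)
qed

lemma runs_bits:
  assumes "r 13 = x" "r 12 = 0" "x < 2 ^ w" "2 < (2::nat) ^ w" "bit_length x < 2 ^ w"
  shows "runs w bits_prog r m (20 * (bit_length x + 1)) (\<lambda>r' m'. (\<forall>y<12. r' y = r y) \<and>
    r' 12 = bit_length x \<and> m' = m)"
proof -
  define I where "I = (\<lambda>j r' m'. (\<forall>y<12. r' y = r y) \<and> r' 12 = j \<and> r' 13 = x div 2 ^ j \<and> m' = m)"
  show ?thesis
    unfolding bits_prog_def
  proof (rule runs_mono[OF runs_While_wpb[where I = I and l = "bit_length x" and A = 20, OF _ _ _ _ order.refl]])
    fix j r' m' assume j: "j < bit_length x" and I: "I j r' m'"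
    have "2 ^ j \<le> x" using j by (rule bit_length_le)
    then have "0 < x div 2 ^ j" by (simp add: div_greater_zero_iff)
    moreover have "x div 2 ^ j div 2 < 2 ^ w"
      using assms(3) by (meson div_le_dividend le_less_trans)
    moreover have "x div 2 ^ j div 2 = x div 2 ^ Suc j" 
      by (simp only: power_Suc2 div_mult2_eq)
    ultimately show "bsafe w (Less (N 0) (R 13)) r' m' \<and> bv (Less (N 0) (R 13)) r' m' \<and>
      wpb w (13 ::= R 13 ./ N 2;; 12 ::= R 12 .+ N 1) (I (Suc j)) r' m'"
      using I assms j by (simp add: I_def)
  next
    fix r' m' assume "I (bit_length x) r' m'"
    then show "bsafe w (Less (N 0) (R 13)) r' m' \<and> \<not> bv (Less (N 0) (R 13)) r' m'"
      using less_bit_length[of x] by (simp add: I_def)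
  qed (use assms in \<open>auto simp: I_def\<close>)
qed

lemma runs_power:
  assumes "r 7 = L" "r 8 = 1" "r 13 = 0" "D + L < 2 ^ w" "2 < (2::nat) ^ w"
  shows "runs w power_prog r m (20 * (L + 1)) (\<lambda>r' m'. (\<forall>y<13. y \<noteq> 8 \<longrightarrow> r' y = r y) \<and>
    r' 8 = D \<and> m' = m)"
proof -
  define I where "I = (\<lambda>j r' m'. (\<forall>y<13. y \<noteq> 8 \<longrightarrow> r' y = r y) \<and> r' 8 = 2 ^ j \<and> r' 13 = j \<and> m' = m)"
  show ?thesis
    unfolding power_prog_def
  proof (rule runs_mono[OF runs_While_wpb[where I = I and l = L and A = 20, OF _ _ _ _ order.refl]])
    fix j r' m' assume j: "j < L" and I: "I j r' m'"
    have "(2::nat) ^ Suc j \<le> D" unfolding D_def using j by (intro power_increasing) auto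
    then have "(2::nat) ^ j + 2 ^ j < 2 ^ w" using assms(4) by simp
    then show "bsafe w (Less (R 13) (R 7)) r' m' \<and> bv (Less (R 13) (R 7)) r' m' \<and>
      wpb w (8 ::= R 8 .+ R 8;; 13 ::= R 13 .+ N 1) (I (Suc j)) r' m'"
      using I assms j by (simp add: I_def)
  next
    fix r' m' assume "I L r' m'"
    then show "bsafe w (Less (R 13) (R 7)) r' m' \<and> \<not> bv (Less (R 13) (R 7)) r' m'"
      using assms by (simp add: I_def)
  next
    fix r' m' assume "I L r' m'"
    then show "(\<forall>y<13. y \<noteq> 8 \<longrightarrow> r' y = r y) \<and> r' 8 = D \<and> m' = m" by (simp add: I_def D_def)
  qed (use assms in \<open>auto simp: I_def\<close>)
qed

lemma runs_setup:
  fixes lg K :: nat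
  defines "lg \<equiv> bit_length (length es)" and "K \<equiv> L * L * lg"
  assumes off0: "off 0 = 5 + 2 * length es + n" "\<And>v. v < n \<Longrightarrow> off (Suc v) = off v + length (fs ! v)"
      "off n = CNT"
    and \<mu>': "\<exists>v<n. length (fs ! v) = \<mu>"
    and fit: "(CNT + 1) * (length es + 1) < 2 ^ w" and K: "K < 2 ^ w" "lg \<ge> 1"
    and raw: "raw_input m"
  shows "runs w setup_prog r m (100 * n + 20 * lg + 20 * L + 400) (\<lambda>r' m'. base_ok m' \<and> r' 12 = K \<and> r' 0 = r 0 \<and>
    (\<forall>P. regs P (r'(14 := P))))"
proof -
  let ?M = "length es" let ?f = "\<lambda>v. off v * (length es + 1) + length (fs ! v)"
  have CNTw: "CNT + 1 < 2 ^ w"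
  proof -
    have "(CNT + 1) * 1 \<le> (CNT + 1) * (?M + 1)" by (intro mult_le_mono) auto
    then show "CNT + 1 < 2 ^ w" unfolding mult_1_right using fit by (rule le_less_trans)
  qed
  have b0: "0 < (2::nat) ^ w" "1 < (2::nat) ^ w" "2 < (2::nat) ^ w" "3 < (2::nat) ^ w" "4 < (2::nat) ^ w"
    "5 < (2::nat) ^ w" "2 * ?M < 2 ^ w" "5 + 2 * ?M < 2 ^ w" "5 + 2 * ?M + n < 2 ^ w" "?M < 2 ^ w"
    using CNTw CNT by linarith+
  have raw0: "m 0 = n" "m 1 = ?M" "m 2 = k" "m 3 = src" "m 4 = trg"
    "\<And>v. v < n \<Longrightarrow> m (5 + 2 * ?M + v) = length (fs ! v)"
    using raw by (auto simp: raw_input_def)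
  define r1 where "r1 = r(1 := n, 2 := ?M, 3 := k, 4 := src, 5 := trg, 6 := 0, 10 := 5 + 2 * ?M + n, 13 := 0)"
  have wp1: "wpb w (1 ::= M (N 0);; 2 ::= M (N 1);; 3 ::= M (N 2);; 4 ::= M (N 3);; 5 ::= M (N 4);;
      6 ::= N 0;; 10 ::= N 5 .+ N 2 .* R 2 .+ R 1;; 13 ::= N 0) (\<lambda>r' m'. r' = r1 \<and> m' = m) r m"
    using b0 raw0(1-5) by (simp add: r1_def)
  define m2 where "m2 = wr m (5 + 2 * ?M) n ?f"
  have scan: "runs w scan_prog r1 m (60 * (n + 1)) (\<lambda>r' m'. (\<forall>x<13. x \<noteq> 6 \<and> x \<noteq> 10 \<longrightarrow> r' x = r1 x) \<and>
    r' 6 = \<mu> \<and> r' 10 = CNT \<and> m' = m2)"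
    unfolding m2_def
    by (rule runs_scan[OF off0 \<mu>' fit raw0(6)]) (simp_all add: r1_def off0)
  have SBw: "SB < 2 ^ w" using top by linarith
  have SDL: "D + L < 2 ^ w" "S < 2 ^ w"
  proof -
    have "S \<le> (k + 1) * n * (D + 1) * S" using n_pos by simp
    then show "S < 2 ^ w" using top by linarith
    then show "D + L < 2 ^ w" by (simp add: S_def)
  qed
  have LL: "2 * \<mu> * k < 2 ^ w" "2 * \<mu> < 2 ^ w" "L * L < 2 ^ w" "L < 2 ^ w" "lg < 2 ^ w"
  proof -
    show 1: "L < 2 ^ w" using SDL by linarith
    then show "2 * \<mu> * k < 2 ^ w" by (simp add: L_def)
    have "2 * \<mu> * 1 \<le> 2 * \<mu> * k" using k by (intro mult_le_mono) auto
    then show "2 * \<mu> < 2 ^ w" unfolding mult_1_right using 1 unfolding L_def by (rule le_less_trans)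
    have "L * L * 1 \<le> L * L * lg" using K(2) by (intro mult_le_mono) auto
    then show "L * L < 2 ^ w" unfolding mult_1_right using K(1) unfolding K_def by (rule le_less_trans)
    have "1 \<le> L * L" using L_ge(2) by (cases L) auto
    then have "1 * lg \<le> L * L * lg" by (intro mult_le_mono1)
    then show "lg < 2 ^ w" unfolding mult_1 using K(1) unfolding K_def by (rule le_less_trans)
  qed
  have kw: "k + 1 < 2 ^ w" "(k + 1) * n < 2 ^ w" "CNT + (k + 1) * n < 2 ^ w"
  proof -
    show 1: "CNT + (k + 1) * n < 2 ^ w" using SBw by (simp add: SB_def)
    then show 2: "(k + 1) * n < 2 ^ w" by linarith
    have "(k + 1) * 1 \<le> (k + 1) * n" using n_pos by (intro mult_le_mono) auto
    then show "k + 1 < 2 ^ w" unfolding mult_1_right using 2 by (rule le_less_trans)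
  qed
  have slot_w: "trg * (D + 1) * S + SB + 1 < 2 ^ w" "D + 1 < 2 ^ w" "trg * (D + 1) < 2 ^ w"
  proof -
    have s0: "slots 0 trg = SB + trg * (D + 1) * S" by (simp add: slots_def cell_def)
    have "1 * S \<le> (D + 1) * S" by (intro mult_le_mono1) simp
    then have "S \<le> (D + 1) * S" by simp
    then show 1: "trg * (D + 1) * S + SB + 1 < 2 ^ w"
      using slots_top[of 0 trg] trg S_def unfolding s0 by linarith
    have "trg * (D + 1) * 1 \<le> trg * (D + 1) * S" using S_def by (intro mult_le_mono) auto
    with 1 show "trg * (D + 1) < 2 ^ w" by linarith
    show "D + 1 < 2 ^ w" using SDL S_def by linarith
  qed
  have CS: "CNT + n \<le> SB" by (simp add: SB_def)
  define m3 where "m3 = m2(CNT + trg := 1, SB + trg * (D + 1) * S + 1 := 1)"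
  have base: "base_ok m3"
  proof -
    have addr: "5 + 2 * ?M + n \<le> CNT" by (rule CNT)
    have lo: "m3 a = m a" if "a < 5 + 2 * ?M \<or> 5 + 2 * ?M + n \<le> a" "a \<noteq> CNT + trg"
        "a \<noteq> SB + trg * (D + 1) * S + 1" for a
      using that by (simp add: m3_def m2_def wr_outside)
    have lo': "m3 a = m a" if "a < CNT" "a < 5 + 2 * ?M \<or> 5 + 2 * ?M + n \<le> a" for a
      using that CS by (intro lo) auto
    have mid: "m3 (5 + 2 * ?M + v) = ?f v" if "v < n" for v
      using that addr CS by (simp add: m3_def m2_def)
    have zero: "m3 a = 0" if "CNT \<le> a" "a \<noteq> CNT + trg" "a \<noteq> SB + trg * (D + 1) * S + 1" for a
      using lo[of a] that addr raw by (simp add: raw_input_def)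
    have off_ge: "5 + 2 * ?M + n \<le> off v" if "v \<le> n" for v
      using that
    proof (induction v)
      case (Suc v)
      then show ?case using off0(2)[of v] by simp
    qed (simp add: off0)
    have "input_ok m3"
      unfolding input_ok_def
    proof (intro conjI allI impI)
      fix e assume e: "e < ?M"
      show "m3 (5 + 2 * e) = fst (es ! e)" "m3 (6 + 2 * e) = snd (es ! e)"
        using lo'[of "5 + 2 * e"] lo'[of "6 + 2 * e"] e addr raw by (auto simp: raw_input_def)
    next
      fix v assume v: "v < n"
      show "m3 (5 + 2 * ?M + v) = ?f v" by (rule mid[OF v])
      fix i assume i: "i < length (fs ! v)"
      have "m3 (off v + i) = m (off v + i)"
        using off[OF v] i off_ge[of v] v by (intro lo') auto
      then show "m3 (off v + i) = fs ! v ! i" using raw v i by (simp add: raw_input_def)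
    qed
    moreover have "cnt m3 0 v = (if v = trg then 1 else 0)" if "v < n" for v
    proof (cases "v = trg")
      case True
      then show ?thesis using trg CS by (simp add: cnt_def cell_def m3_def)
    next
      case False
      then have "m3 (CNT + v) = 0" using that CS by (intro zero) auto
      then show ?thesis using False by (simp add: cnt_def cell_def)
    qed
    moreover have "entry m3 0 trg 0 = (\<lambda>i. if i = 0 then 1 else 0)"
    proof
      fix i
      show "entry m3 0 trg 0 i = (if i = 0 then 1 else 0)"
      proof (cases "i = 0")
        case True
        then show ?thesis by (simp add: entry_def coefs_def slots_def cell_def m3_def)
      next
        case False
        have "m3 (SB + trg * (D + 1) * S + 1 + i) = 0" using False CS trg by (intro zero) auto
        then show ?thesis using False by (simp add: entry_def coefs_def slots_def cell_def)
      qed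
    qed
    ultimately show ?thesis by (simp add: base_ok_def)
  qed
  let ?Q = "\<lambda>r' m'. base_ok m' \<and> r' 12 = K \<and> r' 0 = r 0 \<and> (\<forall>P. regs P (r'(14 := P)))"
  have last: "runs w layout_prog r' m2 60 ?Q"
    if "r' 0 = r 0" "r' 1 = n" "r' 2 = ?M" "r' 3 = k" "r' 4 = src" "r' 5 = trg" "r' 7 = L" "r' 8 = D" "r' 10 = CNT"
      "r' 12 = K" for r'
  proof -
    have b: "L + 2 < 2 ^ w" "L + 2 + D < 2 ^ w" "CNT + trg < 2 ^ w" "trg * (D + 1) * S < 2 ^ w"
      "SB + trg * (D + 1) * S < 2 ^ w" "SB + trg * (D + 1) * S + 1 < 2 ^ w"
      using SDL S_def slot_w CS SBw trg by linarith+
    have SBe: "CNT + (k + 1) * n = SB" by (simp add: SB_def)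
    have regs: "regs P (r'(9 := S, 11 := SB, 14 := P))" for P
      using that by (simp add: regs_def)
    have S': "L + 2 + D = S" by (simp add: S_def)
    have final: "?Q (r'(9 := S, 11 := SB)) m3" using that base regs by simp
    show ?thesis
    proof (rule runs_wpb)
      show "wpb w layout_prog ?Q r' m2"
        unfolding layout_prog_def
        apply (rule wpb_assign[where x = S])
          apply (use that b b0 in simp)
         apply (use that S' in simp)
        apply (rule wpb_assign[where x = SB])
          apply (use that kw b0 in simp)
         apply (use that SBe in simp)
        apply (subst wpb.simps)
        using that b b0 slot_w final unfolding m3_def by simp
    qed (simp add: layout_prog_def)
  qed
  have s5: "runs w (power_prog;; layout_prog) r' m2 (1 + 20 * (L + 1) + 60) ?Q"
    if "r' 0 = r 0" "r' 1 = n" "r' 2 = ?M" "r' 3 = k" "r' 4 = src" "r' 5 = trg" "r' 7 = L" "r' 8 = 1" "r' 10 = CNT"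
      "r' 12 = K" "r' 13 = 0" for r'
  proof (rule runs_Seq[OF runs_power[OF that(7,8,11) SDL(1) b0(3)] _ order.refl])
    fix r2 m3 assume "(\<forall>y<13. y \<noteq> 8 \<longrightarrow> r2 y = r' y) \<and> r2 8 = D \<and> m3 = m2"
    then have a: "\<And>y. y < 13 \<Longrightarrow> y \<noteq> 8 \<Longrightarrow> r2 y = r' y" "r2 8 = D" "m3 = m2" by auto
    show "runs w layout_prog r2 m3 60 ?Q"
      unfolding a(3) by (rule last) (use a that in simp_all)
  qed
  have s4: "runs w ((12 ::= R 7 .* R 7 .* R 12;; 8 ::= N 1;; 13 ::= N 0);; power_prog;; layout_prog) r' m2 (20 + (1 + 20 * (L + 1) + 60)) ?Q"
    if "r' 0 = r 0" "r' 1 = n" "r' 2 = ?M" "r' 3 = k" "r' 4 = src" "r' 5 = trg" "r' 7 = L" "r' 10 = CNT"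
      "r' 12 = lg" for r'
  proof (rule runs_Seq_wpb)
    have "L * L * lg < 2 ^ w" using K(1) by (simp add: K_def)
    then show "wpb w (12 ::= R 7 .* R 7 .* R 12;; 8 ::= N 1;; 13 ::= N 0) (\<lambda>r' m'. runs w (power_prog;; layout_prog) r' m' (1 + 20 * (L + 1) + 60) ?Q) r' m2"
      using s5[of "r'(12 := K, 8 := 1, 13 := 0)"] that LL b0 by (simp add: K_def)
  qed simp
  have s3: "runs w (bits_prog;; (12 ::= R 7 .* R 7 .* R 12;; 8 ::= N 1;; 13 ::= N 0);; power_prog;; layout_prog) r' m2
      (1 + 20 * (lg + 1) + (20 + (1 + 20 * (L + 1) + 60))) ?Q"
    if "r' 0 = r 0" "r' 1 = n" "r' 2 = ?M" "r' 3 = k" "r' 4 = src" "r' 5 = trg" "r' 7 = L" "r' 10 = CNT"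
      "r' 12 = 0" "r' 13 = ?M" for r'
    unfolding lg_def
  proof (rule runs_Seq[OF runs_bits[OF that(10,9) b0(10,3) LL(5)[unfolded lg_def]] _ order.refl])
    fix r2 m3 assume "(\<forall>y<12. r2 y = r' y) \<and> r2 12 = bit_length ?M \<and> m3 = m2"
    then have a: "\<And>y. y < 12 \<Longrightarrow> r2 y = r' y" "r2 12 = lg" "m3 = m2" by (auto simp: lg_def)
    show "runs w ((12 ::= R 7 .* R 7 .* R 12;; 8 ::= N 1;; 13 ::= N 0);; power_prog;; layout_prog) r2 m3 (20 + (1 + 20 * (L + 1) + 60)) ?Q"
      unfolding a(3) by (rule s4) (use a that in simp_all)
  qed
  have s2: "runs w ((7 ::= N 2 .* R 6 .* R 3;; 12 ::= N 0;; 13 ::= R 2);;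
      bits_prog;; (12 ::= R 7 .* R 7 .* R 12;; 8 ::= N 1;; 13 ::= N 0);; power_prog;; layout_prog) r' m2
      (20 + (1 + 20 * (lg + 1) + (20 + (1 + 20 * (L + 1) + 60)))) ?Q"
    if "r' 0 = r 0" "r' 1 = n" "r' 2 = ?M" "r' 3 = k" "r' 4 = src" "r' 5 = trg" "r' 6 = \<mu>" "r' 10 = CNT" for r'
  proof (rule runs_Seq_wpb)
    show "wpb w (7 ::= N 2 .* R 6 .* R 3;; 12 ::= N 0;; 13 ::= R 2) (\<lambda>r' m'. runs w (bits_prog;; (12 ::= R 7 .* R 7 .* R 12;; 8 ::= N 1;; 13 ::= N 0);; power_prog;; layout_prog) r' m'
      (1 + 20 * (lg + 1) + (20 + (1 + 20 * (L + 1) + 60))) ?Q) r' m2"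
      using s3[of "r'(7 := L, 12 := 0, 13 := ?M)"] that LL b0 by (simp add: L_def)
  qed simp
  show ?thesis
    unfolding setup_prog_def
  proof (rule runs_Seq[OF runs_wpb[OF wp1, of 50]])
    fix r0 m0 assume "r0 = r1 \<and> m0 = m"
    then have e: "r0 = r1" "m0 = m" by auto
    show "runs w (scan_prog;; (7 ::= N 2 .* R 6 .* R 3;; 12 ::= N 0;; 13 ::= R 2);;
      bits_prog;; (12 ::= R 7 .* R 7 .* R 12;; 8 ::= N 1;; 13 ::= N 0);; power_prog;; layout_prog) r0 m0
      (1 + 60 * (n + 1) + (20 + (1 + 20 * (lg + 1) + (20 + (1 + 20 * (L + 1) + 60))))) ?Q"
      unfolding e
    proof (rule runs_Seq[OF scan _ order.refl])
      fix r2 m3 assume "(\<forall>x<13. x \<noteq> 6 \<and> x \<noteq> 10 \<longrightarrow> r2 x = r1 x) \<and> r2 6 = \<mu> \<and> r2 10 = CNT \<and> m3 = m2"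
      then have a: "\<And>x. x < 13 \<Longrightarrow> x \<noteq> 6 \<Longrightarrow> x \<noteq> 10 \<Longrightarrow> r2 x = r1 x" "r2 6 = \<mu>" "r2 10 = CNT" "m3 = m2" by auto
      show "runs w ((7 ::= N 2 .* R 6 .* R 3;; 12 ::= N 0;; 13 ::= R 2);;
        bits_prog;; (12 ::= R 7 .* R 7 .* R 12;; 8 ::= N 1;; 13 ::= N 0);; power_prog;; layout_prog) r2 m3
        (20 + (1 + 20 * (lg + 1) + (20 + (1 + 20 * (L + 1) + 60)))) ?Q"
        unfolding a(4) by (rule s2) (use a in \<open>simp_all add: r1_def\<close>)
    qed
  qed simp_all
qed

end

section \<open>Running time and word length\<close>

text \<open>Trial division costs about \<open>X ^ 2\<close>, which grows with the graph like
  \<open>lg ^ 4\<close>. Since \<open>2 ^ lg\<close> is at most twice the number of edges, this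
  bound hides it in the linear factor.\<close>

lemma bit_length_pow4: "j ^ 4 \<le> 64 * (2::nat) ^ j"
proof (induction j rule: less_induct)
  case (less j)
  show ?case
  proof (cases "j < 6")
    case True
    then have "j \<in> {0, 1, 2, 3, 4, 5}" by auto
    then show ?thesis by auto
  next
    case False
    then obtain i where i: "j = Suc i" "i \<ge> 5" by (cases j) auto
    show ?thesis
    \<comment> \<open>The doubling argument needs \<open>(1 + 1 / i) ^ 4 \<le> 2\<close>, which
      still fails at \<open>i = 5\<close>.\<close>
    proof (cases "i = 5")
      case True
      then show ?thesis using i by simp
    next
      case False
      then have i6: "i \<ge> 6" using i by simp
      have "6 * (i * (i * i)) \<le> i * (i * (i * i))" using i6 by (intro mult_le_mono) auto
      moreover have "6 * (i * i) \<le> i * (i * i)" using i6 by (intro mult_le_mono) auto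
      moreover have "6 * i \<le> i * i" using i6 by (intro mult_le_mono) auto
      moreover have "Suc i ^ 4 = i * (i * (i * i)) + 4 * (i * (i * i)) + 6 * (i * i) + 4 * i + 1"
        "i ^ 4 = i * (i * (i * i))"
        by (simp_all add: eval_nat_numeral algebra_simps)
      ultimately have "Suc i ^ 4 \<le> 2 * i ^ 4" using i6 by linarith
      also have "\<dots> \<le> 2 * (64 * 2 ^ i)" using less.IH[of i] i by simp
      finally show ?thesis using i by simp
    qed
  qed
qed

lemma bit_length_ge1: "x \<ge> 1 \<Longrightarrow> bit_length x \<ge> 1"
  using less_bit_length[of x] by (cases "bit_length x") auto

lemma bit_length_pow_le: "x \<ge> 1 \<Longrightarrow> 2 ^ bit_length x \<le> 2 * x"
  using bit_length_le[of "bit_length x - 1" x] bit_length_ge1[of x]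
  by (cases "bit_length x") auto

context machine
begin

text \<open>Polynomial factors in \<open>L\<close>, \<open>\<mu>\<close> and \<open>k\<close> are
  swallowed by powers of \<open>D\<close>. An insertion costs \<open>O(D ^ 3)\<close>; the entries
  of a cell and the number of layers contribute one more factor \<open>D\<close> each.\<close>

lemma run_cost_le:
  assumes "length es \<ge> 1"
  shows "run_cost + 30 \<le> 30000 * (D ^ 5 * (n + length es))"
proof -
  let ?N = "n + length es"
  have kL: "k + 1 \<le> L" "\<mu> + 1 \<le> L" "2 \<le> L"
  proof -
    have 1: "k \<le> \<mu> * k" "\<mu> \<le> \<mu> * k" "1 \<le> \<mu> * k" using \<mu> k by auto
    then show "k + 1 \<le> L" "\<mu> + 1 \<le> L" "2 \<le> L" unfolding L_def by linarith+
  qed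
  have "L + 2 \<le> 2 ^ L" if "2 \<le> L" for L :: nat
    using that by (induction L rule: dec_induct) auto
  then have LD: "L + 2 \<le> D" using kL(3) by (simp add: D_def)
  then have D4: "4 \<le> D" using kL by simp
  have D1: "D + 1 \<le> 2 * D" using D4 by simp
  have pw: "D ^ i \<le> D ^ j" if "i \<le> j" for i j using that D4 by (intro power_increasing) auto
  have pw1: "1 \<le> D ^ i" for i using D4 by simp
  have "(L + 2) * (D + 1) * (D + 1) \<le> D * (2 * D) * (2 * D)" using LD D1 by (intro mult_le_mono)
  also have "\<dots> = 4 * D ^ 3" by (simp add: eval_nat_numeral algebra_simps)
  finally have 1: "(L + 2) * (D + 1) * (D + 1) \<le> 4 * D ^ 3" .
  have "(L + 2) * (\<mu> + 1) \<le> D * D" using LD kL by (intro mult_le_mono) linarith+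
  also have "\<dots> = D ^ 2" by (simp add: power2_eq_square)
  also have "\<dots> \<le> D ^ 3" by (rule pw) simp
  finally have 2: "(L + 2) * (\<mu> + 1) \<le> D ^ 3" .
  have "1000 * a + 100 * b + 20 \<le> 4120 * c" if "a \<le> 4 * c" "b \<le> c" "1 \<le> c" for a b c :: nat
    using that by linarith
  from this[OF 1 2 pw1] have ins: "insert_cost + 20 \<le> 4120 * D ^ 3"
    by (simp only: insert_cost_def mult.assoc)
  have "(D + 1) * (insert_cost + 20) \<le> (2 * D) * (4120 * D ^ 3)" using D1 ins by (rule mult_le_mono)
  also have "\<dots> = 8240 * (D * D ^ 3)" by (simp add: algebra_simps)
  also have "D * D ^ 3 = D ^ 4" by (simp add: eval_nat_numeral)
  finally have 3: "(D + 1) * (insert_cost + 20) \<le> 8240 * D ^ 4" .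
  have "a + 150 \<le> 8390 * c" if "a \<le> 8240 * c" "1 \<le> c" for a c :: nat
    using that by linarith
  from this[OF 3 pw1] have "(D + 1) * (insert_cost + 20) + 150 \<le> 8390 * D ^ 4" .
  moreover have "2 * length es + 1 \<le> 3 * ?N" using assms by auto
  ultimately have "edges_cost \<le> (3 * ?N) * (8390 * D ^ 4)"
    unfolding edges_cost_def by (intro mult_le_mono)
  also have "\<dots> = 25170 * (D ^ 4 * ?N)" by (simp add: algebra_simps)
  finally have ed: "edges_cost \<le> 25170 * (D ^ 4 * ?N)" .
  have N1: "1 \<le> D ^ i * ?N" for i using mult_le_mono[OF pw1[of i], of 1 ?N] assms by linarith
  have "a + 60 \<le> 25230 * c" if "a \<le> 25170 * c" "1 \<le> c" for a c :: nat
    using that by linarith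
  from this[OF ed N1] have 4: "edges_cost + 60 \<le> 25230 * (D ^ 4 * ?N)" .
  have "k + 1 \<le> D" using kL LD by linarith
  then have "(k + 1) * (edges_cost + 60) \<le> D * (25230 * (D ^ 4 * ?N))"
    using 4 by (rule mult_le_mono)
  also have "\<dots> = 25230 * ((D * D ^ 4) * ?N)" by (simp only: mult_ac)
  also have "D * D ^ 4 = D ^ 5" by (simp add: eval_nat_numeral)
  finally have main: "(k + 1) * (edges_cost + 60) \<le> 25230 * (D ^ 5 * ?N)" .
  have "k \<le> D ^ 1" using kL LD by simp
  then have "k \<le> D ^ 5" using pw[of 1 5] by (rule le_trans) simp
  then have kn: "k * n \<le> D ^ 5 * ?N" by (rule mult_le_mono) simp
  have "30 * (b + 2) + a + 4 + 30 \<le> 30000 * c" if "a \<le> 25230 * c" "b \<le> c" "1 \<le> c" for a b c :: nat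
    using that by simp
  from this[OF main kn N1] show ?thesis unfolding run_cost_def .
qed

text \<open>The exponent 8 comes from trial division, of order \<open>K ^ 4\<close> with
  \<open>K \<le> D ^ 2 * lg\<close>; the runs need \<open>D ^ 7\<close> and contribute the factor
  \<open>lg\<close> through their number.\<close>

lemma total_cost_le:
  fixes lg K X :: nat
  defines "lg \<equiv> bit_length (length es)" and "K \<equiv> L * L * lg" and "X \<equiv> 2 * K\<^sup>2"
  assumes es: "length es \<ge> 1"
  shows "1 + (100 * n + 20 * lg + 20 * L + 400) +
    (X * (30 * (X + 1) + 60) + K * (run_cost + 30) + 20) \<le> 2 ^ 17 * (D ^ 8 * (n + length es) * lg)"
proof -
  let ?N = "n + length es"
  have LD: "L \<le> D" unfolding D_def using less_exp[of L] by simp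
  have L2: "2 \<le> L" using \<mu> k unfolding L_def by (simp add: Suc_le_eq)
  then have D2: "2 \<le> D" using LD by simp
  have pw: "D ^ i \<le> D ^ j" if "i \<le> j" for i j using that D2 by (intro power_increasing) auto
  have pw1: "1 \<le> D ^ i" for i using D2 by simp
  have lg1: "1 \<le> lg" unfolding lg_def using es by (rule bit_length_ge1)
  define A where "A = D ^ 8 * ?N * lg"
  have N1: "1 \<le> ?N" using es by simp
  have K_le: "K \<le> D ^ 2 * lg" unfolding K_def power2_eq_square using LD by (intro mult_le_mono) auto
  have K1: "1 \<le> K" unfolding K_def using L2 lg1 by (simp add: Suc_le_eq)
  have X1: "1 \<le> X" unfolding X_def using K1 by (simp add: Suc_le_eq)
  have "lg ^ 4 \<le> 64 * 2 ^ lg" by (rule bit_length_pow4)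
  also have "\<dots> \<le> 64 * (2 * length es)" unfolding lg_def using es bit_length_pow_le by simp
  finally have lg4: "lg ^ 4 \<le> 128 * ?N" by simp
  have "X * (30 * (X + 1) + 60) \<le> X * (120 * X)" using X1 by (intro mult_le_mono) auto
  also have "\<dots> = 480 * (K\<^sup>2 * K\<^sup>2)" by (simp add: X_def)
  also have "K\<^sup>2 * K\<^sup>2 = K ^ 4" by (simp flip: power_add)
  also have "K ^ 4 \<le> (D ^ 2 * lg) ^ 4" using K_le by (rule power_mono) simp
  also have "(D ^ 2 * lg) ^ 4 = D ^ 8 * lg ^ 4" by (simp add: power_mult_distrib flip: power_mult)
  also have "D ^ 8 * lg ^ 4 \<le> D ^ 8 * (128 * ?N)" using lg4 by (rule mult_le_mono2)
  also have "480 * (D ^ 8 * (128 * ?N)) = 61440 * (D ^ 8 * ?N * 1)" by simp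
  also have "D ^ 8 * ?N * 1 \<le> A" unfolding A_def using lg1 by (rule mult_le_mono2)
  finally have 1: "X * (30 * (X + 1) + 60) \<le> 61440 * A" by simp
  have "K * (run_cost + 30) \<le> (D ^ 2 * lg) * (30000 * (D ^ 5 * ?N))"
    using K_le run_cost_le[OF es] by (rule mult_le_mono)
  also have "\<dots> = 30000 * ((D ^ 2 * D ^ 5) * ?N * lg)" by (simp only: mult_ac)
  also have "D ^ 2 * D ^ 5 = D ^ 7" by (simp flip: power_add)
  also have "D ^ 7 * ?N * lg \<le> A" unfolding A_def by (intro mult_le_mono1 pw) simp
  finally have 2: "K * (run_cost + 30) \<le> 30000 * A" by simp
  have "1 * n * 1 \<le> A" "1 * 1 * lg \<le> A" "D ^ 1 * 1 * 1 \<le> A" "1 * 1 * 1 \<le> A"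
    unfolding A_def using pw1[of 8] pw[of 1 8] N1 lg1 by (intro mult_le_mono; simp)+
  then have 3: "n \<le> A" "lg \<le> A" "L \<le> A" "1 \<le> A" using LD by simp_all
  show ?thesis using 1 2 3 unfolding A_def[symmetric] by simp
qed

end

section \<open>Reading the encoding, and fitting all numbers into words\<close>

lemma nth_concat_pairs:
  "e < length es \<Longrightarrow> concat (map (\<lambda>(u, v). [u, v]) es) ! (2 * e) = fst (es ! e) \<and>
    concat (map (\<lambda>(u, v). [u, v]) es) ! Suc (2 * e) = snd (es ! e)"
proof (induction es arbitrary: e)
  case (Cons p es)
  then show ?case by (cases e; cases p) auto
qed simp

lemma length_concat_pairs: "length (concat (map (\<lambda>(u, v). [u, v]) es)) = 2 * length es"
  by (induction es) auto

lemma nth_concat: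
  "v < length xss \<Longrightarrow> i < length (xss ! v) \<Longrightarrow>
    sum_list (map length (take v xss)) + i < length (concat xss) \<and>
    concat xss ! (sum_list (map length (take v xss)) + i) = xss ! v ! i"
proof (induction xss arbitrary: v)
  case (Cons xs xss)
  then show ?case by (cases v) (auto simp: nth_append)
qed simp

lemma sum_list_take_Suc:
  "v < length xss \<Longrightarrow> sum_list (map length (take (Suc v) xss)) =
    sum_list (map length (take v xss)) + length (xss ! v)"
  by (simp add: take_Suc_conv_app_nth)

text \<open>The hypothesis on the word length, exponentiated, so that all size bounds can be stated
  as powers of the single quantity \<open>Z\<close>.\<close>

lemma powers_fit:
  fixes Z d w q n :: nat
  assumes "Z = 2 ^ q * n" "n \<ge> 1" "real w \<ge> real d * (real q + log 2 (real n))"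
  shows "Z ^ d \<le> 2 ^ w"
proof -
  have n: "real n > 0" using assms(2) by simp
  have "real (Z ^ d) = (2 powr real q * real n) powr real d"
    using n assms(1) by (simp add: powr_realpow)
  also have "2 powr real q * real n = 2 powr (real q + log 2 (real n))"
    using n by (simp add: powr_add)
  also have "(2 powr (real q + log 2 (real n))) powr real d = 2 powr ((real q + log 2 (real n)) * real d)"
    by (rule powr_powr)
  also have "\<dots> \<le> 2 powr real w" using assms(3) by (intro powr_mono) (simp_all add: mult.commute)
  also have "\<dots> = real (2 ^ w)" by (simp add: powr_realpow)
  finally show ?thesis by (simp only: of_nat_le_iff)
qed

text \<open>All quantities are small powers of \<open>Z\<close>; as \<open>Z \<ge> 4\<close>, a
  constant factor of at most 4 costs one more power. The largest power needed is 27, for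
  \<open>2 * (X * X)\<close>, so the exponent 40 leaves slack.\<close>

lemma sizes_fit:
  fixes Z q n k \<mu> M L D S CNT lg K X w :: nat
  assumes Z: "Z = 2 ^ q * n" and q: "q = \<mu> * k" and pos: "\<mu> \<ge> 1" "k \<ge> 1" "n \<ge> 2"
    and M: "M \<le> n * n" "M \<ge> 1" and L: "L = 2 * q" "D = 2 ^ L" "S = L + 2 + D"
    and CNT: "CNT \<le> 5 + 2 * M + n + n * \<mu>" and lg: "lg \<le> M"
    and K: "K = L * L * lg" "X = 2 * K\<^sup>2"
    and w: "Z ^ 40 \<le> 2 ^ w"
  shows "CNT + (k + 1) * n + (k + 1) * n * (D + 1) * S < 2 ^ w"
    "(CNT + 1) * (M + 1) < 2 ^ w" "4 * M + 6 < 2 ^ w" "2 * (X * X) < 2 ^ w" "K < 2 ^ w" "k < 2 ^ w"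
proof -
  have qk: "k \<le> q" "\<mu> \<le> q" "1 \<le> q" using pos q by auto
  have "q < 2 ^ q" by (rule less_exp)
  moreover have "2 ^ q * 1 \<le> 2 ^ q * n" using pos by (intro mult_le_mono) auto
  ultimately have qZ: "q + 1 \<le> Z" unfolding Z by linarith
  have nZ: "n \<le> Z" unfolding Z by simp
  have "2 ^ 1 * 2 \<le> 2 ^ q * n" using qk pos by (intro mult_le_mono power_increasing) auto
  then have Z4: "4 \<le> Z" unfolding Z by simp
  have pw: "Z ^ i \<le> Z ^ j" if "i \<le> j" for i j using that Z4 by (intro power_increasing) auto
  have c4: "c * Z ^ i \<le> Z ^ Suc i" if "c \<le> 4" for c i using that Z4 by (simp add: mult_le_mono)
  have lt: "a < 2 ^ w" if "a \<le> Z ^ i" "i \<le> 39" for a i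
  proof -
    have "Z ^ i < Z ^ 40" using that Z4 by (intro power_strict_increasing) auto
    then show ?thesis using that w by linarith
  qed
  have D: "D \<le> Z ^ 2"
  proof -
    have "D = (2 ^ q) ^ 2" unfolding L by (simp add: power_mult mult.commute)
    also have "\<dots> \<le> Z ^ 2" unfolding Z using pos by (intro power_mono) auto
    finally show ?thesis .
  qed
  have one: "1 \<le> Z ^ i" for i using Z4 by simp
  have D1: "D + 1 \<le> Z ^ 3" using D c4[of 2 2] one[of 2] by simp
  have LZ: "L \<le> Z ^ 2" using D less_exp[of L] unfolding L(2) by linarith
  have SZ: "S \<le> Z ^ 3" using D LZ c4[of 3 2] pw[of 1 2] Z4 unfolding L(3) by simp
  have MZ: "M \<le> Z ^ 2" using M(1) mult_le_mono[OF nZ nZ] by (simp add: power2_eq_square)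
  have "n * \<mu> \<le> Z * Z" using nZ qk qZ by (intro mult_le_mono) auto
  then have nmu: "n * \<mu> \<le> Z ^ 2" by (simp add: power2_eq_square)
  have CZ: "CNT + 1 \<le> Z ^ 4"
  proof -
    have "6 \<le> 2 * Z ^ 2" using pw[of 1 2] Z4 by simp
    then have "CNT + 1 \<le> 6 * Z ^ 2" using CNT MZ nmu nZ pw[of 1 2] by simp
    also have "\<dots> \<le> Z * Z * Z ^ 2" using Z4 mult_le_mono[of 4 Z 4 Z] by (intro mult_le_mono1) simp
    also have "\<dots> = Z ^ 4" by (simp add: eval_nat_numeral)
    finally show ?thesis .
  qed
  have kn: "(k + 1) * n \<le> Z ^ 2"
    unfolding power2_eq_square using qk qZ nZ by (intro mult_le_mono) auto
  have "(k + 1) * n * (D + 1) * S \<le> Z ^ 2 * Z ^ 3 * Z ^ 3" using kn D1 SZ by (intro mult_le_mono)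
  also have "\<dots> = Z ^ 8" by (simp flip: power_add)
  finally have "CNT + (k + 1) * n + (k + 1) * n * (D + 1) * S \<le> 3 * Z ^ 8"
    using CZ kn pw[of 4 8] pw[of 2 8] by simp
  also have "\<dots> \<le> Z ^ 9" using c4[of 3 8] by simp
  finally show "CNT + (k + 1) * n + (k + 1) * n * (D + 1) * S < 2 ^ w" by (rule lt) simp
  have M1: "M + 1 \<le> Z ^ 3" using MZ one[of 2] c4[of 2 2] by simp
  have "(CNT + 1) * (M + 1) \<le> Z ^ 4 * Z ^ 3" using CZ M1 by (rule mult_le_mono)
  also have "\<dots> = Z ^ 7" by (simp flip: power_add)
  finally show "(CNT + 1) * (M + 1) < 2 ^ w" by (rule lt) simp
  have "4 * M + 6 \<le> 4 * Z ^ 3" using M1 one[of 3] M(2) MZ c4[of 4 2] pw[of 1 2] Z4 by simp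
  also have "\<dots> \<le> Z ^ 4" using c4[of 4 3] by simp
  finally show "4 * M + 6 < 2 ^ w" by (rule lt) simp
  have "K \<le> Z ^ 2 * Z ^ 2 * Z ^ 2" unfolding K using LZ lg MZ by (intro mult_le_mono) auto
  also have "\<dots> = Z ^ 6" by (simp flip: power_add)
  finally have KZ: "K \<le> Z ^ 6" .
  then show "K < 2 ^ w" by (rule lt) simp
  have "K\<^sup>2 \<le> (Z ^ 6)\<^sup>2" using KZ by (rule power_mono) simp
  then have "X \<le> 2 * Z ^ 12" unfolding K(2) by (simp flip: power_mult)
  also have "\<dots> \<le> Z ^ 13" using c4[of 2 12] by simp
  finally have "X * X \<le> Z ^ 13 * Z ^ 13" by (intro mult_le_mono)
  then have "2 * (X * X) \<le> 2 * Z ^ 26" by (simp flip: power_add)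
  also have "\<dots> \<le> Z ^ 27" using c4[of 2 26] by simp
  finally show "2 * (X * X) < 2 ^ w" by (rule lt) simp
  have "k \<le> Z ^ 1" using qk qZ by simp
  then show "k < 2 ^ w" by (rule lt) simp
qed

context machine
begin

lemma halts_with_main:
  assumes off0: "off 0 = 5 + 2 * length es + n" "\<And>v. v < n \<Longrightarrow> off (Suc v) = off v + length (fs ! v)"
      "off n = CNT"
    and \<mu>': "\<exists>v<n. length (fs ! v) = \<mu>" and es: "length es \<ge> 1"
    and K: "K = L * L * bit_length (length es)" "X = 2 * K\<^sup>2"
    and fit: "(CNT + 1) * (length es + 1) < 2 ^ w" "2 * (X * X) < 2 ^ w" "K < 2 ^ w"
    and raw: "raw_input (snd (initial_state w ws))"
  shows "\<exists>T. halts_with w main_prog ws T (has_short_conforming_path {..<n} (edge_of ` set es) f src trg k) \<and>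
    T \<le> 2 ^ 17 * (D ^ 8 * (n + length es) * bit_length (length es))"
proof -
  let ?lg = "bit_length (length es)" and ?path = "has_short_conforming_path {..<n} (edge_of ` set es) f src trg k"
  obtain m where init: "initial_state w ws = ((\<lambda>x. 0), m)" by (simp add: initial_state_def)
  have raw': "raw_input m" using raw by (simp add: init)
  have lg1: "1 \<le> ?lg" using es by (rule bit_length_ge1)
  have "runs w main_prog (\<lambda>x. 0) m (1 + (100 * n + 20 * ?lg + 20 * L + 400) +
    (X * (30 * (X + 1) + 60) + K * (run_cost + 30) + 20)) (\<lambda>r' m'. r' 0 = (if ?path then 1 else 0))"
    unfolding main_prog_def
  proof (rule runs_Seq[OF runs_setup[OF off0 \<mu>' fit(1) fit(3)[unfolded K] lg1 raw'] _ order.refl])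
    fix r' m' assume "base_ok m' \<and> r' 12 = L * L * ?lg \<and> r' 0 = 0 \<and> (\<forall>P. regs P (r'(14 := P)))"
    then show "runs w primes_prog r' m' (X * (30 * (X + 1) + 60) + K * (run_cost + 30) + 20)
      (\<lambda>r' m'. r' 0 = (if ?path then 1 else 0))"
      unfolding K by (intro runs_primes less_bit_length lg1 fit(2)[unfolded K]) auto
  qed
  then obtain T r' m' where T: "exec w main_prog ((\<lambda>x. 0), m) T (r', m')" "r' 0 = (if ?path then 1 else 0)"
    "T \<le> 1 + (100 * n + 20 * ?lg + 20 * L + 400) + (X * (30 * (X + 1) + 60) + K * (run_cost + 30) + 20)"
    unfolding runs_def by blast
  have "T \<le> 2 ^ 17 * (D ^ 8 * (n + length es) * ?lg)"
    using T(3) total_cost_le[OF es] unfolding K by (rule le_trans)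
  moreover have "halts_with w main_prog ws T ?path"
    unfolding halts_with_def init using T(1,2) by (intro exI[of _ "(r', m')"]) simp
  ultimately show ?thesis by blast
qed

end

theorem theorem24:
  "\<exists>(P :: com) (c :: nat) (d :: nat).
     \<forall>(n :: nat) (E :: nat set set) (f :: nat \<Rightarrow> nat set set) (s :: nat) (t :: nat) (k :: nat)
       (\<mu> :: nat) (ws :: nat list) (w :: nat).
       self_deleting_graph {..<n} E f \<longrightarrow> s \<in> {..<n} \<longrightarrow> t \<in> {..<n} \<longrightarrow> k \<ge> 1 \<longrightarrow>
       \<mu> = max_deletions {..<n} f \<longrightarrow> \<mu> \<ge> 1 \<longrightarrow>
       encodes ws n E f s t k \<longrightarrow>
       real w \<ge> real d * (real (\<mu> * k) + log 2 (real n)) \<longrightarrow>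
       (\<exists>T. halts_with w P ws T (has_short_conforming_path {..<n} E f s t k) \<and>
            real T \<le> 2 ^ (c * (\<mu> * k)) * real (n + card E) * log 2 (real n))"
\<comment> \<open>The cost is at most \<open>3 * 2 ^ 17 * D ^ 8\<close> times
  \<open>(n + m) log n\<close>, the 3 coming from \<open>lg \<le> 3 log n\<close>. With
  \<open>D ^ 8 = 2 ^ (16 \<mu> k)\<close>, \<open>3 * 2 ^ 17 \<le> 2 ^ 19\<close> and
  \<open>\<mu> k \<ge> 1\<close> the exponent is at most \<open>35 \<mu> k\<close>. The 40 is the
  exponent of \<open>sizes_fit\<close>.\<close>
proof (rule exI[of _ main_prog], rule exI[of _ 35], rule exI[of _ 40], intro allI impI)
  fix n :: nat and E :: "nat set set" and f :: "nat \<Rightarrow> nat set set" and s t k \<mu> :: nat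
    and ws :: "nat list" and w :: nat
  assume graph: "self_deleting_graph {..<n} E f" and st: "s \<in> {..<n}" "t \<in> {..<n}" and k: "k \<ge> 1"
    and \<mu>: "\<mu> = max_deletions {..<n} f" "\<mu> \<ge> 1" and enc: "encodes ws n E f s t k"
    and w: "real w \<ge> real 40 * (real (\<mu> * k) + log 2 (real n))"
  obtain es fs where es: "distinct (map edge_of es)" "set (map edge_of es) = E" and len_fs: "length fs = n"
    and fs: "\<And>v. v < n \<Longrightarrow> distinct (fs ! v) \<and> set (fs ! v) \<subseteq> {..<length es} \<and>
        (\<lambda>i. edge_of (es ! i)) ` set (fs ! v) = f v"
    and ws: "ws = [n, length es, k, s, t] @ concat (map (\<lambda>(u, v). [u, v]) es) @ map length fs @ concat fs"
    using enc unfolding encodes_def by metis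
  define M where "M = length es"
  have E: "E = edge_of ` set es" using es(2) by simp
  have edge: "e \<subseteq> {..<n} \<and> card e = 2" if "e \<in> E" for e
    using graph that unfolding self_deleting_graph_def by blast
  have edges: "fst (es ! e) < n \<and> snd (es ! e) < n" if "e < length es" for e
    using edge[of "edge_of (es ! e)"] that by (auto simp: E edge_of_def)
  have len_card: "length (fs ! v) = card (f v)" if "v < n" for v
  proof -
    have "inj_on (\<lambda>i. edge_of (es ! i)) {..<length es}"
      using es(1) by (auto simp: inj_on_def distinct_conv_nth)
    then have "inj_on (\<lambda>i. edge_of (es ! i)) (set (fs ! v))"
      using fs[OF that] by (meson inj_on_subset)
    then show ?thesis using fs[OF that] by (metis card_image distinct_card)
  qed
  have n0: "{..<n} \<noteq> {}" using st by auto
  have Max: "\<mu> = Max ((\<lambda>v. card (f v)) ` {..<n})" using \<mu> by (simp add: max_deletions_def)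
  have len_f: "length (fs ! v) \<le> \<mu>" if "v < n" for v
    unfolding len_card[OF that] Max using that by (intro Max_ge) auto
  have "\<mu> \<in> (\<lambda>v. card (f v)) ` {..<n}" unfolding Max using n0 by (intro Max_in) auto
  then obtain v0 where v0: "v0 < n" "length (fs ! v0) = \<mu>" using len_card by auto
  \<comment> \<open>As \<open>\<mu> \<ge> 1\<close>, some vertex deletes an edge, so there are an
    edge and two vertices; hence \<open>log 2 n \<ge> 1\<close>.\<close>
  have "fs ! v0 \<noteq> []" using v0 \<mu>(2) by auto
  then have "hd (fs ! v0) < length es" using fs[OF v0(1)] hd_in_set[of "fs ! v0"] by blast
  then have M1: "M \<ge> 1" by (simp add: M_def)
  have n2: "n \<ge> 2"
  proof -
    have e: "edge_of (es ! 0) \<in> E" unfolding E using M1 by (intro imageI nth_mem) (auto simp: M_def)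
    have "card (edge_of (es ! 0)) \<le> card {..<n}" using edge[OF e] by (intro card_mono) auto
    then show ?thesis using edge[OF e] by simp
  qed
  have cardE: "card E = M"
    using es distinct_card[OF es(1)] by (simp add: M_def)
  have Mn: "M \<le> n * n"
  proof -
    have "distinct es" using es(1) by (simp add: distinct_map)
    then have "M = card (set es)" by (simp add: M_def distinct_card)
    also have "\<dots> \<le> card ({..<n} \<times> {..<n})"
    proof (rule card_mono)
      show "set es \<subseteq> {..<n} \<times> {..<n}"
      proof
        fix p assume "p \<in> set es"
        then obtain i where "i < length es" "es ! i = p" by (meson in_set_conv_nth)
        then show "p \<in> {..<n} \<times> {..<n}" using edges[of i] by (cases p) auto
      qed
    qed simp
    finally show ?thesis by (simp add: card_cartesian_product)
  qed
  define off where "off = (\<lambda>v. 5 + 2 * M + n + sum_list (map length (take v fs)))"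
  define CNT where "CNT = off n"
  have off_Suc: "off (Suc v) = off v + length (fs ! v)" if "v < n" for v
    using sum_list_take_Suc[of v fs] that len_fs by (simp add: off_def)
  have CNT_eq: "CNT = 5 + 2 * M + n + length (concat fs)"
    unfolding CNT_def off_def length_concat using len_fs by simp
  have off_le: "off v + length (fs ! v) \<le> CNT" if "v < n" for v
  proof -
    have "off (Suc v) \<le> off n"
      by (rule lift_Suc_mono_le_ivl[where N = "{..<n}"]) (use that in \<open>auto simp: off_Suc\<close>)
    then show ?thesis using off_Suc[OF that] by (simp add: CNT_def)
  qed
  have CNT_le: "CNT \<le> 5 + 2 * M + n + n * \<mu>"
  proof -
    have "length (concat fs) = sum_list (map length fs)" by (rule length_concat)
    also have "\<dots> \<le> sum_list (map (\<lambda>_. \<mu>) fs)"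
      using len_f len_fs by (intro sum_list_mono) (metis in_set_conv_nth)
    finally show ?thesis by (simp add: CNT_eq len_fs sum_list_triv)
  qed
  define L where "L = 2 * \<mu> * k"
  define D where "D = (2::nat) ^ L"
  define S where "S = L + 2 + D"
  define lg where "lg = bit_length M"
  define K where "K = L * L * lg"
  define X where "X = 2 * K\<^sup>2"
  have "lg \<ge> 1" unfolding lg_def using M1 by (rule bit_length_ge1)
  have pow_lg: "2 ^ (lg - 1) \<le> M" using bit_length_le[of "lg - 1" M] \<open>lg \<ge> 1\<close> by (simp add: lg_def)
  have lgM: "lg \<le> M" using pow_lg less_exp[of "lg - 1"] \<open>lg \<ge> 1\<close> by linarith
  have Z: "(2 ^ (\<mu> * k) * n) ^ 40 \<le> 2 ^ w" by (rule powers_fit[OF refl _ w]) (use n2 in simp)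
  have Lq: "L = 2 * (\<mu> * k)" by (simp add: L_def)
  note fit = sizes_fit[OF refl refl \<mu>(2) k n2 Mn M1 Lq D_def S_def CNT_le lgM K_def X_def Z]
  interpret machine n es fs f \<mu> k w L D S CNT "CNT + (k + 1) * n" s t off
    by unfold_locales
      (use es(1) edges len_fs fs len_f \<mu> k st off_le fit CNT_eq in \<open>auto simp: L_def D_def S_def M_def\<close>)
  \<comment> \<open>\<open>initial_state\<close> reduces the input words modulo
    \<open>2 ^ w\<close>; this shows that nothing is lost.\<close>
  have small: "x < 2 ^ w" if x: "x \<in> set ws" for x
  proof -
    have "M + n < 2 ^ w" using fit(1) CNT_eq by linarith
    then have Mw: "M < 2 ^ w" and nw: "n < 2 ^ w" by linarith+
    have pair: "x < n" if "x \<in> set (concat (map (\<lambda>(u, v). [u, v]) es))"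
    proof -
      from that obtain p where "p \<in> set es" "x = fst p \<or> x = snd p" by (auto split: prod.splits)
      then show ?thesis using edges by (metis in_set_conv_nth)
    qed
    have len: "x \<le> M" if "x \<in> set (map length fs)"
    proof -
      from that obtain v where v: "v < n" "x = length (fs ! v)" using len_fs by (auto simp: in_set_conv_nth)
      have "card (set (fs ! v)) \<le> card {..<M}" using fs[OF v(1)] by (intro card_mono) (auto simp: M_def)
      then show ?thesis using fs[OF v(1)] v by (simp add: distinct_card)
    qed
    have idx: "x < M" if "x \<in> set (concat fs)"
    proof -
      from that obtain xs where xs: "xs \<in> set fs" "x \<in> set xs" by auto
      then obtain v where "v < n" "fs ! v = xs" using len_fs by (metis in_set_conv_nth)
      with xs(2) have "v < n" "x \<in> set (fs ! v)" by simp_all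
      then show ?thesis using fs by (auto simp: M_def)
    qed
    consider "x \<in> {n, M, k, s, t}" | "x \<in> set (concat (map (\<lambda>(u, v). [u, v]) es))"
      | "x \<in> set (map length fs)" | "x \<in> set (concat fs)"
      using x unfolding ws M_def set_append list.set by blast
    then show ?thesis
    proof cases
      case 1
      then show ?thesis using Mw nw fit(6) st by auto
    next
      case 2
      then show ?thesis using pair nw by (meson order.strict_trans)
    next
      case 3
      then show ?thesis using len Mw by (meson le_less_trans)
    next
      case 4
      then show ?thesis using idx Mw by (meson order.strict_trans)
    qed
  qed
  define m where "m = snd (initial_state w ws)"
  have m: "m a = ws ! a" if "a < length ws" for a
    using that small[of "ws ! a"] by (simp add: m_def initial_state_def)
  have len_ws: "length ws = CNT"
    unfolding ws length_append length_concat_pairs CNT_eq by (simp add: M_def len_fs)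
  have raw: "raw_input m"
    unfolding raw_input_def M_def[symmetric]
  proof (intro conjI allI impI)
    have "5 \<le> length ws" by (simp add: ws)
    then show "m 0 = n" "m 1 = M" "m 2 = k" "m 3 = s" "m 4 = t"
      using m[of 0] m[of 1] m[of 2] m[of 3] m[of 4] by (simp_all add: ws M_def)
  next
    fix e assume e: "e < M"
    then have "5 + 2 * e < length ws" "6 + 2 * e < length ws" by (simp_all add: len_ws CNT_eq)
    moreover have "ws ! (5 + 2 * e) = fst (es ! e)" "ws ! (6 + 2 * e) = snd (es ! e)"
      using nth_concat_pairs[of e es] e length_concat_pairs[of es]
      by (simp_all add: ws M_def nth_append)
    ultimately show "m (5 + 2 * e) = fst (es ! e)" "m (6 + 2 * e) = snd (es ! e)"
      using m by simp_all
  next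
    fix v assume v: "v < n"
    have "ws ! (5 + 2 * M + v) = length (fs ! v)"
      using v len_fs length_concat_pairs[of es] by (simp add: ws M_def nth_append)
    moreover have "5 + 2 * M + v < length ws" using v by (simp add: len_ws CNT_eq)
    ultimately show "m (5 + 2 * M + v) = length (fs ! v)" using m by simp
    fix i assume i: "i < length (fs ! v)"
    have a: "off v + i < length ws" using off_le[OF v] i by (simp add: len_ws)
    have "ws ! (off v + i) = concat fs ! (sum_list (map length (take v fs)) + i)"
      using length_concat_pairs[of es] len_fs by (simp add: ws M_def off_def nth_append)
    also have "\<dots> = fs ! v ! i" using nth_concat[of v fs i] v i len_fs by simp
    finally show "m (off v + i) = fs ! v ! i" using m[OF a] by simp
  next
    fix a assume "CNT \<le> a"
    then show "m a = 0" by (simp add: m_def initial_state_def len_ws)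
  qed
  have "\<exists>T. halts_with w main_prog ws T (has_short_conforming_path {..<n} (edge_of ` set es) f s t k) \<and>
    T \<le> 2 ^ 17 * (D ^ 8 * (n + length es) * bit_length (length es))"
  proof (rule halts_with_main)
    show "off 0 = 5 + 2 * length es + n" by (simp add: off_def M_def)
    show "off (Suc v) = off v + length (fs ! v)" if "v < n" for v by (rule off_Suc[OF that])
    show "off n = CNT" by (simp add: CNT_def)
    show "\<exists>v<n. length (fs ! v) = \<mu>" using v0 by blast
    show "length es \<ge> 1" using M1 by (simp add: M_def)
    show "K = L * L * bit_length (length es)" by (simp add: K_def lg_def M_def)
    show "X = 2 * K\<^sup>2" by (simp add: X_def)
    show "(CNT + 1) * (length es + 1) < 2 ^ w" using fit(2) by (simp add: M_def)
    show "2 * (X * X) < 2 ^ w" "K < 2 ^ w" using fit(4,5) by simp_all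
    show "raw_input (snd (initial_state w ws))" using raw by (simp add: m_def)
  qed
  then obtain T where T: "halts_with w main_prog ws T (has_short_conforming_path {..<n} E f s t k)"
    "T \<le> 2 ^ 17 * (D ^ 8 * (n + M) * lg)" by (auto simp: E M_def lg_def)
  have "real T \<le> 2 ^ (35 * (\<mu> * k)) * real (n + card E) * log 2 (real n)"
  proof -
    define q where "q = \<mu> * k"
    have q1: "q \<ge> 1" using \<mu> k by (simp add: q_def)
    have ln1: "1 \<le> log 2 (real n)" using n2 by simp
    \<comment> \<open>\<open>2 ^ (lg - 1) \<le> M \<le> n * n\<close> gives
      \<open>lg \<le> 1 + 2 log n\<close>, and the 1 is paid by
      \<open>log n \<ge> 1\<close>.\<close>
    have "real lg \<le> 3 * log 2 (real n)"
    proof -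
      have "real (2 ^ (lg - 1)) \<le> real (n * n)" using pow_lg Mn by (simp only: of_nat_le_iff)
      then have "2 powr real (lg - 1) \<le> real n ^ 2" by (simp add: powr_realpow power2_eq_square)
      then have "log 2 (2 powr real (lg - 1)) \<le> log 2 (real n ^ 2)" using n2 by (subst log_le_cancel_iff) auto
      then have "real (lg - 1) \<le> 2 * log 2 (real n)" using n2 by (simp add: log_nat_power)
      then show ?thesis using \<open>lg \<ge> 1\<close> ln1 by simp
    qed
    have D8: "real D ^ 8 = 2 ^ (16 * q)"
      by (simp add: D_def Lq q_def flip: power_mult)
    have "real T \<le> real (2 ^ 17 * (D ^ 8 * (n + M) * lg))" using T(2) by (simp only: of_nat_le_iff)
    also have "\<dots> = 2 ^ 17 * (2 ^ (16 * q) * real (n + M) * real lg)" by (simp add: D8)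
    also have "\<dots> \<le> 2 ^ 17 * (2 ^ (16 * q) * real (n + M) * (3 * log 2 (real n)))"
      using \<open>real lg \<le> 3 * log 2 (real n)\<close> by (intro mult_left_mono) auto
    also have "\<dots> = (3 * 2 ^ 17 * 2 ^ (16 * q)) * (real (n + M) * log 2 (real n))" by simp
    also have "\<dots> \<le> 2 ^ (35 * q) * (real (n + M) * log 2 (real n))"
    proof (rule mult_right_mono)
      have "3 * 2 ^ 17 * 2 ^ (16 * q) \<le> (2::real) ^ 19 * 2 ^ (16 * q)" by simp
      also have "\<dots> = 2 ^ (19 + 16 * q)" by (simp only: power_add)
      also have "\<dots> \<le> 2 ^ (35 * q)" using q1 by (intro power_increasing) auto
      finally show "3 * 2 ^ 17 * 2 ^ (16 * q) \<le> (2::real) ^ (35 * q)" .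
    qed (use ln1 in simp)
    finally show ?thesis by (simp add: q_def cardE mult.assoc)
  qed
  with T(1) show "\<exists>T. halts_with w main_prog ws T (has_short_conforming_path {..<n} E f s t k) \<and>
      real T \<le> 2 ^ (35 * (\<mu> * k)) * real (n + card E) * log 2 (real n)" by blast
qed

end
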